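(* Let $0<\rho\le1$, $0\le\delta<1$, $\delta\le\rho$, $m\in\mathbb R$ and $a\in APS^m_{\rho,\delta}$. (i) If $a(x,\xi)=a(x)$ for all $x,\xi\in\mathbb R^d$ (no dependence on $\xi$), then $$\sigma_{B^2}(a(x,D))=\sigma_{B^2,\mathrm{ess}}(a(x,D))=\overline{\mathrm{Ran}(a)}.$$ (ii) If $a(x,\xi)=a(\xi)\in\mathbb R$ for all $x,\xi\in\mathbb R^d$ (real valued, no dependence on $x$), then $$\sigma_{B^2}(\overline{a(D)})=\sigma_{B^2,\mathrm{ess}}(\overline{a(D)})=\overline{\mathrm{Ran}(a)},\qquad \sigma_{B^2,\mathrm p}(\overline{a(D)})=\mathrm{Ran}(a),\qquad \sigma_{B^2,\mathrm{cont}}(\overline{a(D)})=\overline{\mathrm{Ran}(a)}\setminus\mathrm{Ran}(a).$$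
   Context: Notation: $\langle\xi\rangle=(1+|\xi|^2)^{1/2}$, $e_\lambda(x)=e^{2\pi i\lambda\cdot x}$. $TP(\mathbb R^d)$: finite linear combinations of the $e_\lambda$, $\lambda\in\mathbb R^d$. $C_{\rm ap}(\mathbb R^d)$: uniform limits of trigonometric polynomials. Mean value $\mathscr M(f)=\lim_{T\to\infty}T^{-d}\int_{[0,T]^d}f(x)\,dx$. $B^2=B^2(\mathbb R^d)$: completion of $C_{\rm ap}(\mathbb R^d)$ for $(f,g)_B=\mathscr M(f\overline g)$. $\mathrm{Ran}(a)$ is the range of the function $a$ of one variable, $\overline{\mathrm{Ran}(a)}$ its closure in $\mathbb C$. Symbols: $APS^m_{\rho,\delta}$ is the set of $a\in C^\infty(\mathbb R^{2d})$ such that $a(\cdot,\xi)\in C_{\rm ap}(\mathbb R^d)$ for all $\xi$ and $\sup_{x,\xi}\langle\xi\rangle^{-m+\rho|\alpha|-\delta|\beta|}|\partial_\xi^\alpha\partial_x^\beta a(x,\xi)|<\infty$ for all $\alpha,\beta$. Operator: $a(x,D)e_\lambda=a(\cdot,\lambda)e_\lambda$ on $TP(\mathbb R^d)$ (so in case (i) $a(x,D)$ is multiplication by $a(x)$, a bounded operator on $B^2$; in case (ii) it is the Fourier multiplier $a(D)$, $a(D)e_\lambda=a(\lambda)e_\lambda$). The bar denotes the closure in $B^2$ of the operator with domain $TP(\mathbb R^d)$. Spectrum: for a closed densely defined operator $T$ on a Hilbert space $H$, $\sigma_H(T)$ is the complement of the set of $s\in\mathbb C$ such that $T-sI$ is bijective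 onto $H$ with bounded inverse; $s\in\sigma_{H,\mathrm{ess}}(T)$ iff $T-sI$ is not Fredholm (Fredholm: closed, with finite-dimensional kernel and cokernel $H/\mathrm{Ran}$); the point spectrum $\sigma_{H,\mathrm p}(T)$ is the set of $s$ with $T-sI$ not injective; the continuous spectrum $\sigma_{H,\mathrm{cont}}(T)$ is the set of $s\in\sigma_H(T)$ with $T-sI$ injective and of dense range. *)

theory Defs
  imports "HOL-Analysis.Analysis"
begin

section \<open>Almost periodic functions and the mean value\<close>

definition expc :: "real^'n \<Rightarrow> real^'n \<Rightarrow> complex" where
  "expc \<mu> x = exp (2 * of_real pi * \<i> * of_real (\<mu> \<bullet> x))"

definition TP :: "(real^'n \<Rightarrow> complex) set" where
  "TP = {f. \<exists>S c. finite S \<and> f = (\<lambda>x. \<Sum>\<mu>\<in>S. c \<mu> * expc \<mu> x)}"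

definition C_ap :: "(real^'n \<Rightarrow> complex) set" where
  "C_ap = {f. \<exists>p. (\<forall>n. p n \<in> TP) \<and> uniform_limit UNIV p f sequentially}"

definition cube_avg :: "(real^'n \<Rightarrow> complex) \<Rightarrow> real \<Rightarrow> complex" where
  "cube_avg f T = integral (cbox 0 (\<chi> i. T)) f / of_real (T ^ CARD('n))"

definition mean_value :: "(real^'n \<Rightarrow> complex) \<Rightarrow> complex" where
  "mean_value f = Lim at_top (cube_avg f)"

lemma expc_add: "expc (\<mu> + \<nu>) x = expc \<mu> x * expc \<nu> x"
  by (simp add: expc_def inner_add_left ring_distribs exp_add)

lemma expc_0 [simp]: "expc 0 x = 1"
  by (simp add: expc_def)

lemma norm_expc [simp]: "norm (expc \<mu> x) = 1"
  by (simp add: expc_def)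

lemma cnj_expc: "cnj (expc \<mu> x) = expc (- \<mu>) x"
  by (simp add: expc_def exp_cnj)

lemma continuous_on_expc [continuous_intros]: "continuous_on A (expc \<mu>)"
  unfolding expc_def by (intro continuous_intros)

lemma TP_D: "f \<in> TP \<Longrightarrow> \<exists>S c. finite S \<and> f = (\<lambda>x. \<Sum>\<mu>\<in>S. c \<mu> * expc \<mu> x)"
  by (simp add: TP_def)

lemma TP_I: "finite S \<Longrightarrow> (\<lambda>x. \<Sum>\<mu>\<in>S. c \<mu> * expc \<mu> x) \<in> TP"
  by (auto simp: TP_def)

lemma TP_add: assumes "f \<in> TP" "g \<in> TP" shows "(\<lambda>x. f x + g x) \<in> TP"
proof -
  obtain S c where f: "finite S" "f = (\<lambda>x. \<Sum>\<mu>\<in>S. c \<mu> * expc \<mu> x)" using TP_D assms(1) by blast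
  obtain R d where g: "finite R" "g = (\<lambda>x. \<Sum>\<mu>\<in>R. d \<mu> * expc \<mu> x)" using TP_D assms(2) by blast
  let ?k = "\<lambda>\<mu>. (if \<mu> \<in> S then c \<mu> else 0) + (if \<mu> \<in> R then d \<mu> else 0)"
  have "f x + g x = (\<Sum>\<mu>\<in>S \<union> R. ?k \<mu> * expc \<mu> x)" for x
  proof -
    have "f x = (\<Sum>\<mu>\<in>S \<union> R. (if \<mu> \<in> S then c \<mu> else 0) * expc \<mu> x)"
      unfolding f using f g by (intro sum.mono_neutral_cong_left) auto
    moreover have "g x = (\<Sum>\<mu>\<in>S \<union> R. (if \<mu> \<in> R then d \<mu> else 0) * expc \<mu> x)"
      unfolding g using f g by (intro sum.mono_neutral_cong_left) auto
    ultimately show ?thesis by (simp add: sum.distrib ring_distribs)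
  qed
  then have "(\<lambda>x. f x + g x) = (\<lambda>x. \<Sum>\<mu>\<in>S \<union> R. ?k \<mu> * expc \<mu> x)" by auto
  then show ?thesis using TP_I[of "S \<union> R" ?k] f g by simp
qed

lemma TP_monom: "(\<lambda>x. c * expc \<mu> x) \<in> TP"
  using TP_I[of "{\<mu>}" "\<lambda>_. c"] by simp

lemma TP_const: "(\<lambda>x. c) \<in> TP"
  using TP_monom[of c 0] by simp

lemma TP_sum: "finite I \<Longrightarrow> (\<And>i. i \<in> I \<Longrightarrow> f i \<in> TP) \<Longrightarrow> (\<lambda>x. \<Sum>i\<in>I. f i x) \<in> TP"
  by (induction I rule: finite_induct) (auto intro: TP_add TP_const)

lemma TP_mult: assumes "f \<in> TP" "g \<in> TP" shows "(\<lambda>x. f x * g x) \<in> TP"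
proof -
  obtain S c where f: "finite S" "f = (\<lambda>x. \<Sum>\<mu>\<in>S. c \<mu> * expc \<mu> x)" using TP_D assms(1) by blast
  obtain R d where g: "finite R" "g = (\<lambda>x. \<Sum>\<mu>\<in>R. d \<mu> * expc \<mu> x)" using TP_D assms(2) by blast
  have "(\<lambda>x. \<Sum>\<mu>\<in>S. \<Sum>\<nu>\<in>R. (c \<mu> * d \<nu>) * expc (\<mu> + \<nu>) x) \<in> TP"
    by (intro TP_sum TP_monom f g)
  also have "(\<lambda>x. \<Sum>\<mu>\<in>S. \<Sum>\<nu>\<in>R. (c \<mu> * d \<nu>) * expc (\<mu> + \<nu>) x) = (\<lambda>x. f x * g x)"
    by (simp add: f g sum_product expc_add mult_ac)
  finally show ?thesis .
qed

lemma TP_cmult: "f \<in> TP \<Longrightarrow> (\<lambda>x. c * f x) \<in> TP"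
  using TP_mult[OF TP_const] by blast

lemma TP_cnj: assumes "f \<in> TP" shows "(\<lambda>x. cnj (f x)) \<in> TP"
proof -
  obtain S c where f: "finite S" "f = (\<lambda>x. \<Sum>\<mu>\<in>S. c \<mu> * expc \<mu> x)" using TP_D assms(1) by blast
  have "(\<lambda>x. \<Sum>\<mu>\<in>S. cnj (c \<mu>) * expc (-\<mu>) x) \<in> TP"
    by (intro TP_sum TP_monom f)
  then show ?thesis by (simp add: f cnj_expc)
qed

lemma TP_continuous: "f \<in> TP \<Longrightarrow> continuous_on A f"
  by (auto simp: TP_def intro!: continuous_intros)

lemma TP_bounded: assumes "f \<in> TP" shows "\<exists>B. \<forall>x. norm (f x) \<le> B"
proof -
  obtain S c where f: "finite S" "f = (\<lambda>x. \<Sum>\<mu>\<in>S. c \<mu> * expc \<mu> x)" using TP_D assms(1) by blast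
  have "norm (f x) \<le> (\<Sum>\<mu>\<in>S. norm (c \<mu>))" for x
    unfolding f by (rule sum_norm_le) (simp add: norm_mult)
  then show ?thesis by blast
qed

lemma CapI: "(\<And>n. p n \<in> TP) \<Longrightarrow> uniform_limit UNIV p f sequentially \<Longrightarrow> f \<in> C_ap"
  by (auto simp: C_ap_def)

lemma CapE: assumes "f \<in> C_ap"
  obtains p where "\<And>n. p n \<in> TP" "uniform_limit UNIV p f sequentially"
  using assms by (auto simp: C_ap_def)

lemma TP_Cap: "f \<in> TP \<Longrightarrow> f \<in> C_ap"
  by (rule CapI[of "\<lambda>_. f"]) (auto intro: uniform_limit_const)

lemma Cap_continuous: assumes "f \<in> C_ap" shows "continuous_on UNIV f"
proof -
  obtain p where p: "\<And>n. p n \<in> TP" "uniform_limit UNIV p f sequentially" using CapE assms by blast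
  show ?thesis
    by (rule uniform_limit_theorem[OF _ p(2)]) (simp_all add: TP_continuous p(1))
qed

lemma Cap_bounded_range: assumes "f \<in> C_ap" shows "bounded (range f)"
proof -
  obtain p where p: "\<And>n. p n \<in> TP" "uniform_limit UNIV p f sequentially" using CapE assms by blast
  have "bounded (range (p n))" for n using TP_bounded[OF p(1)[of n]] by (auto simp: bounded_iff)
  then show ?thesis
    by (intro uniform_limit_bounded[OF p(2)]) auto
qed

lemma Cap_bounded: assumes "f \<in> C_ap" obtains B where "B > 0" "\<And>x. norm (f x) \<le> B"
  using Cap_bounded_range[OF assms] that by (auto simp: bounded_pos)

lemma Cap_add: assumes "f \<in> C_ap" "g \<in> C_ap" shows "(\<lambda>x. f x + g x) \<in> C_ap"
proof -
  obtain p where p: "\<And>n. p n \<in> TP" "uniform_limit UNIV p f sequentially" using CapE assms by blast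
  obtain q where q: "\<And>n. q n \<in> TP" "uniform_limit UNIV q g sequentially" using CapE assms by blast
  show ?thesis
    by (rule CapI[of "\<lambda>n x. p n x + q n x"]) (intro TP_add uniform_limit_intros p q)+
qed

lemma Cap_mult: assumes "f \<in> C_ap" "g \<in> C_ap" shows "(\<lambda>x. f x * g x) \<in> C_ap"
proof -
  obtain p where p: "\<And>n. p n \<in> TP" "uniform_limit UNIV p f sequentially" using CapE assms by blast
  obtain q where q: "\<And>n. q n \<in> TP" "uniform_limit UNIV q g sequentially" using CapE assms by blast
  have "bounded (range f)" "bounded (range g)"
    using Cap_bounded_range assms by blast+
  then show ?thesis
    by (intro CapI[of "\<lambda>n x. p n x * q n x"] TP_mult uniform_lim_mult p q)
qed

lemma Cap_cnj: assumes "f \<in> C_ap" shows "(\<lambda>x. cnj (f x)) \<in> C_ap"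
proof -
  obtain p where p: "\<And>n. p n \<in> TP" "uniform_limit UNIV p f sequentially" using CapE assms by blast
  have "uniform_limit UNIV (\<lambda>n x. cnj (p n x)) (\<lambda>x. cnj (f x)) sequentially"
    using p(2) by (rule bounded_linear.uniform_limit[OF bounded_linear_cnj])
  with p show ?thesis by (intro CapI[of "\<lambda>n x. cnj (p n x)"] TP_cnj)
qed

lemma Cap_const: "(\<lambda>x. c) \<in> C_ap"
  by (intro TP_Cap TP_const)

lemma Cap_cmult: "f \<in> C_ap \<Longrightarrow> (\<lambda>x. c * f x) \<in> C_ap"
  by (intro Cap_mult Cap_const)

lemma Cap_minus: "f \<in> C_ap \<Longrightarrow> (\<lambda>x. - f x) \<in> C_ap"
  using Cap_cmult[of f "-1"] by simp

lemma Cap_diff: "f \<in> C_ap \<Longrightarrow> g \<in> C_ap \<Longrightarrow> (\<lambda>x. f x - g x) \<in> C_ap"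
  using Cap_add[OF _ Cap_minus, of f g] by simp

lemma Cap_integrable: "f \<in> C_ap \<Longrightarrow> f integrable_on cbox a b"
  by (intro integrable_continuous continuous_on_subset[OF Cap_continuous]) auto

lemma content_slab:
  fixes j :: "'n::finite"
  assumes "t \<ge> 0" "T \<ge> 0" "\<And>i. b $ i - a $ i = (if i = j then t else T)"
  shows "measure lborel (cbox a b :: (real^'n) set) = t * T ^ (CARD('n) - 1)"
proof -
  have "a $ i \<le> b $ i" for i using assms(1,2) assms(3)[of i] by (auto split: if_splits)
  then have "measure lborel (cbox a b) = (\<Prod>i\<in>UNIV. b $ i - a $ i)"
    by (intro content_cbox_cart) (auto simp: interval_ne_empty_cart)
  also have "\<dots> = (\<Prod>i\<in>UNIV. if i = j then t else T)" by (simp add: assms)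
  also have "\<dots> = t * (\<Prod>i\<in>UNIV - {j}. T)"
    by (subst prod.remove[of _ j]) (auto intro!: prod.cong)
  finally show ?thesis by (simp add: card_Diff_singleton)
qed

lemma cbox_split_cart:
  fixes a b :: "real^'n"
  shows "cbox a b \<inter> {x. x $ k \<le> c} = cbox a (\<chi> i. if i = k then min (b $ k) c else b $ i)"
    and "cbox a b \<inter> {x. x $ k \<ge> c} = cbox (\<chi> i. if i = k then max (a $ k) c else a $ i) b"
  using interval_split_cart(1)[where a=a and b=b and k=k and c=c] interval_split_cart(2)[where a=a and b=b and k=k and c=c]
  by (simp_all add: interval_cbox_cart)

lemma cube_avg_expc:
  fixes \<mu> :: "real^'n"
  assumes "\<mu> \<noteq> 0" shows "(cube_avg (expc \<mu>) \<longlongrightarrow> 0) at_top"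
proof -
  obtain j where j: "\<mu> $ j \<noteq> 0" using assms by (metis vec_eq_iff zero_index)
  define t where "t = 1 / (2 * \<bar>\<mu> $ j\<bar>)"
  have t: "t > 0" using j by (simp add: t_def)
  define h :: "real^'n" where "h = axis j t"
  have muh: "\<mu> \<bullet> h = 1/2 \<or> \<mu> \<bullet> h = - (1/2)"
    using j by (auto simp: h_def t_def inner_axis field_simps abs_if)
  have eh: "expc \<mu> (h + x) = - expc \<mu> x" for x
  proof -
    have "exp (2 * of_real pi * \<i> * of_real (\<mu> \<bullet> h)) = -1"
    proof -
      have "of_real (\<mu> \<bullet> h) = (1/2 :: complex) \<or> of_real (\<mu> \<bullet> h) = (- (1/2) :: complex)"
        by (rule disjE[OF muh]) (simp_all only: of_real_divide of_real_minus of_real_1 of_real_numeral, simp_all)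
      then have "2 * of_real pi * \<i> * of_real (\<mu> \<bullet> h) = (of_real pi * \<i> :: complex) \<or>
            2 * of_real pi * \<i> * of_real (\<mu> \<bullet> h) = (- (of_real pi * \<i>) :: complex)"
        by (elim disjE) (simp_all only:, simp_all)
      then show ?thesis by (elim disjE) (simp_all only: exp_minus exp_pi_i inverse_minus_eq inverse_1)
    qed
    then show ?thesis by (simp add: expc_def inner_add_right ring_distribs exp_add)
  qed
  let ?one = "\<lambda>T. (\<chi> i. T) :: real^'n"
  have bnd: "norm (cube_avg (expc \<mu>) T) \<le> t / T" if T: "T > t" for T
  proof -
    let ?f = "expc \<mu>"
    have int: "?f integrable_on cbox a b" for a b
      by (intro Cap_integrable TP_Cap) (use TP_monom[of 1] in simp)
    let ?Q = "cbox 0 (?one T)"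
    let ?A = "cbox 0 (\<chi> i. if i = j then t else T)"
    let ?M = "cbox (\<chi> i. if i = j then t else 0) (?one T)"
    let ?B = "cbox (\<chi> i. if i = j then T else 0) (\<chi> i. if i = j then T + t else T)"
    have ax: "x \<bullet> axis j 1 = x $ j" for x :: "real^'n" by (simp add: inner_axis)
    have hi: "h $ i = (if i = j then t else 0)" for i by (simp add: h_def axis_def)
    have "integral ?Q ?f = integral (?Q \<inter> {x. x \<bullet> axis j 1 \<le> t}) ?f + integral (?Q \<inter> {x. x \<bullet> axis j 1 \<ge> t}) ?f"
      by (rule integral_split[OF int]) (simp add: axis_in_Basis_iff)
    also have "?Q \<inter> {x. x \<bullet> axis j 1 \<le> t} = ?A"
      using T t unfolding ax cbox_split_cart by (auto simp: vec_eq_iff intro!: arg_cong2[where f=cbox])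
    also have "?Q \<inter> {x. x \<bullet> axis j 1 \<ge> t} = ?M"
      using T t unfolding ax cbox_split_cart by (auto simp: vec_eq_iff intro!: arg_cong2[where f=cbox])
    finally have 1: "integral ?Q ?f = integral ?A ?f + integral ?M ?f" .
    have "integral (cbox (0 + h) (?one T + h)) ?f = integral (cbox (0 + h) (?one T + h) \<inter> {x. x \<bullet> axis j 1 \<le> T}) ?f 
        + integral (cbox (0 + h) (?one T + h) \<inter> {x. x \<bullet> axis j 1 \<ge> T}) ?f"
      by (rule integral_split[OF int]) (simp add: axis_in_Basis_iff)
    also have "cbox (0 + h) (?one T + h) \<inter> {x. x \<bullet> axis j 1 \<le> T} = ?M"
      using T t unfolding ax cbox_split_cart by (auto simp: vec_eq_iff hi intro!: arg_cong2[where f=cbox])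
    also have "cbox (0 + h) (?one T + h) \<inter> {x. x \<bullet> axis j 1 \<ge> T} = ?B"
      using T t unfolding ax cbox_split_cart by (auto simp: vec_eq_iff hi intro!: arg_cong2[where f=cbox])
    also have "integral (cbox (0 + h) (?one T + h)) ?f = integral ?Q (?f \<circ> ((+) h))"
      by (simp only: integral_shift_cbox_plus)
    also have "?f \<circ> ((+) h) = (\<lambda>x. - ?f x)" by (auto simp: eh)
    finally have 2: "- integral ?Q ?f = integral ?M ?f + integral ?B ?f" by simp
    have "norm (integral ?A ?f) \<le> 1 * measure lborel ?A"
      by (rule integrable_bound[OF _ int]) auto
    also have "measure lborel ?A = t * T ^ (CARD('n) - 1)"
      using T t by (intro content_slab[where j=j]) auto
    finally have 3: "norm (integral ?A ?f) \<le> t * T ^ (CARD('n) - 1)" by simp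
    have "norm (integral ?B ?f) \<le> 1 * measure lborel ?B"
      by (rule integrable_bound[OF _ int]) auto
    also have "measure lborel ?B = t * T ^ (CARD('n) - 1)"
      using T t by (intro content_slab[where j=j]) auto
    finally have 4: "norm (integral ?B ?f) \<le> t * T ^ (CARD('n) - 1)" by simp
    have "2 * integral ?Q ?f = integral ?A ?f - integral ?B ?f"
      using arg_cong2[where f="(-)", OF 1 2] by simp
    then have "norm (2 * integral ?Q ?f) \<le> 2 * (t * T ^ (CARD('n) - 1))"
      using 3 4 norm_triangle_ineq4[of "integral ?A ?f" "integral ?B ?f"] by simp
    then have "norm (integral ?Q ?f) \<le> t * T ^ (CARD('n) - 1)" by (simp add: norm_mult)
    moreover have "T ^ CARD('n) = T * T ^ (CARD('n) - 1)"
      by (metis One_nat_def Suc_pred power_Suc zero_less_card_finite)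
    moreover have "norm (cube_avg ?f T) = norm (integral ?Q ?f) / T ^ CARD('n)"
      using T t by (simp add: cube_avg_def norm_divide del: of_real_power)
    moreover have "T ^ (CARD('n) - 1) > 0" using T t by simp
    ultimately have "norm (cube_avg ?f T) \<le> t * T ^ (CARD('n) - 1) / (T * T ^ (CARD('n) - 1))"
      using T t by (simp only:) (rule divide_right_mono, auto)
    with \<open>T ^ (CARD('n) - 1) > 0\<close> show ?thesis using T t by simp
  qed
  have "((\<lambda>T. t / T) \<longlongrightarrow> 0) at_top"
    by (intro tendsto_divide_0[OF tendsto_const] filterlim_at_top_imp_at_infinity filterlim_ident)
  moreover have "\<forall>\<^sub>F T in at_top. norm (cube_avg (expc \<mu>) T) \<le> t / T"
    using eventually_gt_at_top[of t] by eventually_elim (rule bnd)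
  ultimately show ?thesis by (rule Lim_null_comparison[rotated])
qed

lemma cube_avg_add: "f \<in> C_ap \<Longrightarrow> g \<in> C_ap \<Longrightarrow> cube_avg (\<lambda>x. f x + g x) = (\<lambda>T. cube_avg f T + cube_avg g T)"
  by (simp add: fun_eq_iff cube_avg_def integral_add Cap_integrable add_divide_distrib)

lemma cube_avg_cmult: "cube_avg (\<lambda>x. c * f x) = (\<lambda>T. c * cube_avg f T)"
  by (simp add: fun_eq_iff cube_avg_def)

lemma cube_avg_cnj: "cube_avg (\<lambda>x. cnj (f x)) = (\<lambda>T. cnj (cube_avg f T))"
  by (simp add: fun_eq_iff cube_avg_def integral_cnj)

lemma cube_avg_diff: "f \<in> C_ap \<Longrightarrow> g \<in> C_ap \<Longrightarrow> cube_avg (\<lambda>x. f x - g x) = (\<lambda>T. cube_avg f T - cube_avg g T)"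
  by (simp add: fun_eq_iff cube_avg_def integral_diff Cap_integrable diff_divide_distrib)

lemma content_cube: "T \<ge> 0 \<Longrightarrow> measure lborel (cbox 0 (\<chi> i. T) :: (real^'n) set) = T ^ CARD('n)"
  by (subst content_cbox_cart) (auto simp: interval_ne_empty_cart)

lemma cube_avg_bound:
  fixes f :: "real^'n \<Rightarrow> complex"
  assumes "f \<in> C_ap" "T > 0" "\<And>x. norm (f x) \<le> B" shows "norm (cube_avg f T) \<le> B"
proof -
  have B: "B \<ge> 0" using assms(3)[of 0] norm_ge_zero order_trans by blast
  let ?Q = "cbox 0 (\<chi> i. T) :: (real^'n) set"
  have "norm (integral ?Q f) \<le> B * measure lborel ?Q"
    by (rule integrable_bound[OF B Cap_integrable[OF assms(1)] assms(3)])
  then have "norm (integral ?Q f) \<le> B * T ^ CARD('n)"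
    using assms(2) by (simp add: content_cube)
  then show ?thesis
    using assms(2) by (simp add: cube_avg_def norm_divide divide_le_eq del: of_real_power)
qed

lemma cube_avg_expc_tendsto:
  fixes \<mu> :: "real^'n"
  shows "(cube_avg (expc \<mu>) \<longlongrightarrow> (if \<mu> = 0 then 1 else 0)) at_top"
proof (cases "\<mu> = 0")
  case True
  have e0: "expc 0 = (\<lambda>x :: real^'n. 1)" by auto
  have "\<forall>\<^sub>F T in at_top. 1 = cube_avg (expc (0 :: real^'n)) T"
    using eventually_gt_at_top[of 0]
    by eventually_elim (simp add: cube_avg_def content_cube scaleR_conv_of_real e0)
  then show ?thesis using True
    by (simp add: tendsto_eventually eventually_mono)
next
  case False
  then show ?thesis using cube_avg_expc by simp
qed

lemma cube_avg_TP_sum: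
  assumes "finite S"
  shows "(cube_avg (\<lambda>x. \<Sum>\<mu>\<in>S. c \<mu> * expc \<mu> x) \<longlongrightarrow> (\<Sum>\<mu>\<in>S. c \<mu> * (if \<mu> = 0 then 1 else 0))) at_top"
  using assms
proof (induction S rule: finite_induct)
  case empty
  then show ?case by (simp add: cube_avg_def)
next
  case (insert \<mu> S)
  have "(\<lambda>x. \<Sum>\<mu>\<in>insert \<mu> S. c \<mu> * expc \<mu> x) = (\<lambda>x. c \<mu> * expc \<mu> x + (\<Sum>\<mu>\<in>S. c \<mu> * expc \<mu> x))"
    using insert.hyps by simp
  then have *: "cube_avg (\<lambda>x. \<Sum>\<mu>\<in>insert \<mu> S. c \<mu> * expc \<mu> x)
      = (\<lambda>T. c \<mu> * cube_avg (expc \<mu>) T + cube_avg (\<lambda>x. \<Sum>\<mu>\<in>S. c \<mu> * expc \<mu> x) T)"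
    using insert.hyps
    by (simp only: cube_avg_cmult cube_avg_add TP_Cap TP_monom TP_I)
  show ?case
    unfolding *
    by (subst sum.insert[OF insert.hyps], intro tendsto_add tendsto_mult tendsto_const cube_avg_expc_tendsto insert.IH)
qed

lemma mean_eqI: "(cube_avg f \<longlongrightarrow> c) at_top \<Longrightarrow> mean_value f = c"
  unfolding mean_value_def by (rule tendsto_Lim) auto

lemma mean_tendsto_TP: assumes "f \<in> TP" shows "(cube_avg f \<longlongrightarrow> mean_value f) at_top"
proof -
  obtain S c where "finite S" "f = (\<lambda>x. \<Sum>\<mu>\<in>S. c \<mu> * expc \<mu> x)" using TP_D assms by blast
  then have "\<exists>l. (cube_avg f \<longlongrightarrow> l) at_top" using cube_avg_TP_sum by blast
  then show ?thesis using mean_eqI by blast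
qed

lemma limit_norm_bound:
  assumes f: "f \<in> C_ap" and l: "(cube_avg f \<longlongrightarrow> l) at_top" and B: "\<And>x. norm (f x) \<le> B"
  shows "norm l \<le> B"
proof (rule tendsto_upperbound[OF tendsto_norm[OF l]])
  show "\<forall>\<^sub>F T in at_top. norm (cube_avg f T) \<le> B"
    using eventually_gt_at_top[of 0] by eventually_elim (rule cube_avg_bound[OF f _ B])
qed simp

lemma mean_tendsto: assumes f: "f \<in> C_ap" shows "(cube_avg f \<longlongrightarrow> mean_value f) at_top"
proof -
  obtain p where p: "\<And>n. p n \<in> TP" "uniform_limit UNIV p f sequentially" using CapE assms by blast
  have ev: "\<exists>N. \<forall>n\<ge>N. \<forall>x. norm (p n x - f x) < e" if "e > 0" for e
    using uniform_limitD[OF p(2) that] by (auto simp: eventually_sequentially dist_norm)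
  have "Cauchy (\<lambda>n. mean_value (p n))"
  proof (rule metric_CauchyI)
    fix e :: real assume e: "e > 0"
    then obtain N where N: "\<And>n x. n \<ge> N \<Longrightarrow> norm (p n x - f x) < e/4" using ev[of "e/4"] by auto
    have "dist (mean_value (p m)) (mean_value (p n)) < e" if "m \<ge> N" "n \<ge> N" for m n
    proof -
      have t: "(cube_avg (\<lambda>x. p m x - p n x) \<longlongrightarrow> mean_value (p m) - mean_value (p n)) at_top"
        using tendsto_diff[OF mean_tendsto_TP[OF p(1)[of m]] mean_tendsto_TP[OF p(1)[of n]]]
        by (simp add: cube_avg_diff TP_Cap p(1))
      have "norm (p m x - p n x) \<le> e/2" for x
        using norm_triangle_ineq4[of "p m x - f x" "p n x - f x"] N[OF that(1), of x] N[OF that(2), of x] by simp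
      then have "norm (mean_value (p m) - mean_value (p n)) \<le> e/2"
        by (intro limit_norm_bound[OF _ t] Cap_diff TP_Cap p(1))
      then show ?thesis using e by (simp add: dist_norm)
    qed
    then show "\<exists>M. \<forall>m\<ge>M. \<forall>n\<ge>M. dist (mean_value (p m)) (mean_value (p n)) < e" by blast
  qed
  then obtain l where l: "(\<lambda>n. mean_value (p n)) \<longlonglongrightarrow> l" by (auto simp: Cauchy_convergent_iff convergent_def)
  have "(cube_avg f \<longlongrightarrow> l) at_top"
  proof (rule tendstoI)
    fix e :: real assume e: "e > 0"
    obtain N where N: "\<And>n x. n \<ge> N \<Longrightarrow> norm (p n x - f x) < e/3" using ev[of "e/3"] e by auto
    obtain M where M: "\<And>n. n \<ge> M \<Longrightarrow> norm (mean_value (p n) - l) < e/3"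
      using LIMSEQ_D[OF l, of "e/3"] e by auto
    define n where "n = max N M"
    have "\<forall>\<^sub>F T in at_top. dist (cube_avg (p n) T) (mean_value (p n)) < e/3"
      using tendstoD[OF mean_tendsto_TP[OF p(1)[of n]], of "e/3"] e by simp
    then show "\<forall>\<^sub>F T in at_top. dist (cube_avg f T) l < e"
      using eventually_gt_at_top[of 0]
    proof eventually_elim
      case (elim T)
      have "norm (cube_avg (\<lambda>x. p n x - f x) T) \<le> e/3"
        using N[of n] by (intro cube_avg_bound Cap_diff f TP_Cap p(1) elim) (auto simp: n_def less_imp_le)
      then have "dist (cube_avg (p n) T) (cube_avg f T) \<le> e/3"
        by (simp add: cube_avg_diff f TP_Cap p(1) dist_norm)
      moreover have "dist (mean_value (p n)) l < e/3" using M[of n] by (simp add: n_def dist_norm)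
      ultimately show ?case using elim(1)
        using dist_triangle[of "cube_avg f T" l "cube_avg (p n) T"] 
          dist_triangle[of "cube_avg (p n) T" l "mean_value (p n)"] by (simp add: dist_commute)
    qed
  qed
  then show ?thesis using mean_eqI by blast
qed

lemma mean_add: "f \<in> C_ap \<Longrightarrow> g \<in> C_ap \<Longrightarrow> mean_value (\<lambda>x. f x + g x) = mean_value f + mean_value g"
  using tendsto_add[OF mean_tendsto mean_tendsto, of f g]
  by (intro mean_eqI) (simp add: cube_avg_add)

lemma mean_cmult: "f \<in> C_ap \<Longrightarrow> mean_value (\<lambda>x. c * f x) = c * mean_value f"
  using tendsto_mult[OF tendsto_const mean_tendsto, of f c]
  by (intro mean_eqI) (simp add: cube_avg_cmult)

lemma mean_cnj: "f \<in> C_ap \<Longrightarrow> mean_value (\<lambda>x. cnj (f x)) = cnj (mean_value f)"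
  using tendsto_cnj[OF mean_tendsto, of f]
  by (intro mean_eqI) (simp add: cube_avg_cnj)

lemma mean_bound: "f \<in> C_ap \<Longrightarrow> (\<And>x. norm (f x) \<le> B) \<Longrightarrow> norm (mean_value f) \<le> B"
  using limit_norm_bound mean_tendsto by blast

lemma mean_Re_nonneg:
  fixes f :: "real^'n \<Rightarrow> complex"
  assumes f: "f \<in> C_ap" and p: "\<And>x. Re (f x) \<ge> 0" shows "Re (mean_value f) \<ge> 0"
proof (rule tendsto_lowerbound[OF tendsto_Re[OF mean_tendsto[OF f]]])
  show "\<forall>\<^sub>F T in at_top. 0 \<le> Re (cube_avg f T)"
    using eventually_gt_at_top[of 0]
  proof eventually_elim
    case (elim T)
    have "Re (integral (cbox 0 (\<chi> i. T)) f) = integral (cbox 0 (\<chi> i. T)) (\<lambda>x. Re (f x))"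
      using integral_linear[OF Cap_integrable[OF f] bounded_linear_Re] by (simp add: o_def)
    also have "\<dots> \<ge> 0" using p by (intro integral_nonneg integrable_linear[OF Cap_integrable[OF f] bounded_linear_Re, unfolded o_def])
    finally show ?case using elim by (simp add: cube_avg_def del: of_real_power)
  qed
qed simp

section \<open>The Besicovitch space as the Hilbert space completion of \<open>C_ap\<close>\<close>

definition ipB :: "(real^'n \<Rightarrow> complex) \<Rightarrow> (real^'n \<Rightarrow> complex) \<Rightarrow> complex" where
  "ipB f g = mean_value (\<lambda>x. f x * cnj (g x))"

definition normB :: "(real^'n \<Rightarrow> complex) \<Rightarrow> real" where
  "normB f = sqrt (Re (ipB f f))"

lemma ipB_add_left: "f \<in> C_ap \<Longrightarrow> g \<in> C_ap \<Longrightarrow> h \<in> C_ap \<Longrightarrow> ipB (\<lambda>x. f x + g x) h = ipB f h + ipB g h"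
  by (simp add: ipB_def ring_distribs mean_add Cap_mult Cap_cnj)

lemma ipB_cmult_left: "f \<in> C_ap \<Longrightarrow> g \<in> C_ap \<Longrightarrow> ipB (\<lambda>x. c * f x) g = c * ipB f g"
  by (simp add: ipB_def mult.assoc mean_cmult Cap_mult Cap_cnj)

lemma ipB_cnj: "f \<in> C_ap \<Longrightarrow> g \<in> C_ap \<Longrightarrow> cnj (ipB f g) = ipB g f"
  by (simp add: ipB_def mean_cnj[symmetric] Cap_mult Cap_cnj mult.commute)

lemma ipB_diff_left: "f \<in> C_ap \<Longrightarrow> g \<in> C_ap \<Longrightarrow> h \<in> C_ap \<Longrightarrow> ipB (\<lambda>x. f x - g x) h = ipB f h - ipB g h"
  using ipB_add_left[of f "\<lambda>x. (-1) * g x" h] ipB_cmult_left[of g h "-1"] Cap_cmult[of g "-1"] by simp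

lemma ipB_add_right:
  assumes "f \<in> C_ap" "g \<in> C_ap" "h \<in> C_ap"
  shows "ipB h (\<lambda>x. f x + g x) = ipB h f + ipB h g"
proof -
  have "ipB h (\<lambda>x. f x + g x) = cnj (ipB (\<lambda>x. f x + g x) h)"
    using assms by (simp add: ipB_cnj Cap_add)
  also have "\<dots> = cnj (ipB f h) + cnj (ipB g h)" using assms by (simp add: ipB_add_left)
  finally show ?thesis using assms by (simp add: ipB_cnj)
qed

lemma ipB_cmult_right:
  assumes "f \<in> C_ap" "g \<in> C_ap"
  shows "ipB f (\<lambda>x. c * g x) = cnj c * ipB f g"
proof -
  have "ipB f (\<lambda>x. c * g x) = cnj (ipB (\<lambda>x. c * g x) f)"
    using assms by (simp add: ipB_cnj Cap_cmult)
  also have "\<dots> = cnj c * cnj (ipB g f)" using assms by (simp add: ipB_cmult_left)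
  finally show ?thesis using assms by (simp add: ipB_cnj)
qed

lemma ipB_diff_right:
  assumes "f \<in> C_ap" "g \<in> C_ap" "h \<in> C_ap"
  shows "ipB h (\<lambda>x. f x - g x) = ipB h f - ipB h g"
proof -
  have "ipB h (\<lambda>x. f x - g x) = cnj (ipB (\<lambda>x. f x - g x) h)"
    using assms by (simp add: ipB_cnj Cap_diff)
  also have "\<dots> = cnj (ipB f h) - cnj (ipB g h)" using assms by (simp add: ipB_diff_left)
  finally show ?thesis using assms by (simp add: ipB_cnj)
qed

lemma ipB_ge_0: "f \<in> C_ap \<Longrightarrow> Re (ipB f f) \<ge> 0"
  unfolding ipB_def by (intro mean_Re_nonneg Cap_mult Cap_cnj) auto

lemma ipB_self: "f \<in> C_ap \<Longrightarrow> ipB f f = of_real ((normB f)\<^sup>2)"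
  using ipB_cnj[of f f] ipB_ge_0[of f] by (auto simp: normB_def complex_eq_iff)

lemma normB_ge_0: "normB f \<ge> 0 \<or> f \<notin> C_ap"
  using ipB_ge_0 by (auto simp: normB_def)

lemma normB_nonneg: "f \<in> C_ap \<Longrightarrow> normB f \<ge> 0"
  using normB_ge_0 by auto

lemma normB_cmult: "f \<in> C_ap \<Longrightarrow> normB (\<lambda>x. c * f x) = norm c * normB f"
proof -
  assume f: "f \<in> C_ap"
  have "ipB (\<lambda>x. c * f x) (\<lambda>x. c * f x) = (c * cnj c) * ipB f f"
    by (simp add: ipB_cmult_left ipB_cmult_right Cap_cmult f)
  also have "c * cnj c = of_real ((norm c)\<^sup>2)" by (rule complex_norm_square[symmetric])
  finally have "Re (ipB (\<lambda>x. c * f x) (\<lambda>x. c * f x)) = (norm c)\<^sup>2 * Re (ipB f f)"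
    by (simp del: of_real_power)
  then show ?thesis by (simp add: normB_def real_sqrt_mult)
qed

lemma normB_le_sup: 
  assumes "f \<in> C_ap" "\<And>x. norm (f x) \<le> B" shows "normB f \<le> B"
proof -
  have B: "B \<ge> 0" using assms(2)[of 0] norm_ge_zero order_trans by blast
  have "norm (ipB f f) \<le> B * B"
    unfolding ipB_def using assms B by (intro mean_bound Cap_mult Cap_cnj) (auto simp: norm_mult intro!: mult_mono)
  then have "Re (ipB f f) \<le> B\<^sup>2" using complex_Re_le_cmod[of "ipB f f"] by (simp add: power2_eq_square)
  then show ?thesis using B by (simp add: normB_def real_le_lsqrt real_sqrt_le_iff)
qed

lemma Re_ipB_le:
  assumes f: "f \<in> C_ap" and g: "g \<in> C_ap" shows "Re (ipB f g) \<le> normB f * normB g"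
proof -
  define a b c where "a = normB f" and "b = Re (ipB f g)" and "c = normB g"
  have nn: "a \<ge> 0" "c \<ge> 0" using normB_nonneg f g by (auto simp: a_def c_def)
  have q: "s\<^sup>2 * a\<^sup>2 - 2 * s * t * b + t\<^sup>2 * c\<^sup>2 \<ge> 0" for s t :: real
  proof -
    let ?S = "of_real s :: complex" and ?T = "of_real t :: complex"
    have b': "Re (ipB g f) = b" using ipB_cnj[OF f g] by (metis b_def complex_cnj(1) complex_surj cnj.sel(1))
    have "0 \<le> Re (ipB (\<lambda>x. ?S * f x - ?T * g x) (\<lambda>x. ?S * f x - ?T * g x))"
      by (intro ipB_ge_0 Cap_diff Cap_cmult f g)
    also have "ipB (\<lambda>x. ?S * f x - ?T * g x) (\<lambda>x. ?S * f x - ?T * g x)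
      = of_real (s * s) * ipB f f - of_real (s * t) * ipB f g - of_real (s * t) * ipB g f + of_real (t * t) * ipB g g"
      by (simp add: ipB_diff_left ipB_diff_right ipB_cmult_left ipB_cmult_right Cap_cmult Cap_diff f g algebra_simps)
    also have "Re \<dots> = s\<^sup>2 * a\<^sup>2 - 2 * s * t * b + t\<^sup>2 * c\<^sup>2"
      using ipB_self[OF f] ipB_self[OF g] b' 
      by (simp add: a_def c_def b_def[symmetric] power2_eq_square algebra_simps)
    finally show ?thesis .
  qed
  consider "a > 0 \<and> c > 0" | "a = 0" | "c = 0" using nn by linarith
  then have "b \<le> a * c"
  proof cases
    case 1
    have "2 * (a * c) * (a * c - b) \<ge> 0" using q[of c a] by (simp add: power2_eq_square algebra_simps)
    moreover have "a * c > 0" using 1 by simp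
    ultimately show ?thesis by (simp add: zero_le_mult_iff)
  next
    case 2
    show ?thesis
    proof (rule ccontr)
      assume "\<not> b \<le> a * c"
      then have b: "b > 0" using 2 by simp
      have "(c\<^sup>2 + 1) / (2 * b) * (2 * b) \<le> c\<^sup>2" using q[of "(c\<^sup>2 + 1) / (2 * b)" 1] 2 by (simp add: mult_ac)
      then show False using b by simp
    qed
  next
    case 3
    show ?thesis
    proof (rule ccontr)
      assume "\<not> b \<le> a * c"
      then have b: "b > 0" using 3 by simp
      have "(a\<^sup>2 + 1) / (2 * b) * (2 * b) \<le> a\<^sup>2" using q[of 1 "(a\<^sup>2 + 1) / (2 * b)"] 3 by (simp add: mult_ac)
      then show False using b by simp
    qed
  qed
  then show ?thesis by (simp add: a_def b_def c_def)
qed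

lemma norm_ipB_le:
  assumes f: "f \<in> C_ap" and g: "g \<in> C_ap" shows "norm (ipB f g) \<le> normB f * normB g"
proof (cases "ipB f g = 0")
  case True
  then show ?thesis using normB_nonneg[OF f] normB_nonneg[OF g] by simp
next
  case False
  define u where "u = cnj (ipB f g) / norm (ipB f g)"
  have nu: "norm u = 1" using False by (simp add: u_def norm_divide)
  have "u * ipB f g = norm (ipB f g)"
    using False by (simp add: u_def complex_norm_square[symmetric] mult.commute power2_eq_square)
  then have "norm (ipB f g) = Re (ipB (\<lambda>x. u * f x) g)" by (simp add: ipB_cmult_left f g)
  also have "\<dots> \<le> normB (\<lambda>x. u * f x) * normB g" by (intro Re_ipB_le Cap_cmult f g)
  finally show ?thesis by (simp add: normB_cmult f nu)
qed

lemma normB_triangle: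
  assumes f: "f \<in> C_ap" and g: "g \<in> C_ap" shows "normB (\<lambda>x. f x + g x) \<le> normB f + normB g"
proof (rule power2_le_imp_le)
  have c: "Re (ipB g f) = Re (ipB f g)" using ipB_cnj[OF f g] by (metis complex_cnj(1) complex_surj cnj.sel(1))
  have fg: "(\<lambda>x. f x + g x) \<in> C_ap" using Cap_add f g by blast
  have "(normB (\<lambda>x. f x + g x))\<^sup>2 = Re (ipB (\<lambda>x. f x + g x) (\<lambda>x. f x + g x))"
    using ipB_self[OF fg] by simp
  also have "\<dots> = (normB f)\<^sup>2 + 2 * Re (ipB f g) + (normB g)\<^sup>2"
    using ipB_self[OF f] ipB_self[OF g] by (simp add: ipB_add_right fg ipB_add_left f g c)
  also have "\<dots> \<le> (normB f + normB g)\<^sup>2"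
    using Re_ipB_le[OF f g] by (simp add: power2_sum)
  finally show "(normB (\<lambda>x. f x + g x))\<^sup>2 \<le> (normB f + normB g)\<^sup>2" .
  show "0 \<le> normB f + normB g" using normB_nonneg[OF f] normB_nonneg[OF g] by simp
qed

lemma normB_zero [simp]: "normB (\<lambda>x. 0) = 0"
  using normB_cmult[OF Cap_const[of 0], of 0] by simp

lemma normB_minus: "f \<in> C_ap \<Longrightarrow> normB (\<lambda>x. - f x) = normB f"
  using normB_cmult[of f "-1"] by simp

lemma normB_minus_commute: "f \<in> C_ap \<Longrightarrow> g \<in> C_ap \<Longrightarrow> normB (\<lambda>x. f x - g x) = normB (\<lambda>x. g x - f x)"
  using normB_minus[of "\<lambda>x. f x - g x"] by (simp add: Cap_diff)

lemma normB_triangle3: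
  assumes "f \<in> C_ap" "g \<in> C_ap" "h \<in> C_ap"
  shows "normB (\<lambda>x. f x - h x) \<le> normB (\<lambda>x. f x - g x) + normB (\<lambda>x. g x - h x)"
  using normB_triangle[OF Cap_diff[OF assms(1,2)] Cap_diff[OF assms(2,3)]]
  by (simp only: diff_add_cancel add_diff_eq)

lemma normB_le_diff:
  assumes f: "f \<in> C_ap" and g: "g \<in> C_ap" shows "normB f \<le> normB (\<lambda>x. f x - g x) + normB g"
proof -
  have "normB (\<lambda>x. (f x - g x) + g x) \<le> normB (\<lambda>x. f x - g x) + normB g"
    by (rule normB_triangle) (fact Cap_diff[OF f g] g)+
  then show ?thesis by simp
qed

lemma normB_abs_diff:
  assumes f: "f \<in> C_ap" and g: "g \<in> C_ap" shows "\<bar>normB f - normB g\<bar> \<le> normB (\<lambda>x. f x - g x)"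
proof -
  have "normB g \<le> normB (\<lambda>x. f x - g x) + normB f"
    using normB_le_diff[OF g f] normB_minus_commute[OF f g] by simp
  then show ?thesis using normB_le_diff[OF f g] by linarith
qed

text \<open>
  Complex inner product spaces, linear in the first argument. The norm and the topology are
  those of the underlying real inner product space.
\<close>

class complex_inner = real_inner +
  fixes scaleC :: "complex \<Rightarrow> 'a \<Rightarrow> 'a"  (infixr "*\<^sub>C" 75)
    and cinner :: "'a \<Rightarrow> 'a \<Rightarrow> complex"
  assumes scaleC_add_right: "c *\<^sub>C (x + y) = c *\<^sub>C x + c *\<^sub>C y"
    and scaleC_add_left: "(c + d) *\<^sub>C x = c *\<^sub>C x + d *\<^sub>C x"
    and scaleC_scaleC: "c *\<^sub>C (d *\<^sub>C x) = (c * d) *\<^sub>C x"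
    and scaleR_scaleC: "r *\<^sub>R x = complex_of_real r *\<^sub>C x"
    and cinner_commute: "cinner x y = cnj (cinner y x)"
    and cinner_add_left: "cinner (x + y) z = cinner x z + cinner y z"
    and cinner_scaleC_left: "cinner (c *\<^sub>C x) y = c * cinner x y"
    and inner_cinner: "inner x y = Re (cinner x y)"

class chilbert_space = complex_inner + complete_space

text \<open>
  The completion consists of sequences in \<open>C_ap\<close> that are Cauchy for the seminorm induced by
  the mean value, two of them being identified when the seminorm of their difference tends to 0.
\<close>

definition cauchyB :: "(nat \<Rightarrow> real^'n \<Rightarrow> complex) \<Rightarrow> bool" where
  "cauchyB X \<longleftrightarrow> (\<forall>n. X n \<in> C_ap) \<and>
    (\<forall>e>0. \<exists>N. \<forall>m\<ge>N. \<forall>n\<ge>N. normB (\<lambda>x. X m x - X n x) < e)"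

definition relB :: "(nat \<Rightarrow> real^'n \<Rightarrow> complex) \<Rightarrow> (nat \<Rightarrow> real^'n \<Rightarrow> complex) \<Rightarrow> bool" where
  "relB X Y \<longleftrightarrow> cauchyB X \<and> cauchyB Y \<and> (\<lambda>n. normB (\<lambda>x. X n x - Y n x)) \<longlonglongrightarrow> 0"

lemma cauchyB_Cap: "cauchyB X \<Longrightarrow> X n \<in> C_ap"
  by (simp add: cauchyB_def)

lemma cauchyB_D: "cauchyB X \<Longrightarrow> e > 0 \<Longrightarrow> \<exists>N. \<forall>m\<ge>N. \<forall>n\<ge>N. normB (\<lambda>x. X m x - X n x) < e"
  by (simp add: cauchyB_def)

lemma relB_refl: "cauchyB X \<Longrightarrow> relB X X"
  by (simp add: relB_def)

lemma relB_refl_iff [simp]: "relB X X \<longleftrightarrow> cauchyB X"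
  using relB_refl by (auto simp: relB_def)

lemma cauchyB_const: "f \<in> C_ap \<Longrightarrow> cauchyB (\<lambda>n. f)"
  by (simp add: cauchyB_def)

lemma part_equivp_relB: "part_equivp relB"
proof (rule part_equivpI)
  show "\<exists>X :: nat \<Rightarrow> real^'n \<Rightarrow> complex. relB X X"
    using relB_refl[OF cauchyB_const[OF Cap_const]] by blast
  show "symp relB"
  proof (rule sympI)
    fix X Y :: "nat \<Rightarrow> real^'n \<Rightarrow> complex" assume "relB X Y"
    then show "relB Y X"
      by (auto simp: relB_def normB_minus_commute[OF cauchyB_Cap cauchyB_Cap, of Y X])
  qed
  show "transp relB"
  proof (rule transpI)
    fix X Y Z :: "nat \<Rightarrow> real^'n \<Rightarrow> complex" assume *: "relB X Y" "relB Y Z"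
    then have C: "X n \<in> C_ap" "Y n \<in> C_ap" "Z n \<in> C_ap" for n by (auto simp: relB_def cauchyB_def)
    have "(\<lambda>n. normB (\<lambda>x. X n x - Y n x) + normB (\<lambda>x. Y n x - Z n x)) \<longlonglongrightarrow> 0"
      using * by (auto simp: relB_def intro: tendsto_add_zero)
    then have "(\<lambda>n. normB (\<lambda>x. X n x - Z n x)) \<longlonglongrightarrow> 0"
      by (rule tendsto_sandwich[OF _ _ tendsto_const, rotated 2])
        (auto intro!: always_eventually normB_nonneg normB_triangle3 Cap_diff C)
    with * show "relB X Z" by (simp add: relB_def)
  qed
qed

quotient_type (overloaded) 'n B2 = "nat \<Rightarrow> real^('n::finite) \<Rightarrow> complex" / partial: relB
  by (rule part_equivp_relB)

lemma cauchyB_add: assumes "cauchyB X" "cauchyB Y" shows "cauchyB (\<lambda>n x. X n x + Y n x)"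
  unfolding cauchyB_def
proof (intro conjI allI impI)
  show "(\<lambda>x. X n x + Y n x) \<in> C_ap" for n using assms by (intro Cap_add cauchyB_Cap)
  fix e :: real assume "e > 0"
  then have e: "e/2 > 0" by simp
  obtain N where N: "\<And>m n. m \<ge> N \<Longrightarrow> n \<ge> N \<Longrightarrow> normB (\<lambda>x. X m x - X n x) < e/2"
    using cauchyB_D[OF assms(1) e] by blast
  obtain M where M: "\<And>m n. m \<ge> M \<Longrightarrow> n \<ge> M \<Longrightarrow> normB (\<lambda>x. Y m x - Y n x) < e/2"
    using cauchyB_D[OF assms(2) e] by blast
  have "normB (\<lambda>x. X m x + Y m x - (X n x + Y n x)) < e" if "m \<ge> max N M" "n \<ge> max N M" for m n
  proof -
    have "normB (\<lambda>x. (X m x - X n x) + (Y m x - Y n x)) \<le> normB (\<lambda>x. X m x - X n x) + normB (\<lambda>x. Y m x - Y n x)"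
      using assms by (intro normB_triangle Cap_diff cauchyB_Cap)
    also have "\<dots> < e" using N[of m n] M[of m n] that by simp
    finally show ?thesis by (simp add: algebra_simps)
  qed
  then show "\<exists>N. \<forall>m\<ge>N. \<forall>n\<ge>N. normB (\<lambda>x. X m x + Y m x - (X n x + Y n x)) < e" by blast
qed

lemma cauchyB_cmult: assumes "cauchyB X" shows "cauchyB (\<lambda>n x. c * X n x)"
  unfolding cauchyB_def
proof (intro conjI allI impI)
  show "(\<lambda>x. c * X n x) \<in> C_ap" for n using assms by (intro Cap_cmult cauchyB_Cap)
  fix e :: real assume e: "e > 0"
  have c: "norm c + 1 > 0" by (simp add: add_nonneg_pos)
  obtain N where N: "\<And>m n. m \<ge> N \<Longrightarrow> n \<ge> N \<Longrightarrow> normB (\<lambda>x. X m x - X n x) < e / (norm c + 1)"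
    using cauchyB_D[OF assms, of "e / (norm c + 1)"] e c by auto
  have "normB (\<lambda>x. c * X m x - c * X n x) < e" if "m \<ge> N" "n \<ge> N" for m n
  proof -
    have C: "(\<lambda>x. X m x - X n x) \<in> C_ap" using assms by (intro Cap_diff cauchyB_Cap)
    have "normB (\<lambda>x. c * X m x - c * X n x) = norm c * normB (\<lambda>x. X m x - X n x)"
      using normB_cmult[OF C, of c] by (simp add: right_diff_distrib)
    also have "\<dots> \<le> (norm c + 1) * normB (\<lambda>x. X m x - X n x)"
      using normB_nonneg[OF C] by (simp add: mult_right_mono)
    also have "\<dots> < e" using N[OF that] c by (simp add: pos_less_divide_eq mult.commute)
    finally show ?thesis .
  qed
  then show "\<exists>N. \<forall>m\<ge>N. \<forall>n\<ge>N. normB (\<lambda>x. c * X m x - c * X n x) < e" by blast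
qed

lemma relB_add: assumes "relB X X'" "relB Y Y'" shows "relB (\<lambda>n x. X n x + Y n x) (\<lambda>n x. X' n x + Y' n x)"
proof -
  have C: "X n \<in> C_ap" "X' n \<in> C_ap" "Y n \<in> C_ap" "Y' n \<in> C_ap" for n
    using assms by (auto simp: relB_def cauchyB_def)
  have le: "normB (\<lambda>x. X n x + Y n x - (X' n x + Y' n x)) \<le> normB (\<lambda>x. X n x - X' n x) + normB (\<lambda>x. Y n x - Y' n x)" for n
    using normB_triangle[OF Cap_diff[OF C(1) C(2)] Cap_diff[OF C(3) C(4)], of n n n n] by (simp add: algebra_simps)
  have "(\<lambda>n. normB (\<lambda>x. X n x - X' n x) + normB (\<lambda>x. Y n x - Y' n x)) \<longlonglongrightarrow> 0"
    using assms by (auto simp: relB_def intro: tendsto_add_zero)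
  then have "(\<lambda>n. normB (\<lambda>x. X n x + Y n x - (X' n x + Y' n x))) \<longlonglongrightarrow> 0"
    by (rule tendsto_sandwich[OF _ _ tendsto_const, rotated 2])
      (auto intro!: always_eventually normB_nonneg le Cap_add Cap_diff C)
  then show ?thesis using assms by (simp add: relB_def cauchyB_add)
qed

lemma relB_cmult: assumes "relB X X'" shows "relB (\<lambda>n x. c * X n x) (\<lambda>n x. c * X' n x)"
proof -
  have C: "(\<lambda>x. X n x - X' n x) \<in> C_ap" for n
    using assms by (auto simp: relB_def cauchyB_def intro: Cap_diff)
  have "(\<lambda>n. norm c * normB (\<lambda>x. X n x - X' n x)) \<longlonglongrightarrow> norm c * 0"
    using assms by (intro tendsto_mult tendsto_const) (simp add: relB_def)
  then have "(\<lambda>n. normB (\<lambda>x. c * X n x - c * X' n x)) \<longlonglongrightarrow> 0"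
    using normB_cmult[OF C, of c] by (simp add: right_diff_distrib)
  then show ?thesis using assms by (simp add: relB_def cauchyB_cmult)
qed

lemma ipB_diff_bound:
  assumes "f \<in> C_ap" "f' \<in> C_ap" "g \<in> C_ap" "g' \<in> C_ap"
  shows "norm (ipB f g - ipB f' g') \<le> normB (\<lambda>x. f x - f' x) * normB g + normB f' * normB (\<lambda>x. g x - g' x)"
proof -
  have "ipB f g - ipB f' g' = ipB (\<lambda>x. f x - f' x) g + ipB f' (\<lambda>x. g x - g' x)"
    using assms by (simp add: ipB_diff_left ipB_diff_right)
  also have "norm \<dots> \<le> norm (ipB (\<lambda>x. f x - f' x) g) + norm (ipB f' (\<lambda>x. g x - g' x))"
    by (rule norm_triangle_ineq)
  also have "\<dots> \<le> normB (\<lambda>x. f x - f' x) * normB g + normB f' * normB (\<lambda>x. g x - g' x)"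
    using assms by (intro add_mono norm_ipB_le Cap_diff)
  finally show ?thesis .
qed

lemma normB_convergent: assumes "cauchyB X" shows "convergent (\<lambda>n. normB (X n))"
proof -
  have "Cauchy (\<lambda>n. normB (X n))"
  proof (rule metric_CauchyI)
    fix e :: real assume "e > 0"
    then obtain N where "\<And>m n. m \<ge> N \<Longrightarrow> n \<ge> N \<Longrightarrow> normB (\<lambda>x. X m x - X n x) < e"
      using cauchyB_D[OF assms] by blast
    then show "\<exists>M. \<forall>m\<ge>M. \<forall>n\<ge>M. dist (normB (X m)) (normB (X n)) < e"
      using normB_abs_diff[OF cauchyB_Cap[OF assms] cauchyB_Cap[OF assms]]
      by (metis dist_real_def le_less_trans)
  qed
  then show ?thesis by (rule Cauchy_convergent)
qed

lemma normB_seq_bounded: assumes "cauchyB X" obtains B where "B > 0" "\<And>n. normB (X n) \<le> B"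
proof -
  obtain B where "B > 0" "\<And>n. norm (normB (X n)) \<le> B"
    using convergent_imp_Bseq[OF normB_convergent[OF assms]] by (auto simp: Bseq_def)
  then show ?thesis using that by (metis abs_le_D1 real_norm_def)
qed

lemma ipB_convergent: assumes X: "cauchyB X" and Y: "cauchyB Y" shows "convergent (\<lambda>n. ipB (X n) (Y n))"
proof -
  obtain B where B: "B > 0" "\<And>n. normB (X n) \<le> B" using normB_seq_bounded[OF X] by blast
  obtain D where D: "D > 0" "\<And>n. normB (Y n) \<le> D" using normB_seq_bounded[OF Y] by blast
  have "Cauchy (\<lambda>n. ipB (X n) (Y n))"
  proof (rule metric_CauchyI)
    fix e :: real assume e: "e > 0"
    obtain N where N: "\<And>m n. m \<ge> N \<Longrightarrow> n \<ge> N \<Longrightarrow> normB (\<lambda>x. X m x - X n x) < e / (2 * D)"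
      using cauchyB_D[OF X, of "e / (2 * D)"] e D by auto
    obtain M where M: "\<And>m n. m \<ge> M \<Longrightarrow> n \<ge> M \<Longrightarrow> normB (\<lambda>x. Y m x - Y n x) < e / (2 * B)"
      using cauchyB_D[OF Y, of "e / (2 * B)"] e B by auto
    have "dist (ipB (X m) (Y m)) (ipB (X n) (Y n)) < e" if "m \<ge> max N M" "n \<ge> max N M" for m n
    proof -
      have "dist (ipB (X m) (Y m)) (ipB (X n) (Y n))
        \<le> normB (\<lambda>x. X m x - X n x) * normB (Y m) + normB (X n) * normB (\<lambda>x. Y m x - Y n x)"
        unfolding dist_norm using X Y by (intro ipB_diff_bound cauchyB_Cap)
      also have "\<dots> \<le> normB (\<lambda>x. X m x - X n x) * D + B * normB (\<lambda>x. Y m x - Y n x)"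
        using X Y B D by (intro add_mono mult_mono) (simp_all add: normB_nonneg Cap_diff cauchyB_Cap less_imp_le)
      also have "\<dots> < e / (2 * D) * D + B * (e / (2 * B))"
        using N[of m n] M[of m n] that B D by (intro add_strict_mono mult_strict_right_mono mult_strict_left_mono) auto
      also have "\<dots> = e" using B D by simp
      finally show ?thesis .
    qed
    then show "\<exists>M. \<forall>m\<ge>M. \<forall>n\<ge>M. dist (ipB (X m) (Y m)) (ipB (X n) (Y n)) < e" by blast
  qed
  then show ?thesis by (rule Cauchy_convergent)
qed

lemma ipB_lim_cong:
  assumes "relB X X'" "relB Y Y'"
  shows "lim (\<lambda>n. ipB (X n) (Y n)) = lim (\<lambda>n. ipB (X' n) (Y' n))"
proof -
  have c: "cauchyB X" "cauchyB X'" "cauchyB Y" "cauchyB Y'" using assms by (auto simp: relB_def)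
  obtain B where B: "B > 0" "\<And>n. normB (X' n) \<le> B" using normB_seq_bounded[OF c(2)] by blast
  obtain D where D: "D > 0" "\<And>n. normB (Y n) \<le> D" using normB_seq_bounded[OF c(3)] by blast
  have "(\<lambda>n. ipB (X n) (Y n) - ipB (X' n) (Y' n)) \<longlonglongrightarrow> 0"
  proof (rule Lim_null_comparison)
    show "\<forall>\<^sub>F n in sequentially. norm (ipB (X n) (Y n) - ipB (X' n) (Y' n))
      \<le> normB (\<lambda>x. X n x - X' n x) * D + B * normB (\<lambda>x. Y n x - Y' n x)"
    proof (rule always_eventually, rule allI)
      fix n
      have "norm (ipB (X n) (Y n) - ipB (X' n) (Y' n))
        \<le> normB (\<lambda>x. X n x - X' n x) * normB (Y n) + normB (X' n) * normB (\<lambda>x. Y n x - Y' n x)"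
        using c by (intro ipB_diff_bound cauchyB_Cap)
      also have "\<dots> \<le> normB (\<lambda>x. X n x - X' n x) * D + B * normB (\<lambda>x. Y n x - Y' n x)"
        using c B D by (intro add_mono mult_mono) (simp_all add: normB_nonneg Cap_diff cauchyB_Cap less_imp_le)
      finally show "norm (ipB (X n) (Y n) - ipB (X' n) (Y' n))
        \<le> normB (\<lambda>x. X n x - X' n x) * D + B * normB (\<lambda>x. Y n x - Y' n x)" .
    qed
    have "(\<lambda>n. normB (\<lambda>x. X n x - X' n x) * D + B * normB (\<lambda>x. Y n x - Y' n x)) \<longlonglongrightarrow> 0 * D + B * 0"
      using assms by (intro tendsto_intros) (auto simp: relB_def)
    then show "(\<lambda>n. normB (\<lambda>x. X n x - X' n x) * D + B * normB (\<lambda>x. Y n x - Y' n x)) \<longlonglongrightarrow> 0" by simp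
  qed
  moreover have "(\<lambda>n. ipB (X n) (Y n) - ipB (X' n) (Y' n)) \<longlonglongrightarrow>
    lim (\<lambda>n. ipB (X n) (Y n)) - lim (\<lambda>n. ipB (X' n) (Y' n))"
    using ipB_convergent c by (intro tendsto_diff) (auto simp: convergent_LIMSEQ_iff)
  ultimately show ?thesis using LIMSEQ_unique by fastforce
qed

text \<open>
  The canonical map from \<open>C_ap\<close> to its completion, with the arbitrary value 0 off \<open>C_ap\<close>.
  See \<open>cinner_to_B2\<close> and \<open>Cap_dense\<close> below: it preserves the inner product and has dense range.
\<close>

lift_definition to_B2 :: "(real^'n \<Rightarrow> complex) \<Rightarrow> 'n B2" is
  "\<lambda>f n. if f \<in> C_ap then f else (\<lambda>x. 0)"
  by (auto intro: cauchyB_const Cap_const)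

instantiation B2 :: (finite) complex_inner
begin

lift_definition zero_B2 :: "'a B2" is "\<lambda>n x. 0"
  by (auto intro: cauchyB_const Cap_const)

lift_definition plus_B2 :: "'a B2 \<Rightarrow> 'a B2 \<Rightarrow> 'a B2" is "\<lambda>X Y n x. X n x + Y n x"
  by (rule relB_add)

lift_definition scaleC_B2 :: "complex \<Rightarrow> 'a B2 \<Rightarrow> 'a B2" is "\<lambda>c X n x. c * X n x"
  by (rule relB_cmult)

lift_definition cinner_B2 :: "'a B2 \<Rightarrow> 'a B2 \<Rightarrow> complex" is "\<lambda>X Y. lim (\<lambda>n. ipB (X n) (Y n))"
  by (rule ipB_lim_cong)

definition uminus_B2_def: "- (u :: 'a B2) = (-1) *\<^sub>C u"
definition minus_B2_def: "(u :: 'a B2) - v = u + (- v)"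
definition scaleR_B2_def: "r *\<^sub>R (u :: 'a B2) = complex_of_real r *\<^sub>C u"
definition inner_B2_def: "inner (u :: 'a B2) v = Re (cinner u v)"
definition norm_B2_def: "norm (u :: 'a B2) = sqrt (inner u u)"
definition sgn_B2_def: "sgn (u :: 'a B2) = inverse (norm u) *\<^sub>R u"
definition dist_B2_def: "dist (u :: 'a B2) v = norm (u - v)"
definition uniformity_B2_def:
  "(uniformity :: ('a B2 \<times> 'a B2) filter) = (INF e\<in>{0<..}. principal {(u, v). dist u v < e})"
definition open_B2_def:
  "open (U :: 'a B2 set) \<longleftrightarrow> (\<forall>u\<in>U. eventually (\<lambda>(u', v). u' = u \<longrightarrow> v \<in> U) uniformity)"

instance
proof
  note ab = plus_B2.abs_eq scaleC_B2.abs_eq cinner_B2.abs_eq zero_B2.abs_eq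
  have rep: "\<exists>X. cauchyB X \<and> u = abs_B2 X" for u :: "'a B2"
    by (metis Quotient_B2 Quotient_def relB_def)
  note ca = cauchyB_add cauchyB_cmult
  have z: "cauchyB (\<lambda>n (x :: real^'a). 0)" by (intro cauchyB_const Cap_const)
  have conv: "(\<lambda>n. ipB (X n) (Y n)) \<longlonglongrightarrow> cinner (abs_B2 X) (abs_B2 Y)"
    if "cauchyB X" "cauchyB Y" for X Y :: "nat \<Rightarrow> real^'a \<Rightarrow> complex"
    using ipB_convergent[OF that] that by (simp add: ab convergent_LIMSEQ_iff)
  fix u v w :: "'a B2" and c d :: complex and r s :: real
  obtain X where X: "cauchyB X" "u = abs_B2 X" using rep by blast
  obtain Y where Y: "cauchyB Y" "v = abs_B2 Y" using rep by blast
  obtain Z where Z: "cauchyB Z" "w = abs_B2 Z" using rep by blast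
  show add_assoc: "u + v + w = u + (v + w)" by (simp add: X Y Z ab ca add.assoc)
  show "u + v = v + u" by (simp add: X Y ab add.commute)
  show "0 + u = u" by (simp add: X ab z)
  show "- u + u = 0" using cauchyB_cmult[OF X(1), of "-1"] by (simp add: X ab ca uminus_B2_def)
  show "u - v = u + - v" by (rule minus_B2_def)
  show sar: "c *\<^sub>C (u + v) = c *\<^sub>C u + c *\<^sub>C v" by (simp add: X Y ab ca ring_distribs)
  show sal: "(c + d) *\<^sub>C u = c *\<^sub>C u + d *\<^sub>C u" by (simp add: X ab ca ring_distribs)
  show ss: "c *\<^sub>C d *\<^sub>C u = (c * d) *\<^sub>C u" by (simp add: X ab ca mult.assoc)
  show "r *\<^sub>R u = complex_of_real r *\<^sub>C u" by (rule scaleR_B2_def)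
  show "r *\<^sub>R (u + v) = r *\<^sub>R u + r *\<^sub>R v" by (simp add: scaleR_B2_def X Y ab ca ring_distribs)
  show "(r + s) *\<^sub>R u = r *\<^sub>R u + s *\<^sub>R u" by (simp add: scaleR_B2_def X ab ca ring_distribs)
  show "r *\<^sub>R s *\<^sub>R u = (r * s) *\<^sub>R u" by (simp add: scaleR_B2_def X ab ca mult.assoc)
  show "1 *\<^sub>R u = u" by (simp add: scaleR_B2_def X ab)
  show "dist u v = norm (u - v)" by (rule dist_B2_def)
  show "sgn u = inverse (norm u) *\<^sub>R u" by (rule sgn_B2_def)
  show "uniformity = (INF e\<in>{0<..}. principal {(u, v :: 'a B2). dist u v < e})" by (rule uniformity_B2_def)
  show "open U = (\<forall>u\<in>U. \<forall>\<^sub>F (u', v) in uniformity. u' = u \<longrightarrow> v \<in> U)" for U :: "'a B2 set"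
    by (rule open_B2_def)
  show "inner u v = Re (cinner u v)" by (rule inner_B2_def)
  show "norm u = sqrt (inner u u)" by (rule norm_B2_def)
  show ccom: "cinner x y = cnj (cinner y x)" for x y :: "'a B2"
  proof -
    obtain X where X: "cauchyB X" "x = abs_B2 X" using rep by blast
    obtain Y where Y: "cauchyB Y" "y = abs_B2 Y" using rep by blast
    have "(\<lambda>n. cnj (ipB (Y n) (X n))) \<longlonglongrightarrow> cnj (cinner y x)"
      using conv[OF Y(1) X(1)] X Y by (intro tendsto_cnj) simp
    then have "(\<lambda>n. ipB (X n) (Y n)) \<longlonglongrightarrow> cnj (cinner y x)"
      using X Y by (simp add: ipB_cnj cauchyB_Cap)
    then show ?thesis using conv[OF X(1) Y(1)] X Y LIMSEQ_unique by blast
  qed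
  show cadd: "cinner (u + v) w = cinner u w + cinner v w"
  proof -
    have "(\<lambda>n. ipB (\<lambda>x. X n x + Y n x) (Z n)) \<longlonglongrightarrow> cinner u w + cinner v w"
      using tendsto_add[OF conv[OF X(1) Z(1)] conv[OF Y(1) Z(1)]] X Y Z by (simp add: ipB_add_left cauchyB_Cap)
    moreover have "(\<lambda>n. ipB (\<lambda>x. X n x + Y n x) (Z n)) \<longlonglongrightarrow> cinner (u + v) w"
      using conv[OF cauchyB_add[OF X(1) Y(1)] Z(1)] X Y Z by (simp add: ab)
    ultimately show ?thesis using LIMSEQ_unique by blast
  qed
  show csc: "cinner (c *\<^sub>C u) v = c * cinner u v" for c
  proof -
    have "(\<lambda>n. ipB (\<lambda>x. c * X n x) (Y n)) \<longlonglongrightarrow> c * cinner u v"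
      using tendsto_mult[OF tendsto_const[of c] conv[OF X(1) Y(1)]] X Y by (simp add: ipB_cmult_left cauchyB_Cap)
    moreover have "(\<lambda>n. ipB (\<lambda>x. c * X n x) (Y n)) \<longlonglongrightarrow> cinner (c *\<^sub>C u) v"
      using conv[OF cauchyB_cmult[OF X(1)] Y(1)] X Y by (simp add: ab)
    ultimately show ?thesis using LIMSEQ_unique by blast
  qed
  show "inner u v = inner v u" by (simp add: inner_B2_def ccom[of u v])
  show "inner (u + v) w = inner u w + inner v w" by (simp add: inner_B2_def cadd)
  show "inner (r *\<^sub>R u) v = r * inner u v" by (simp add: inner_B2_def scaleR_B2_def csc)
  have sq: "(\<lambda>n. (normB (X n))\<^sup>2) \<longlonglongrightarrow> inner u u"
    using tendsto_Re[OF conv[OF X(1) X(1)]] X by (simp add: inner_B2_def ipB_self cauchyB_Cap del: of_real_power)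
  show "0 \<le> inner u u" by (rule LIMSEQ_le_const[OF sq]) simp
  show "inner u u = 0 \<longleftrightarrow> u = 0"
  proof
    assume "inner u u = 0"
    then have "(\<lambda>n. sqrt ((normB (X n))\<^sup>2)) \<longlonglongrightarrow> sqrt 0" using tendsto_real_sqrt[OF sq] by simp
    then have "(\<lambda>n. normB (X n)) \<longlonglongrightarrow> 0" using X by (simp add: normB_nonneg cauchyB_Cap)
    then have "relB X (\<lambda>n x. 0)" using X z by (simp add: relB_def)
    then have "abs_B2 X = abs_B2 (\<lambda>n x. 0)" by (rule Quotient_rel_abs[OF Quotient_B2])
    then show "u = 0" by (simp only: X(2) ab)
  next
    assume u: "u = 0"
    have "ipB (\<lambda>x :: real^'a. 0) (\<lambda>x. 0) = 0" using ipB_self[OF Cap_const[of 0]] by simp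
    then have "(\<lambda>n::nat. 0) \<longlonglongrightarrow> cinner u u" using conv[OF z z] by (simp add: u ab)
    then have "cinner u u = 0" using LIMSEQ_unique tendsto_const by blast
    then show "inner u u = 0" by (simp add: inner_B2_def)
  qed
qed

end

lemma B2_rep: obtains X where "cauchyB X" "u = abs_B2 X"
  by (metis Quotient_B2 Quotient_def relB_def)

lemma cinner_abs_B2:
  assumes "cauchyB X" "cauchyB Y"
  shows "(\<lambda>n. ipB (X n) (Y n)) \<longlonglongrightarrow> cinner (abs_B2 X) (abs_B2 Y)"
  using ipB_convergent[OF assms] assms by (simp add: cinner_B2.abs_eq convergent_LIMSEQ_iff)

lemma norm_abs_B2:
  assumes "cauchyB X" shows "(\<lambda>n. normB (X n)) \<longlonglongrightarrow> norm (abs_B2 X)"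
proof -
  have "(\<lambda>n. (normB (X n))\<^sup>2) \<longlonglongrightarrow> inner (abs_B2 X) (abs_B2 X)"
    using tendsto_Re[OF cinner_abs_B2[OF assms assms]] assms
    by (simp add: inner_cinner ipB_self cauchyB_Cap del: of_real_power)
  from tendsto_real_sqrt[OF this] show ?thesis
    using assms by (simp add: normB_nonneg cauchyB_Cap norm_eq_sqrt_inner)
qed

lemma diff_abs_B2:
  assumes "cauchyB X" "cauchyB Y"
  shows "abs_B2 X - abs_B2 Y = abs_B2 (\<lambda>n x. X n x - Y n x)"
  using cauchyB_cmult[OF assms(2), of "-1"] assms
  by (simp add: minus_B2_def uminus_B2_def scaleC_B2.abs_eq plus_B2.abs_eq)

lemma cauchyB_diff: "cauchyB X \<Longrightarrow> cauchyB Y \<Longrightarrow> cauchyB (\<lambda>n x. X n x - Y n x)"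
  using cauchyB_add[OF _ cauchyB_cmult[of Y "-1"], of X] by simp

lemma to_B2_abs: "f \<in> C_ap \<Longrightarrow> to_B2 f = abs_B2 (\<lambda>n. f)"
  by (simp add: to_B2_def)

lemma to_B2_add: "f \<in> C_ap \<Longrightarrow> g \<in> C_ap \<Longrightarrow> to_B2 (\<lambda>x. f x + g x) = to_B2 f + to_B2 g"
  by (simp add: to_B2_abs Cap_add plus_B2.abs_eq cauchyB_const)

lemma to_B2_cmult: "f \<in> C_ap \<Longrightarrow> to_B2 (\<lambda>x. c * f x) = c *\<^sub>C to_B2 f"
  by (simp add: to_B2_abs Cap_cmult scaleC_B2.abs_eq cauchyB_const)

lemma to_B2_diff: "f \<in> C_ap \<Longrightarrow> g \<in> C_ap \<Longrightarrow> to_B2 (\<lambda>x. f x - g x) = to_B2 f - to_B2 g"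
  by (simp add: to_B2_abs Cap_diff diff_abs_B2 cauchyB_const)

lemma cinner_to_B2: "f \<in> C_ap \<Longrightarrow> g \<in> C_ap \<Longrightarrow> cinner (to_B2 f) (to_B2 g) = mean_value (\<lambda>x. f x * cnj (g x))"
  using cinner_abs_B2[OF cauchyB_const cauchyB_const, of f g]
  by (simp add: to_B2_abs ipB_def LIMSEQ_const_iff)

lemma norm_to_B2: "f \<in> C_ap \<Longrightarrow> norm (to_B2 f) = normB f"
  using norm_abs_B2[OF cauchyB_const, of f]
  by (simp add: to_B2_abs LIMSEQ_const_iff)

lemma abs_B2_limit:
  assumes X: "cauchyB X" shows "(\<lambda>n. to_B2 (X n)) \<longlonglongrightarrow> abs_B2 X"
proof (rule metric_LIMSEQ_I)
  fix e :: real assume e: "e > 0"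
  then obtain N where N: "\<And>m n. m \<ge> N \<Longrightarrow> n \<ge> N \<Longrightarrow> normB (\<lambda>x. X m x - X n x) < e/2"
    using cauchyB_D[OF X, of "e/2"] half_gt_zero by blast
  have "dist (to_B2 (X n)) (abs_B2 X) < e" if "n \<ge> N" for n
  proof -
    have c: "cauchyB (\<lambda>k. X n)" using X by (intro cauchyB_const cauchyB_Cap)
    have "(\<lambda>k. normB (\<lambda>x. X n x - X k x)) \<longlonglongrightarrow> norm (to_B2 (X n) - abs_B2 X)"
      using norm_abs_B2[OF cauchyB_diff[OF c X]] X c
      by (simp add: to_B2_abs cauchyB_Cap diff_abs_B2)
    moreover have "\<exists>K. \<forall>k\<ge>K. normB (\<lambda>x. X n x - X k x) \<le> e/2"
      using N[OF that] less_imp_le by blast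
    ultimately have "norm (to_B2 (X n) - abs_B2 X) \<le> e/2" by (rule LIMSEQ_le_const2)
    then show ?thesis using e by (simp add: dist_norm)
  qed
  then show "\<exists>N. \<forall>n\<ge>N. dist (to_B2 (X n)) (abs_B2 X) < e" by blast
qed

lemma Cap_dense: "closure (to_B2 ` C_ap) = (UNIV :: 'n::finite B2 set)"
proof -
  have "u \<in> closure (to_B2 ` C_ap)" for u :: "'n B2"
  proof -
    obtain X where X: "cauchyB X" "u = abs_B2 X" using B2_rep by blast
    show ?thesis unfolding closure_sequential
      using abs_B2_limit[OF X(1)] X cauchyB_Cap[OF X(1)]
      by (intro exI[of _ "\<lambda>n. to_B2 (X n)"]) auto
  qed
  then show ?thesis by blast
qed

instance B2 :: (finite) chilbert_space
proof
  fix U :: "nat \<Rightarrow> 'a B2" assume U: "Cauchy U"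
  have "\<exists>f. f \<in> C_ap \<and> dist (to_B2 f) (U n) < inverse (real (Suc n))" for n
  proof -
    have "U n \<in> closure (to_B2 ` C_ap)" using Cap_dense by blast
    then have "\<exists>y\<in>to_B2 ` C_ap. dist y (U n) < inverse (real (Suc n))"
      unfolding closure_approachable by (rule allE) (erule mp, simp)
    then show ?thesis by blast
  qed
  then obtain f where f: "\<And>n. f n \<in> C_ap" "\<And>n. dist (to_B2 (f n)) (U n) < inverse (real (Suc n))"
    by metis
  have 0: "(\<lambda>n. dist (to_B2 (f n)) (U n)) \<longlonglongrightarrow> 0"
    by (rule tendsto_sandwich[OF _ _ tendsto_const LIMSEQ_inverse_real_of_nat])
      (simp_all add: less_imp_le[OF f(2)] del: of_nat_Suc)
  have "Cauchy (\<lambda>n. to_B2 (f n))"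
  proof (rule metric_CauchyI)
    fix e :: real assume e: "e > 0"
    obtain M where M: "\<And>m n. m \<ge> M \<Longrightarrow> n \<ge> M \<Longrightarrow> dist (U m) (U n) < e/3"
      using metric_CauchyD[OF U, of "e/3"] e by auto
    obtain N where N: "\<And>n. n \<ge> N \<Longrightarrow> dist (to_B2 (f n)) (U n) < e/3"
      using metric_LIMSEQ_D[OF 0, of "e/3"] e by auto
    have "dist (to_B2 (f m)) (to_B2 (f n)) < e" if "m \<ge> max M N" "n \<ge> max M N" for m n
      using M[of m n] N[of m] N[of n] that dist_triangle[of "to_B2 (f m)" "to_B2 (f n)" "U m"]
        dist_triangle[of "U m" "to_B2 (f n)" "U n"] by (simp add: dist_commute)
    then show "\<exists>M. \<forall>m\<ge>M. \<forall>n\<ge>M. dist (to_B2 (f m)) (to_B2 (f n)) < e" by blast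
  qed
  then have "cauchyB f"
    unfolding cauchyB_def Cauchy_def dist_norm
    using f(1) by (simp add: to_B2_diff[symmetric] norm_to_B2 Cap_diff)
  from abs_B2_limit[OF this] have "U \<longlonglongrightarrow> abs_B2 f"
  proof (rule Lim_transform)
    have "(\<lambda>n. norm (U n - to_B2 (f n))) \<longlonglongrightarrow> 0" using 0 by (simp add: dist_norm norm_minus_commute)
    then show "(\<lambda>n. U n - to_B2 (f n)) \<longlonglongrightarrow> 0" by (simp only: tendsto_norm_zero_iff)
  qed
  then show "convergent U" by (auto simp: convergent_def)
qed

lemma TP_dense: "closure (to_B2 ` TP) = (UNIV :: 'n::finite B2 set)"
proof -
  have "to_B2 ` C_ap \<subseteq> closure (to_B2 ` TP :: 'n B2 set)"
  proof
    fix u :: "'n B2" assume "u \<in> to_B2 ` C_ap"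
    then obtain f where f: "f \<in> C_ap" "u = to_B2 f" by blast
    show "u \<in> closure (to_B2 ` TP)"
      unfolding closure_approachable
    proof (intro allI impI)
      fix e :: real assume e: "e > 0"
      obtain p where p: "\<And>n. p n \<in> TP" "uniform_limit UNIV p f sequentially" using CapE f by blast
      obtain n where n: "\<And>x. norm (p n x - f x) < e/2"
        using uniform_limitD[OF p(2), of "e/2"] e by (auto simp: eventually_sequentially dist_norm)
      have "normB (\<lambda>x. p n x - f x) \<le> e/2"
        using n by (intro normB_le_sup Cap_diff TP_Cap p f) (auto simp: less_imp_le)
      then have "dist (to_B2 (p n)) u < e"
        using e by (simp add: f dist_norm to_B2_diff[symmetric] TP_Cap p(1) norm_to_B2 Cap_diff)
      then show "\<exists>y\<in>to_B2 ` TP. dist y u < e" using p(1) by blast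
    qed
  qed
  then show ?thesis using Cap_dense closure_minimal[OF _ closed_closure] by blast
qed

section \<open>Spectra of unbounded operators\<close>

text \<open>
  A linear operator in \<open>H\<close> with a domain is represented by its graph in \<open>H \<times> H\<close>, so that the
  operator closure is the topological closure of the graph, a closed operator is a closed set,
  and the range is \<^const>\<open>Range\<close>. The graph of \<open>T - sI\<close> is \<open>op_shift T s\<close>.
\<close>

definition op_shift :: "('h \<times> 'h) set \<Rightarrow> complex \<Rightarrow> ('h::complex_inner \<times> 'h) set" where
  "op_shift T s = {(u, v - s *\<^sub>C u) | u v. (u, v) \<in> T}"

definition spectrum :: "('h::complex_inner \<times> 'h) set \<Rightarrow> complex set" where
  "spectrum T = - {s. (\<forall>v. \<exists>!u. (u, v) \<in> op_shift T s) \<and>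
                      (\<exists>C. \<forall>(u, v) \<in> op_shift T s. norm u \<le> C * norm v)}"

definition cspan :: "'h::complex_inner set \<Rightarrow> 'h set" where
  "cspan = module.span scaleC"

text \<open>
  The two last conjuncts say that the kernel is finite-dimensional and that finitely many classes
  span the cokernel \<open>H / Ran T\<close>.
\<close>

definition fredholm :: "('h::complex_inner \<times> 'h) set \<Rightarrow> bool" where
  "fredholm T \<longleftrightarrow> closed T \<and>
     (\<exists>F. finite F \<and> {u. (u, 0) \<in> T} = cspan F) \<and>
     (\<exists>F. finite F \<and> (\<forall>w. \<exists>v\<in>Range T. w - v \<in> cspan F))"

definition ess_spectrum :: "('h::complex_inner \<times> 'h) set \<Rightarrow> complex set" where
  "ess_spectrum T = {s. \<not> fredholm (op_shift T s)}"

text \<open>Injectivity of an operator is single-valuedness of the converse of its graph.\<close>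

definition point_spectrum :: "('h::complex_inner \<times> 'h) set \<Rightarrow> complex set" where
  "point_spectrum T = {s. \<not> single_valued ((op_shift T s)\<inverse>)}"

definition cont_spectrum :: "('h::complex_inner \<times> 'h) set \<Rightarrow> complex set" where
  "cont_spectrum T = {s \<in> spectrum T. single_valued ((op_shift T s)\<inverse>) \<and>
     closure (Range (op_shift T s)) = UNIV}"

section \<open>Symbols and operators\<close>

text \<open>A function on a finite-dimensional space is \<open>C\<^sup>\<infinity>\<close> if it is \<open>C_k\<close> for every \<open>k\<close>.\<close>

primrec C_k :: "nat \<Rightarrow> ('a::euclidean_space \<Rightarrow> 'b::real_normed_vector) \<Rightarrow> bool" where
  "C_k 0 f \<longleftrightarrow> continuous_on UNIV f"
| "C_k (Suc k) f \<longleftrightarrow> (\<forall>z. f differentiable (at z)) \<and> (\<forall>v. C_k k (\<lambda>z. frechet_derivative f (at z) v))"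

definition C_inf :: "('a::euclidean_space \<Rightarrow> 'b::real_normed_vector) \<Rightarrow> bool" where
  "C_inf f \<longleftrightarrow> (\<forall>k. C_k k f)"

definition dx :: "'n \<Rightarrow> ((real^'n) \<times> (real^'n) \<Rightarrow> complex) \<Rightarrow> ((real^'n) \<times> (real^'n) \<Rightarrow> complex)" where
  "dx j a = (\<lambda>z. frechet_derivative a (at z) (axis j 1, 0))"

definition dxi :: "'n \<Rightarrow> ((real^'n) \<times> (real^'n) \<Rightarrow> complex) \<Rightarrow> ((real^'n) \<times> (real^'n) \<Rightarrow> complex)" where
  "dxi j a = (\<lambda>z. frechet_derivative a (at z) (0, axis j 1))"

definition jap :: "real^'n \<Rightarrow> real" where
  "jap \<xi> = sqrt (1 + (norm \<xi>)\<^sup>2)"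

text \<open>
  A multi-index is given by a list of coordinate indices, whose length is its order; on smooth
  functions partial derivatives commute, so the derivative depends only on the multiplicities
  in the list, and every multi-index arises.
\<close>

definition APS :: "real \<Rightarrow> real \<Rightarrow> real \<Rightarrow> ((real^'n) \<times> (real^'n) \<Rightarrow> complex) set" where
  "APS m \<rho> \<delta> = {a. C_inf a \<and> (\<forall>\<xi>. (\<lambda>x. a (x, \<xi>)) \<in> C_ap) \<and>
     (\<forall>\<alpha> \<beta>. bdd_above (range (\<lambda>(x, \<xi>).
        jap \<xi> powr (- m + \<rho> * real (length \<alpha>) - \<delta> * real (length \<beta>)) *
        norm (foldr dxi \<alpha> (foldr dx \<beta> a) (x, \<xi>)))))}"

text \<open>
  The graph in \<open>B\<^sup>2\<close> of the operator with domain \<open>TP\<close> that maps \<open>e_\<mu>\<close> to \<open>a(\<cdot>, \<mu>) e_\<mu>\<close>.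
  Closures of such graphs are justified by \<open>closure_psd_op_mult\<close> (for a symbol depending on \<open>x\<close>
  only, the closure is the graph of the everywhere defined bounded multiplication operator) and
  \<open>single_valued_closure_psd_op\<close> (for a real symbol depending on \<open>\<xi>\<close> only, the operator is closable).
\<close>

definition psd_op :: "((real^'n) \<times> (real^'n) \<Rightarrow> complex) \<Rightarrow> ('n B2 \<times> 'n B2) set" where
  "psd_op a = {(to_B2 (\<lambda>x. \<Sum>\<mu>\<in>S. c \<mu> * expc \<mu> x),
                to_B2 (\<lambda>x. \<Sum>\<mu>\<in>S. c \<mu> * (a (x, \<mu>) * expc \<mu> x))) | S c. finite S}"

lemma module_scaleC: "module (scaleC :: complex \<Rightarrow> 'h::complex_inner \<Rightarrow> 'h)"
proof
  show "1 *\<^sub>C x = x" for x :: 'h using scaleR_scaleC[of 1 x] by simp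
qed (rule scaleC_add_right scaleC_add_left scaleC_scaleC)+

lemma to_B2_sum: 
  "finite S \<Longrightarrow> (\<And>i. i \<in> S \<Longrightarrow> f i \<in> C_ap) \<Longrightarrow> (\<lambda>x. \<Sum>i\<in>S. f i x) \<in> C_ap \<and> to_B2 (\<lambda>x. \<Sum>i\<in>S. f i x) = (\<Sum>i\<in>S. to_B2 (f i))"
proof (induction S rule: finite_induct)
  case empty
  then show ?case using to_B2_cmult[OF Cap_const[of 0], of 0] to_B2_diff[OF Cap_const[of 0] Cap_const[of 0]] by (simp add: Cap_const)
next
  case (insert i S)
  then show ?case by (simp add: Cap_add to_B2_add)
qed

lemma expc_TP: "expc \<mu> \<in> TP"
  using TP_monom[of 1 \<mu>] by simp

lemma cinner_expc: "cinner (to_B2 (expc \<mu>)) (to_B2 (expc \<nu>)) = (if \<mu> = \<nu> then 1 else 0)"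
proof -
  have "(\<lambda>x. expc \<mu> x * cnj (expc \<nu> x)) = expc (\<mu> - \<nu>)"
    by (auto simp: cnj_expc simp flip: expc_add)
  then show ?thesis
    using mean_eqI[OF cube_avg_expc_tendsto[of "\<mu> - \<nu>"]] by (simp add: cinner_to_B2 TP_Cap expc_TP)
qed


lemma psd_op_terms:
  assumes S: "finite S" and a: "\<And>\<mu>. (\<lambda>x. a (x, \<mu>)) \<in> C_ap"
  shows "to_B2 (\<lambda>x. \<Sum>\<mu>\<in>S. c \<mu> * expc \<mu> x) = (\<Sum>\<mu>\<in>S. c \<mu> *\<^sub>C to_B2 (expc \<mu>))"
    and "to_B2 (\<lambda>x. \<Sum>\<mu>\<in>S. c \<mu> * (a (x, \<mu>) * expc \<mu> x)) = (\<Sum>\<mu>\<in>S. c \<mu> *\<^sub>C to_B2 (\<lambda>x. a (x, \<mu>) * expc \<mu> x))"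
proof -
  have C: "expc \<mu> \<in> C_ap" "(\<lambda>x. a (x, \<mu>) * expc \<mu> x) \<in> C_ap" for \<mu>
    by (intro Cap_mult a TP_Cap expc_TP)+
  show "to_B2 (\<lambda>x. \<Sum>\<mu>\<in>S. c \<mu> * expc \<mu> x) = (\<Sum>\<mu>\<in>S. c \<mu> *\<^sub>C to_B2 (expc \<mu>))"
    using to_B2_sum[OF S, of "\<lambda>\<mu> x. c \<mu> * expc \<mu> x"] C by (simp add: to_B2_cmult Cap_cmult)
  show "to_B2 (\<lambda>x. \<Sum>\<mu>\<in>S. c \<mu> * (a (x, \<mu>) * expc \<mu> x)) = (\<Sum>\<mu>\<in>S. c \<mu> *\<^sub>C to_B2 (\<lambda>x. a (x, \<mu>) * expc \<mu> x))"
    using to_B2_sum[OF S, of "\<lambda>\<mu> x. c \<mu> * (a (x, \<mu>) * expc \<mu> x)"] C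
    by (simp add: to_B2_cmult Cap_cmult)
qed

lemma normB_mult_le:
  assumes f: "f \<in> C_ap" and g: "g \<in> C_ap" and B: "\<And>x. norm (f x) \<le> B"
  shows "normB (\<lambda>x. f x * g x) \<le> B * normB g"
proof -
  have B0: "B \<ge> 0" using B[of 0] norm_ge_zero order_trans by blast
  have fg: "(\<lambda>x. f x * g x) \<in> C_ap" using f g by (rule Cap_mult)
  have C: "(\<lambda>x. g x * cnj (g x)) \<in> C_ap" "(\<lambda>x. f x * g x * cnj (f x * g x)) \<in> C_ap"
    "(\<lambda>x. of_real (B\<^sup>2) * (g x * cnj (g x))) \<in> C_ap"
    by (intro Cap_mult Cap_cnj Cap_cmult f g)+
  have "0 \<le> Re (mean_value (\<lambda>x. of_real (B\<^sup>2) * (g x * cnj (g x)) - f x * g x * cnj (f x * g x)))"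
  proof (intro mean_Re_nonneg Cap_diff C)
    fix x
    have "Re (of_real (B\<^sup>2) * (g x * cnj (g x)) - f x * g x * cnj (f x * g x)) = B\<^sup>2 * (norm (g x))\<^sup>2 - (norm (f x * g x))\<^sup>2"
      by (simp only: complex_norm_square[symmetric] of_real_mult[symmetric] of_real_diff[symmetric] Re_complex_of_real)
    also have "\<dots> \<ge> 0" using B[of x] B0 by (simp add: norm_mult power_mult_distrib mult_right_mono power_mono)
    finally show "0 \<le> Re (of_real (B\<^sup>2) * (g x * cnj (g x)) - f x * g x * cnj (f x * g x))" .
  qed
  also have "mean_value (\<lambda>x. of_real (B\<^sup>2) * (g x * cnj (g x)) - f x * g x * cnj (f x * g x))
      = of_real (B\<^sup>2) * ipB g g - ipB (\<lambda>x. f x * g x) (\<lambda>x. f x * g x)"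
    using mean_add[OF C(3) Cap_minus[OF C(2)]] mean_cmult[OF C(1), of "of_real (B\<^sup>2)"] mean_cmult[OF C(2), of "-1"]
    by (simp add: ipB_def)
  also have "\<dots> = of_real ((B * normB g)\<^sup>2 - (normB (\<lambda>x. f x * g x))\<^sup>2)"
    by (simp add: ipB_self f g fg power_mult_distrib)
  finally have "(normB (\<lambda>x. f x * g x))\<^sup>2 \<le> (B * normB g)\<^sup>2" by (simp del: of_real_diff of_real_power)
  then show ?thesis using mult_nonneg_nonneg[OF B0 normB_nonneg[OF g]] by (rule power2_le_imp_le)
qed

lemma cauchyB_mult: assumes f: "f \<in> C_ap" and X: "cauchyB X" shows "cauchyB (\<lambda>n x. f x * X n x)"
  unfolding cauchyB_def
proof (intro conjI allI impI)
  show "(\<lambda>x. f x * X n x) \<in> C_ap" for n using cauchyB_Cap[OF X] by (intro Cap_mult f)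
  fix e :: real assume e: "e > 0"
  obtain B where B: "B > 0" "\<And>x. norm (f x) \<le> B" using Cap_bounded[OF f] by blast
  obtain N where N: "\<And>m n. m \<ge> N \<Longrightarrow> n \<ge> N \<Longrightarrow> normB (\<lambda>x. X m x - X n x) < e / B"
    using cauchyB_D[OF X, of "e / B"] e B by auto
  have "normB (\<lambda>x. f x * X m x - f x * X n x) < e" if "m \<ge> N" "n \<ge> N" for m n
  proof -
    have "normB (\<lambda>x. f x * (X m x - X n x)) \<le> B * normB (\<lambda>x. X m x - X n x)"
      using cauchyB_Cap[OF X] B by (intro normB_mult_le Cap_diff f)
    also have "\<dots> < e" using N[OF that] B by (simp add: pos_less_divide_eq mult.commute)
    finally show ?thesis by (simp add: right_diff_distrib)
  qed
  then show "\<exists>N. \<forall>m\<ge>N. \<forall>n\<ge>N. normB (\<lambda>x. f x * X m x - f x * X n x) < e" by blast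
qed

lemma relB_mult: assumes f: "f \<in> C_ap" and R: "relB X X'" shows "relB (\<lambda>n x. f x * X n x) (\<lambda>n x. f x * X' n x)"
proof -
  obtain B where B: "B > 0" "\<And>x. norm (f x) \<le> B" using Cap_bounded[OF f] by blast
  have C: "(\<lambda>x. X n x - X' n x) \<in> C_ap" for n
    using R by (auto simp: relB_def cauchyB_def intro: Cap_diff)
  have le: "normB (\<lambda>x. f x * X n x - f x * X' n x) \<le> B * normB (\<lambda>x. X n x - X' n x)" for n
    using normB_mult_le[OF f C B(2), of n] by (simp add: right_diff_distrib)
  have nn: "0 \<le> normB (\<lambda>x. f x * X n x - f x * X' n x)" for n
    using normB_nonneg[OF Cap_mult[OF f C], of n] by (simp add: right_diff_distrib)
  have "(\<lambda>n. B * normB (\<lambda>x. X n x - X' n x)) \<longlonglongrightarrow> B * 0"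
    using R by (intro tendsto_mult tendsto_const) (simp add: relB_def)
  then have "(\<lambda>n. B * normB (\<lambda>x. X n x - X' n x)) \<longlonglongrightarrow> 0" by simp
  then have "(\<lambda>n. normB (\<lambda>x. f x * X n x - f x * X' n x)) \<longlonglongrightarrow> 0"
    by (rule tendsto_sandwich[OF _ _ tendsto_const, rotated 2]) (auto intro!: always_eventually le nn)
  then show ?thesis using R f by (simp add: relB_def cauchyB_mult)
qed

lemma relB_mult_if:
  fixes f :: "real^'n \<Rightarrow> complex"
  assumes R: "relB X Y"
  shows "relB (\<lambda>n x. if f \<in> C_ap then f x * X n x else 0) (\<lambda>n x. if f \<in> C_ap then f x * Y n x else 0)"
proof (cases "f \<in> C_ap")
  case True
  then show ?thesis using relB_mult[OF True R] by simp
next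
  case False
  have "relB (\<lambda>n x. 0) (\<lambda>n x :: real^'n. 0)" by (rule relB_refl[OF cauchyB_const[OF Cap_const]])
  then show ?thesis using False by simp
qed

text \<open>Multiplication by \<open>f \<in> C_ap\<close> on the completion.\<close>

lift_definition mult_B2 :: "(real^'n \<Rightarrow> complex) \<Rightarrow> 'n B2 \<Rightarrow> 'n B2" is
  "\<lambda>f X n x. if f \<in> C_ap then f x * X n x else 0"
  by (rule relB_mult_if)

lemma mult_B2_abs: "f \<in> C_ap \<Longrightarrow> cauchyB X \<Longrightarrow> mult_B2 f (abs_B2 X) = abs_B2 (\<lambda>n x. f x * X n x)"
  by (simp add: mult_B2.abs_eq)

lemma mult_B2_to_B2: "f \<in> C_ap \<Longrightarrow> g \<in> C_ap \<Longrightarrow> mult_B2 f (to_B2 g) = to_B2 (\<lambda>x. f x * g x)"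
  by (simp add: to_B2_abs Cap_mult mult_B2_abs cauchyB_const)

lemma mult_B2_scaleC: assumes "f \<in> C_ap" shows "mult_B2 f (c *\<^sub>C u) = c *\<^sub>C mult_B2 f u"
proof -
  obtain X where X: "cauchyB X" "u = abs_B2 X" using B2_rep by blast
  show ?thesis using assms X by (simp add: mult_B2_abs scaleC_B2.abs_eq cauchyB_cmult cauchyB_mult mult.left_commute)
qed

lemma bounded_linear_mult_B2:
  fixes f :: "real^'n \<Rightarrow> complex"
  assumes f: "f \<in> C_ap" shows "bounded_linear (mult_B2 f)"
proof -
  obtain B where B: "B > 0" "\<And>x. norm (f x) \<le> B" using Cap_bounded[OF f] by blast
  show ?thesis
  proof (rule bounded_linear_intro)
    fix u v :: "'n B2" and r :: real
    obtain X where X: "cauchyB X" "u = abs_B2 X" using B2_rep by blast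
    obtain Y where Y: "cauchyB Y" "v = abs_B2 Y" using B2_rep by blast
    show "mult_B2 f (u + v) = mult_B2 f u + mult_B2 f v"
      using f X Y by (simp add: plus_B2.abs_eq mult_B2_abs cauchyB_add cauchyB_mult ring_distribs)
    show "mult_B2 f (r *\<^sub>R u) = r *\<^sub>R mult_B2 f u"
      by (simp add: scaleR_scaleC mult_B2_scaleC[OF f])
    have 1: "(\<lambda>n. normB (\<lambda>x. f x * X n x)) \<longlonglongrightarrow> norm (mult_B2 f u)"
      using norm_abs_B2[OF cauchyB_mult[OF f X(1)]] f X by (simp add: mult_B2_abs)
    have 2: "(\<lambda>n. normB (X n) * B) \<longlonglongrightarrow> norm u * B"
      using norm_abs_B2[OF X(1)] X(2) by (intro tendsto_mult tendsto_const) simp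
    show "norm (mult_B2 f u) \<le> norm u * B"
      by (rule LIMSEQ_le[OF 1 2])
        (use normB_mult_le[OF f cauchyB_Cap[OF X(1)] B(2)] in \<open>auto simp: mult.commute\<close>)
  qed
qed

lemma closure_psd_op_mult:
  fixes f :: "real^'n \<Rightarrow> complex"
  assumes f: "f \<in> C_ap"
  shows "closure (psd_op (\<lambda>(x, \<xi>). f x)) = {(u, mult_B2 f u) | u. True}" (is "closure ?P = ?G")
proof
  have cont: "continuous_on UNIV (mult_B2 f)"
    by (rule linear_continuous_on[OF bounded_linear_mult_B2[OF f]])
  have P: "?P = {(to_B2 p, mult_B2 f (to_B2 p)) | p. p \<in> TP}"
  proof -
    have eq: "to_B2 (\<lambda>x. \<Sum>\<mu>\<in>S. c \<mu> * (f x * expc \<mu> x)) = mult_B2 f (to_B2 (\<lambda>x. \<Sum>\<mu>\<in>S. c \<mu> * expc \<mu> x))"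
      if "finite S" for S :: "(real^'n) set" and c
    proof -
      have "(\<lambda>x. \<Sum>\<mu>\<in>S. c \<mu> * (f x * expc \<mu> x)) = (\<lambda>x. f x * (\<Sum>\<mu>\<in>S. c \<mu> * expc \<mu> x))"
        by (simp add: sum_distrib_left mult_ac)
      then show ?thesis using mult_B2_to_B2[OF f TP_Cap[OF TP_I[OF that]], of c] by simp
    qed
    show ?thesis
    proof (intro set_eqI iffI)
      fix w assume "w \<in> ?P"
      then obtain S c where S: "finite S" and w: "w = (to_B2 (\<lambda>x. \<Sum>\<nu>\<in>S. c \<nu> * expc \<nu> x),
          to_B2 (\<lambda>x. \<Sum>\<nu>\<in>S. c \<nu> * (f x * expc \<nu> x)))"
        unfolding psd_op_def by auto
      show "w \<in> {(to_B2 p, mult_B2 f (to_B2 p)) | p. p \<in> TP}"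
        unfolding w eq[OF S] using TP_I[OF S] by blast
    next
      fix w assume "w \<in> {(to_B2 p, mult_B2 f (to_B2 p)) | p. p \<in> TP}"
      then obtain S c where S: "finite S" and w: "w = (to_B2 (\<lambda>x. \<Sum>\<nu>\<in>S. c \<nu> * expc \<nu> x),
          mult_B2 f (to_B2 (\<lambda>x. \<Sum>\<nu>\<in>S. c \<nu> * expc \<nu> x)))"
        unfolding TP_def by blast
      show "w \<in> ?P"
        unfolding w eq[OF S, symmetric] psd_op_def prod.case using S by blast
    qed
  qed
  have "closed ?G"
  proof -
    have "?G = {w. snd w = mult_B2 f (fst w)}" by auto
    moreover have "closed {w. snd w = mult_B2 f (fst w)}"
      by (intro closed_Collect_eq continuous_intros continuous_on_compose2[OF cont]) auto
    ultimately show ?thesis by simp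
  qed
  moreover have "?P \<subseteq> ?G" unfolding P by blast
  ultimately show "closure ?P \<subseteq> ?G" by (rule closure_minimal[rotated])
  show "?G \<subseteq> closure ?P"
  proof clarify
    fix u :: "'n B2"
    have "u \<in> closure (to_B2 ` TP)" using TP_dense by blast
    then obtain U where U: "\<And>n. U n \<in> to_B2 ` TP" "U \<longlonglongrightarrow> u" unfolding closure_sequential by blast
    have "(\<lambda>n. mult_B2 f (U n)) \<longlonglongrightarrow> mult_B2 f u"
      by (rule bounded_linear.tendsto[OF bounded_linear_mult_B2[OF f] U(2)])
    with U have "(\<lambda>n. (U n, mult_B2 f (U n))) \<longlonglongrightarrow> (u, mult_B2 f u)" by (intro tendsto_Pair)
    moreover have "(U n, mult_B2 f (U n)) \<in> ?P" for n using U(1)[of n] unfolding P by auto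
    ultimately show "(u, mult_B2 f u) \<in> closure ?P" unfolding closure_sequential by (intro exI conjI allI)
  qed
qed

lemma single_valued_closure_psd_op:
  fixes b :: "real^'n \<Rightarrow> real"
  shows "single_valued (closure (psd_op (\<lambda>(x :: real^'n, \<xi>). complex_of_real (b \<xi>))))" (is "single_valued (closure ?P)")
proof (rule single_valuedI)
  let ?e = "\<lambda>c \<mu>. c *\<^sub>C to_B2 (expc \<mu>) :: 'n B2"
  have sym: "inner v (?e c \<mu>) = b \<mu> * inner u (?e c \<mu>)" if uv: "(u, v) \<in> closure ?P" for u v c \<mu>
  proof -
    let ?W = "{w :: 'n B2 \<times> 'n B2. inner (snd w) (?e c \<mu>) = b \<mu> * inner (fst w) (?e c \<mu>)}"
    have "closed ?W" by (intro closed_Collect_eq continuous_intros)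
    moreover have "?P \<subseteq> ?W"
    proof
      fix w assume "w \<in> ?P"
      then obtain S k where S: "finite S" and w: "w = (to_B2 (\<lambda>x. \<Sum>\<nu>\<in>S. k \<nu> * expc \<nu> x),
          to_B2 (\<lambda>x. \<Sum>\<nu>\<in>S. k \<nu> * (of_real (b \<nu>) * expc \<nu> x)))"
        unfolding psd_op_def by auto
      have fw: "fst w = (\<Sum>\<nu>\<in>S. k \<nu> *\<^sub>C to_B2 (expc \<nu>))"
        using psd_op_terms(1)[OF S, of "\<lambda>_. 0" k] w by (simp add: Cap_const)
      have sw: "snd w = (\<Sum>\<nu>\<in>S. k \<nu> *\<^sub>C (of_real (b \<nu>) *\<^sub>C to_B2 (expc \<nu>)))"
        using psd_op_terms(2)[OF S, of "\<lambda>(x, \<xi>). of_real (b \<xi>)" k] w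
        by (simp add: Cap_const to_B2_cmult TP_Cap expc_TP)
      have orth: "inner (d *\<^sub>C to_B2 (expc \<nu>)) (?e c \<mu>) = 0" if "\<nu> \<noteq> \<mu>" for d \<nu>
        using that cinner_commute[of "to_B2 (expc \<nu>)" "?e c \<mu>"] 
        by (simp add: inner_cinner cinner_scaleC_left cinner_expc)
      have "inner (k \<nu> *\<^sub>C (of_real (b \<nu>) *\<^sub>C to_B2 (expc \<nu>))) (?e c \<mu>) = b \<mu> * inner (k \<nu> *\<^sub>C to_B2 (expc \<nu>)) (?e c \<mu>)" for \<nu>
      proof (cases "\<nu> = \<mu>")
        case True
        then show ?thesis by (simp add: inner_cinner cinner_scaleC_left mult_ac algebra_simps)
      next
        case False
        then show ?thesis by (simp add: orth scaleC_scaleC)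
      qed
      then have "inner (snd w) (?e c \<mu>) = b \<mu> * inner (fst w) (?e c \<mu>)"
        unfolding fw sw by (simp add: inner_sum_left sum_distrib_left)
      then show "w \<in> ?W" by simp
    qed
    ultimately have "closure ?P \<subseteq> ?W" by (rule closure_minimal[rotated])
    with uv show ?thesis by auto
  qed
  fix u v v' assume "(u, v) \<in> closure ?P" "(u, v') \<in> closure ?P"
  then have 0: "inner (v - v') (?e c \<mu>) = 0" for c \<mu>
    using sym by (simp add: inner_diff_left)
  have "to_B2 ` TP \<subseteq> {w. inner (v - v') w = 0}"
  proof clarify
    fix p :: "real^'n \<Rightarrow> complex" assume "p \<in> TP"
    then obtain S c where p: "finite S" "p = (\<lambda>x. \<Sum>\<mu>\<in>S. c \<mu> * expc \<mu> x)" using TP_D by blast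
    show "inner (v - v') (to_B2 p) = 0"
      using psd_op_terms(1)[OF p(1), of "\<lambda>_. 0" c] 0 p by (simp add: Cap_const inner_sum_right)
  qed
  moreover have "closed {w. inner (v - v') w = 0}" by (intro closed_Collect_eq continuous_intros)
  ultimately have "closure (to_B2 ` TP) \<subseteq> {w. inner (v - v') w = 0}" by (rule closure_minimal)
  then have "inner (v - v') (v - v') = 0" using TP_dense by blast
  then show "v = v'" by simp
qed

end

theory Submission
  imports Defs
begin

text \<open>
  In both cases it suffices to show that the closure of the range of the symbol is contained in the essential
  spectrum and contains the spectrum, since the essential spectrum of a closed operator lies in its spectrum. For a Fourier multiplier the
  exponentials are eigenvectors. For multiplication by \<open>b \<in> C_ap\<close>, every value \<open>b(x0)\<close> has
  approximate eigenvectors that are trigonometric polynomials, obtained from Folner sets in the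
  frequency group; modulating them by exponentials preserves this property and makes them almost
  orthogonal to any finite set. Such families of almost orthogonal approximate eigenvectors of the
  adjoint are incompatible with a finite-dimensional cokernel. Off the closure of the range, the resolvent
  is multiplication by an inverse in \<open>C_ap\<close>, respectively comes from Parseval's identity.
\<close>

section \<open>Complex inner product spaces\<close>

\<comment> \<open>Makes absolutely convergent series converge, as needed for the vector
  \<open>w\<close> in \<open>not_fredholm\<close>.\<close>
subclass (in chilbert_space) banach ..

lemma cinner_scaleC_right: "cinner x (c *\<^sub>C y) = cnj c * cinner (x :: 'h::complex_inner) y"
  by (metis cinner_commute cinner_scaleC_left complex_cnj_mult)

lemma scaleC_one [simp]: "1 *\<^sub>C (x :: 'h::complex_inner) = x"
  using scaleR_scaleC[of 1 x] by simp

lemma scaleC_zero_left [simp]: "0 *\<^sub>C (x :: 'h::complex_inner) = 0"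
  using scaleR_scaleC[of 0 x] by simp

lemma scaleC_minus_left: "(- c) *\<^sub>C (x :: 'h::complex_inner) = - (c *\<^sub>C x)"
  using scaleC_add_left[of "- c" c x] by (simp add: eq_neg_iff_add_eq_0)

lemma scaleC_diff_left: "(c - d) *\<^sub>C (x :: 'h::complex_inner) = c *\<^sub>C x - d *\<^sub>C x"
  using scaleC_add_left[of c "- d" x] by (simp add: scaleC_minus_left)

lemma scaleC_diff_right: "c *\<^sub>C (x - y :: 'h::complex_inner) = c *\<^sub>C x - c *\<^sub>C y"
  using scaleC_add_right[of c "x - y" y] by simp

lemma scaleC_zero_right [simp]: "c *\<^sub>C (0 :: 'h::complex_inner) = 0"
  using scaleC_diff_right[of c 0 0] by simp

lemma scaleC_sum_right: "c *\<^sub>C (\<Sum>i\<in>S. f i :: 'h::complex_inner) = (\<Sum>i\<in>S. c *\<^sub>C f i)"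
proof (induction S rule: infinite_finite_induct)
  case (insert i S)
  then show ?case by (simp add: scaleC_add_right)
qed simp_all

lemma cinner_zero_left [simp]: "cinner 0 (x :: 'h::complex_inner) = 0"
  using cinner_scaleC_left[of 0 0 x] by simp

lemma cinner_sum_left: "cinner (\<Sum>i\<in>S. f i) (x :: 'h::complex_inner) = (\<Sum>i\<in>S. cinner (f i) x)"
  by (induction S rule: infinite_finite_induct) (simp_all add: cinner_add_left)

lemma cinner_diff_left: "cinner (x - y) z = cinner x z - cinner y (z :: 'h::complex_inner)"
  using cinner_add_left[of "x - y" y z] by simp

lemma cinner_self: "cinner x x = complex_of_real ((norm (x :: 'h::complex_inner))\<^sup>2)"
  using cinner_commute[of x x] inner_cinner[of x x]
  by (auto simp: complex_eq_iff power2_norm_eq_inner)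

lemma norm_scaleC: "norm (c *\<^sub>C x) = norm c * norm (x :: 'h::complex_inner)"
proof -
  have "complex_of_real ((norm (c *\<^sub>C x))\<^sup>2) = (c * cnj c) * cinner x x"
    by (simp only: cinner_self[symmetric] cinner_scaleC_left cinner_scaleC_right mult_ac)
  also have "\<dots> = complex_of_real ((norm c * norm x)\<^sup>2)"
    by (simp only: complex_norm_square[symmetric] cinner_self of_real_mult[symmetric] power_mult_distrib)
  finally have "(norm (c *\<^sub>C x))\<^sup>2 = (norm c * norm x)\<^sup>2"
    by (simp only: of_real_eq_iff)
  then show ?thesis by (simp add: power2_eq_iff_nonneg)
qed

text \<open>A unimodular rotation of \<open>x\<close> makes the inner product real and nonnegative,
  which reduces the bound to the real Cauchy-Schwarz inequality.\<close>

lemma norm_cinner_le: "norm (cinner x y) \<le> norm x * norm (y :: 'h::complex_inner)"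
proof (cases "cinner x y = 0")
  case False
  define c where "c = cnj (cinner x y) / norm (cinner x y)"
  have c: "norm c = 1" using False by (simp add: c_def norm_divide)
  have "cinner (c *\<^sub>C x) y = norm (cinner x y)"
    using False by (simp add: c_def cinner_scaleC_left complex_norm_square[symmetric] mult.commute power2_eq_square)
  then have "norm (cinner x y) = inner (c *\<^sub>C x) y" by (simp add: inner_cinner)
  also have "\<dots> \<le> norm (c *\<^sub>C x) * norm y" by (rule norm_cauchy_schwarz)
  finally show ?thesis by (simp add: norm_scaleC c)
qed simp

lemma bounded_linear_scaleC: "bounded_linear (\<lambda>x :: 'h::complex_inner. c *\<^sub>C x)"
  by (rule bounded_linear_intro[of _ "norm c"])
    (simp_all add: scaleC_add_right norm_scaleC scaleR_scaleC scaleC_scaleC mult.commute)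

lemma bounded_linear_cinner_left: "bounded_linear (\<lambda>x :: 'h::complex_inner. cinner x y)"
  by (rule bounded_linear_intro[of _ "norm y"])
    (simp_all add: cinner_add_left norm_cinner_le scaleR_scaleC cinner_scaleC_left scaleR_conv_of_real)

lemma cspan_finite:
  fixes F :: "'h::complex_inner set"
  assumes "finite F" "w \<in> cspan F" obtains z where "w = (\<Sum>f\<in>F. z f *\<^sub>C f)"
  using assms module.span_finite[OF module_scaleC assms(1)] by (auto simp: cspan_def)

section \<open>Spectra\<close>

lemma op_shift_iff: "(u, w) \<in> op_shift T s \<longleftrightarrow> (u, w + s *\<^sub>C u) \<in> T"
  unfolding op_shift_def by force

lemma closed_op_shift: assumes "closed T" shows "closed (op_shift T s)"
proof -
  have "op_shift T s = (\<lambda>p. (fst p, snd p + s *\<^sub>C fst p)) -` T"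
    by (auto simp: op_shift_iff)
  moreover have "continuous_on UNIV (\<lambda>p :: 'a \<times> 'a. (fst p, snd p + s *\<^sub>C fst p))"
    by (intro continuous_intros bounded_linear.continuous_on[OF bounded_linear_scaleC])
  ultimately show ?thesis using closed_vimage[OF assms] by simp
qed

text \<open>Off the spectrum the shifted operator is bijective, so the empty set spans both its
  kernel and its cokernel; its graph is closed because \<open>T\<close> is.\<close>

lemma ess_spectrum_subset_spectrum:
  assumes "closed T" shows "ess_spectrum T \<subseteq> spectrum T"
proof (rule subsetI, rule ccontr)
  fix s assume s: "s \<in> ess_spectrum T" "s \<notin> spectrum T"
  let ?A = "op_shift T s"
  from s obtain C where bij: "\<And>v. \<exists>!u. (u, v) \<in> ?A" and C: "\<And>u v. (u, v) \<in> ?A \<Longrightarrow> norm u \<le> C * norm v"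
    unfolding spectrum_def by blast
  have "u = 0" if "(u, 0) \<in> ?A" for u using C[OF that] by simp
  then have "{u. (u, 0) \<in> ?A} = cspan {}"
    using bij[of 0] by (auto simp: cspan_def module.span_empty[OF module_scaleC])
  moreover have "\<exists>v\<in>Range ?A. w - v \<in> cspan {}" for w
    using bij[of w] by (force simp: cspan_def module.span_empty[OF module_scaleC])
  ultimately have "fredholm ?A"
    unfolding fredholm_def using closed_op_shift[OF assms] by blast
  with s show False by (simp add: ess_spectrum_def)
qed

text \<open>
  Unit vectors \<open>x\<^sub>n\<close> in the domain of the adjoint with \<open>A\<^sup>*x\<^sub>n\<close> of norm below \<open>4\<^sup>-\<^sup>n\<close> that are almost
  orthogonal to each other and to the finite set \<open>F\<close> spanning the cokernel give a vector
  \<open>w = \<Sum>\<^sub>n 2\<^sup>-\<^sup>n x\<^sub>n\<close> whose inner products with \<open>x\<^sub>n\<close> are at least \<open>2\<^sup>-\<^sup>n\<^sup>-\<^sup>1\<close>, whereas \<open>w \<in> Ran A + span F\<close>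
  forces them to be \<open>O(4\<^sup>-\<^sup>n)\<close>.
\<close>

lemma not_fredholm:
  fixes A :: "('h::chilbert_space \<times> 'h) set"
  assumes weyl: "\<And>e E. e > 0 \<Longrightarrow> finite E \<Longrightarrow>
    \<exists>x y. norm x = 1 \<and> norm y < e \<and> (\<forall>(u, v)\<in>A. cinner v x = cinner u y) \<and> (\<forall>f\<in>E. norm (cinner f x) < e)"
  shows "\<not> fredholm A"
proof
  assume "fredholm A"
  then obtain F where F: "finite F" and coker: "\<And>w. \<exists>v\<in>Range A. w - v \<in> cspan F"
    unfolding fredholm_def by blast
  \<comment> \<open>The factor 1/8 leaves room twice: the off-diagonal terms add up to at most
    \<open>2 * d n\<close>, below half of the diagonal term \<open>(1/2) ^ n\<close>, and
    \<open>2 ^ n * d n\<close> is only \<open>(1/2) ^ n / 8\<close>.\<close>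
  define d where "d n = (1/4 :: real) ^ n / 8" for n
  have d: "d n > 0" "m \<le> n \<Longrightarrow> d n \<le> d m" for m n
    by (auto simp: d_def power_decreasing)
  \<comment> \<open>The pair \<open>p\<close> stands for a vector and its image under the adjoint.
    Only the entries of \<open>X\<close> below \<open>n\<close> enter, as dependent choice along
    \<open>less_than\<close> requires.\<close>
  define P where "P = (\<lambda>(X :: nat \<Rightarrow> 'h \<times> 'h) n p. norm (fst p) = 1 \<and> norm (snd p) < d n \<and>
    (\<forall>(u, v)\<in>A. cinner v (fst p) = cinner u (snd p)) \<and>
    (\<forall>f\<in>F. norm (cinner f (fst p)) < d n) \<and> (\<forall>i<n. norm (cinner (fst (X i)) (fst p)) < d n))"
  have "\<exists>X. \<forall>n. P X n (X n)"
  proof (rule dependent_wf_choice[OF wf_less_than])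
    fix X Y :: "nat \<Rightarrow> 'h \<times> 'h" and n p assume "\<And>i. (i, n) \<in> less_than \<Longrightarrow> X i = Y i"
    then show "P X n p = P Y n p" by (simp add: P_def)
  next
    fix n :: nat and X :: "nat \<Rightarrow> 'h \<times> 'h"
    obtain x y where "norm x = 1" "norm y < d n" "\<forall>(u, v)\<in>A. cinner v x = cinner u y"
      "\<forall>f\<in>F \<union> (\<lambda>i. fst (X i)) ` {..<n}. norm (cinner f x) < d n"
      using weyl[of "d n" "F \<union> (\<lambda>i. fst (X i)) ` {..<n}"] F d by auto
    then have "P X n (x, y)" unfolding P_def by auto
    then show "\<exists>p. P X n p" by blast
  qed
  then obtain X where X: "\<And>n. P X n (X n)" by blast
  define x y where "x n = fst (X n)" and "y n = snd (X n)" for n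
  have nx: "norm (x n) = 1" and ny: "norm (y n) < d n"
    and adj: "\<And>u v. (u, v) \<in> A \<Longrightarrow> cinner v (x n) = cinner u (y n)"
    and xF: "\<And>f. f \<in> F \<Longrightarrow> norm (cinner f (x n)) < d n"
    and xx: "\<And>i. i < n \<Longrightarrow> norm (cinner (x i) (x n)) < d n" for n
    using X[of n] by (auto simp: P_def x_def y_def)
  \<comment> \<open>The choice at stage \<open>n\<close> controls earlier indices only; for
    \<open>i > n\<close> the bound comes from stage \<open>i\<close> and the monotonicity of
    \<open>d\<close>.\<close>
  have off: "norm (cinner (x i) (x n)) \<le> d n" if "i \<noteq> n" for i n
  proof (cases "i < n")
    case False
    then have "norm (cinner (x n) (x i)) < d i" "d i \<le> d n" using that xx d by auto
    then show ?thesis using cinner_commute[of "x i" "x n"] by simp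
  qed (use xx less_imp_le in blast)
  have sm: "summable (\<lambda>n. (1/2 :: real) ^ n *\<^sub>R x n)"
    by (rule summable_norm_cancel) (simp add: nx summable_geometric)
  define w where "w = (\<Sum>n. (1/2 :: real) ^ n *\<^sub>R x n)"
  have low: "(1/2) ^ n / 2 \<le> norm (cinner w (x n))" for n
  proof -
    have geo: "(\<lambda>i. (1/2 :: real) ^ i * d n) sums (2 * d n)"
      using sums_mult2[OF geometric_sums[of "1/2 :: real"], of "d n"] by simp
    define h where "h i = (1/2 :: real) ^ i *\<^sub>R cinner (x i) (x n)" for i
    have h: "h sums cinner w (x n)"
      using bounded_linear.sums[OF bounded_linear_cinner_left summable_sums[OF sm], of "x n"]
      by (simp add: w_def h_def[abs_def] scaleR_scaleC cinner_scaleC_left scaleR_conv_of_real)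
    have hn: "h n = of_real ((1/2) ^ n)"
      using cinner_self[of "x n"] by (simp add: h_def nx scaleR_conv_of_real)
    \<comment> \<open>Without its diagonal term the series for \<open>cinner w (x n)\<close> is
      dominated by the geometric series \<open>geo\<close>.\<close>
    define h' where "h' i = (if i = n then 0 else h i)" for i
    have "(\<lambda>i. h i - (if i = n then h i else 0)) sums (cinner w (x n) - h n)"
      by (intro sums_diff h sums_single)
    then have h': "h' sums (cinner w (x n) - h n)"
      by (rule sums_cong[THEN iffD1, rotated]) (simp add: h'_def)
    have le: "norm (h' i) \<le> (1/2) ^ i * d n" for i
      using off[of i n] d(1)[of n] by (simp add: h'_def h_def less_imp_le)
    have "norm (cinner w (x n) - h n) \<le> 2 * d n"
      using norm_suminf_le[OF le sums_summable[OF geo]] h' geo by (simp add: sums_iff)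
    moreover have "2 * d n \<le> (1/2) ^ n / 2"
      using power_mono[of "1/4 :: real" "1/2" n] zero_le_power[of "1/2 :: real" n]
      unfolding d_def by linarith
    moreover have "norm (h n) = (1/2) ^ n" by (simp add: hn norm_power)
    ultimately show ?thesis
      using norm_triangle_ineq2[of "h n" "cinner w (x n)"] by (simp add: norm_minus_commute)
  qed
  obtain u v where uv: "(u, v) \<in> A" "w - v \<in> cspan F" using coker[of w] by auto
  obtain z where z: "w - v = (\<Sum>f\<in>F. z f *\<^sub>C f)" using cspan_finite[OF F uv(2)] by blast
  \<comment> \<open>\<open>K\<close> depends on the decomposition of \<open>w\<close> but not on
    \<open>n\<close>, so \<open>n\<close> can be chosen afterwards with
    \<open>K < 2 ^ n\<close>.\<close>
  define K where "K = norm u + (\<Sum>f\<in>F. norm (z f))"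
  have up: "norm (cinner w (x n)) \<le> K * d n" for n
  proof -
    have "w = v + (\<Sum>f\<in>F. z f *\<^sub>C f)" using z by (simp add: algebra_simps)
    then have "cinner w (x n) = cinner u (y n) + (\<Sum>f\<in>F. z f * cinner f (x n))"
      by (simp add: cinner_add_left cinner_sum_left cinner_scaleC_left adj[OF uv(1)])
    also have "norm \<dots> \<le> norm u * d n + (\<Sum>f\<in>F. norm (z f) * d n)"
    proof (intro norm_triangle_mono sum_norm_le)
      show "norm (cinner u (y n)) \<le> norm u * d n"
        by (rule order_trans[OF norm_cinner_le]) (simp add: mult_left_mono less_imp_le[OF ny])
      show "norm (z f * cinner f (x n)) \<le> norm (z f) * d n" if "f \<in> F" for f
        by (simp add: norm_mult mult_left_mono less_imp_le[OF xF[OF that]])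
    qed
    finally show ?thesis by (simp add: K_def ring_distribs sum_distrib_right)
  qed
  obtain n where n: "K < 2 ^ n" using real_arch_pow[of 2 K] by auto
  have "(1/2) ^ n / 2 \<le> K * d n" using order_trans[OF low up] .
  also have "K * d n < 2 ^ n * d n" using n d(1) by (simp add: mult_strict_right_mono)
  also have "\<dots> = (1/2) ^ n / 8"
    by (simp add: d_def power_mult_distrib[symmetric])
  finally show False by simp
qed

section \<open>Exponentials in \<open>B\<^sup>2\<close>\<close>

lemma to_B2_TP_sum:
  "finite S \<Longrightarrow> to_B2 (\<lambda>x. \<Sum>\<mu>\<in>S. c \<mu> * expc \<mu> x) = (\<Sum>\<mu>\<in>S. c \<mu> *\<^sub>C to_B2 (expc \<mu>))"
  by (rule psd_op_terms(1)[where a = "\<lambda>_. 0"]) (auto intro: Cap_const)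

lemma norm_B2_expc: "norm (to_B2 (expc \<mu>)) = 1"
proof -
  have "complex_of_real ((norm (to_B2 (expc \<mu>)))\<^sup>2) = 1"
    by (simp only: cinner_self[symmetric] cinner_expc if_True simp_thms)
  then have "(norm (to_B2 (expc \<mu>)))\<^sup>2 = 1" by (simp only: of_real_eq_1_iff)
  then show ?thesis using norm_ge_zero[of "to_B2 (expc \<mu>)"] by (auto simp: power2_eq_1_iff)
qed

lemma cinner_expc_sum:
  "finite S \<Longrightarrow> cinner (\<Sum>\<nu>\<in>S. c \<nu> *\<^sub>C to_B2 (expc \<nu>)) (to_B2 (expc \<mu>)) = (if \<mu> \<in> S then c \<mu> else 0)"
  by (simp add: cinner_sum_left cinner_scaleC_left cinner_expc if_distrib[of "(*) _"] cong: if_cong)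

text \<open>Parseval's identity for finite sums, from the orthonormality of the
  exponentials.\<close>

lemma norm_expc_sum:
  assumes "finite S"
  shows "(norm (\<Sum>\<mu>\<in>S. c \<mu> *\<^sub>C to_B2 (expc \<mu>)))\<^sup>2 = (\<Sum>\<mu>\<in>S. (norm (c \<mu>))\<^sup>2)"
proof -
  let ?u = "\<Sum>\<mu>\<in>S. c \<mu> *\<^sub>C to_B2 (expc \<mu>)"
  have "complex_of_real ((norm ?u)\<^sup>2) = (\<Sum>\<mu>\<in>S. c \<mu> * cinner (to_B2 (expc \<mu>)) ?u)"
    by (simp only: cinner_self[symmetric] cinner_sum_left[of _ S] cinner_scaleC_left)
  also have "\<dots> = (\<Sum>\<mu>\<in>S. c \<mu> * cnj (c \<mu>))"
  proof (rule sum.cong[OF refl])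
    fix \<mu> assume "\<mu> \<in> S"
    then have "cinner ?u (to_B2 (expc \<mu>)) = c \<mu>" by (simp add: cinner_expc_sum assms)
    then show "c \<mu> * cinner (to_B2 (expc \<mu>)) ?u = c \<mu> * cnj (c \<mu>)"
      using cinner_commute[of "to_B2 (expc \<mu>)" ?u] by simp
  qed
  also have "\<dots> = of_real (\<Sum>\<mu>\<in>S. (norm (c \<mu>))\<^sup>2)"
    by (simp only: complex_norm_square[symmetric] of_real_sum)
  finally show ?thesis by (simp only: of_real_eq_iff)
qed

text \<open>The vectors orthogonal to \<open>u\<close> form a closed set that contains the dense set
  of trigonometric polynomials, hence also \<open>u\<close>.\<close>

lemma expc_total:
  fixes u :: "'n::finite B2"
  assumes "\<And>\<mu>. cinner u (to_B2 (expc \<mu>)) = 0" shows "u = 0"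
proof -
  have E: "cinner (to_B2 (expc \<mu>)) u = 0" for \<mu>
    by (subst cinner_commute) (simp add: assms)
  let ?W = "{w. cinner w u = 0}"
  have "to_B2 ` TP \<subseteq> ?W"
  proof clarify
    fix p :: "real^'n \<Rightarrow> complex" assume "p \<in> TP"
    then obtain S c where "finite S" "p = (\<lambda>x. \<Sum>\<mu>\<in>S. c \<mu> * expc \<mu> x)" using TP_D by blast
    then show "cinner (to_B2 p) u = 0"
      by (simp add: to_B2_TP_sum cinner_sum_left cinner_scaleC_left E)
  qed
  moreover have "closed ?W"
    by (intro closed_Collect_eq continuous_intros bounded_linear.continuous_on[OF bounded_linear_cinner_left])
  ultimately have "closure (to_B2 ` TP) \<subseteq> ?W" by (rule closure_minimal)
  then have "cinner u u = 0" using TP_dense by blast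
  then show ?thesis by (simp add: cinner_self)
qed

text \<open>Replace \<open>f\<close> by a nearby trigonometric polynomial with frequency set
  \<open>R\<close>. A modulation of \<open>p\<close> is orthogonal to it unless some \<kappa> +
  \<mu> with \<mu> in \<open>S\<close> lies in \<open>R\<close>, which leaves finitely many
  \<kappa>. This yields modulations almost orthogonal to a given finite set.\<close>

lemma finite_modulated_coeffs:
  fixes f :: "'n::finite B2"
  assumes p: "p \<in> TP" and e: "e > 0"
  shows "finite {\<kappa>. norm (cinner f (to_B2 (\<lambda>x. expc \<kappa> x * p x))) \<ge> e}"
proof -
  obtain S c where S: "finite S" "p = (\<lambda>x. \<Sum>\<mu>\<in>S. c \<mu> * expc \<mu> x)" using TP_D p by blast
  \<comment> \<open>The summand 1 keeps \<open>M\<close> positive when all coefficients vanish, so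
    that \<open>e / M\<close> is a positive tolerance.\<close>
  define M where "M = (\<Sum>\<mu>\<in>S. norm (c \<mu>)) + 1"
  have M: "M > 0" by (simp add: M_def add_nonneg_pos sum_nonneg)
  define g where "g \<kappa> = to_B2 (\<lambda>x. expc \<kappa> x * p x)" for \<kappa>
  have g: "g \<kappa> = (\<Sum>\<mu>\<in>S. c \<mu> *\<^sub>C to_B2 (expc (\<kappa> + \<mu>)))" for \<kappa>
  proof -
    have "(\<lambda>x. expc \<kappa> x * p x) = (\<lambda>x. \<Sum>\<mu>\<in>S. c \<mu> * expc (\<kappa> + \<mu>) x)"
      by (simp add: S expc_add sum_distrib_left mult_ac)
    then show ?thesis
      using to_B2_sum[OF S(1), of "\<lambda>\<mu> x. c \<mu> * expc (\<kappa> + \<mu>) x"]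
      by (simp add: g_def to_B2_cmult Cap_cmult TP_Cap expc_TP)
  qed
  have ng: "norm (g \<kappa>) < M" for \<kappa>
  proof -
    have "norm (g \<kappa>) \<le> (\<Sum>\<mu>\<in>S. norm (c \<mu>))"
      unfolding g by (rule sum_norm_le) (simp add: norm_scaleC norm_B2_expc)
    then show ?thesis by (simp add: M_def)
  qed
  have "f \<in> closure (to_B2 ` TP)" using TP_dense by blast
  moreover have "e / M > 0" using e M by simp
  ultimately obtain q where q: "q \<in> TP" "dist (to_B2 q) f < e / M"
    unfolding closure_approachable by blast
  obtain R d where R: "finite R" "q = (\<lambda>x. \<Sum>\<mu>\<in>R. d \<mu> * expc \<mu> x)" using TP_D q by blast
  have "{\<kappa>. norm (cinner f (g \<kappa>)) \<ge> e} \<subseteq> (\<lambda>(\<nu>, \<mu>). \<nu> - \<mu>) ` (R \<times> S)"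
  proof (rule subsetI, rule ccontr)
    fix \<kappa> assume "\<kappa> \<in> {\<kappa>. norm (cinner f (g \<kappa>)) \<ge> e}" and n: "\<kappa> \<notin> (\<lambda>(\<nu>, \<mu>). \<nu> - \<mu>) ` (R \<times> S)"
    then have l: "norm (cinner f (g \<kappa>)) \<ge> e" by simp
    have "cinner (to_B2 q) (to_B2 (expc (\<kappa> + \<mu>))) = 0" if "\<mu> \<in> S" for \<mu>
    proof -
      have "\<kappa> + \<mu> \<notin> R" using n that by (force simp: image_iff)
      then show ?thesis using R by (simp add: to_B2_TP_sum cinner_expc_sum)
    qed
    then have "cinner (to_B2 (expc (\<kappa> + \<mu>))) (to_B2 q) = 0" if "\<mu> \<in> S" for \<mu>
      using that by (subst cinner_commute) simp
    then have "cinner (g \<kappa>) (to_B2 q) = 0"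
      by (simp add: g cinner_sum_left cinner_scaleC_left)
    then have "cinner (to_B2 q) (g \<kappa>) = 0" by (subst cinner_commute) simp
    then have "norm (cinner f (g \<kappa>)) = norm (cinner (f - to_B2 q) (g \<kappa>))" by (simp add: cinner_diff_left)
    also have "\<dots> \<le> norm (f - to_B2 q) * norm (g \<kappa>)" by (rule norm_cinner_le)
    also have "\<dots> \<le> norm (f - to_B2 q) * M" using ng[of \<kappa>] by (intro mult_left_mono) auto
    also have "\<dots> < e" using q M by (simp add: dist_norm norm_minus_commute pos_less_divide_eq)
    finally show False using l by simp
  qed
  then show ?thesis unfolding g_def by (rule finite_subset) (simp add: R(1) S(1))
qed

section \<open>Fourier multipliers\<close>

definition multiplier :: "(real^'n \<Rightarrow> complex) \<Rightarrow> ('n B2 \<times> 'n B2) set" where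
  "multiplier \<beta> = psd_op (\<lambda>(x, \<xi>). \<beta> \<xi>)"

text \<open>In the orthonormal coordinates of the exponentials the operator is diagonal.\<close>

lemma multiplier_eq:
  "multiplier \<beta> = {(\<Sum>\<mu>\<in>S. c \<mu> *\<^sub>C to_B2 (expc \<mu>), \<Sum>\<mu>\<in>S. (c \<mu> * \<beta> \<mu>) *\<^sub>C to_B2 (expc \<mu>)) | S c. finite S}"
proof -
  have "to_B2 (\<lambda>x. \<Sum>\<mu>\<in>S. c \<mu> * (\<beta> \<mu> * expc \<mu> x)) = (\<Sum>\<mu>\<in>S. (c \<mu> * \<beta> \<mu>) *\<^sub>C to_B2 (expc \<mu>))"
    if "finite S" for S c
    using to_B2_TP_sum[OF that, of "\<lambda>\<mu>. c \<mu> * \<beta> \<mu>"] by (simp add: mult.assoc)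
  then show ?thesis
    unfolding multiplier_def psd_op_def by (intro Collect_cong ex_cong1) (auto simp: to_B2_TP_sum)
qed

lemma multiplier_I:
  "finite S \<Longrightarrow> (\<Sum>\<mu>\<in>S. c \<mu> *\<^sub>C to_B2 (expc \<mu>), \<Sum>\<mu>\<in>S. (c \<mu> * \<beta> \<mu>) *\<^sub>C to_B2 (expc \<mu>)) \<in> multiplier \<beta>"
  unfolding multiplier_eq by blast

lemma multiplier_E:
  assumes "(u, v) \<in> multiplier \<beta>"
  obtains S c where "finite S" "u = (\<Sum>\<mu>\<in>S. c \<mu> *\<^sub>C to_B2 (expc \<mu>))" "v = (\<Sum>\<mu>\<in>S. (c \<mu> * \<beta> \<mu>) *\<^sub>C to_B2 (expc \<mu>))"
  using assms unfolding multiplier_eq by blast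

lemma multiplier_diff:
  assumes "(u, v) \<in> multiplier \<beta>" "(u', v') \<in> multiplier \<beta>"
  shows "(u - u', v - v') \<in> multiplier \<beta>"
proof -
  obtain S c where S: "finite S" and u: "u = (\<Sum>\<mu>\<in>S. c \<mu> *\<^sub>C to_B2 (expc \<mu>))"
    and v: "v = (\<Sum>\<mu>\<in>S. (c \<mu> * \<beta> \<mu>) *\<^sub>C to_B2 (expc \<mu>))" using multiplier_E assms(1) by blast
  obtain R d where R: "finite R" and u': "u' = (\<Sum>\<mu>\<in>R. d \<mu> *\<^sub>C to_B2 (expc \<mu>))"
    and v': "v' = (\<Sum>\<mu>\<in>R. (d \<mu> * \<beta> \<mu>) *\<^sub>C to_B2 (expc \<mu>))" using multiplier_E assms(2) by blast
  \<comment> \<open>Both coefficient families are extended by 0 to the common frequency set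
    \<open>S \<union> R\<close>. The free factor \<gamma> below serves both components: \<gamma> = 1
    for the first and \<gamma> = \<beta> for the second.\<close>
  define k where "k \<mu> = (if \<mu> \<in> S then c \<mu> else 0) - (if \<mu> \<in> R then d \<mu> else 0)" for \<mu>
  have ext: "(\<Sum>\<mu>\<in>Q. (h \<mu> * \<gamma> \<mu>) *\<^sub>C to_B2 (expc \<mu>)) = (\<Sum>\<mu>\<in>S \<union> R. ((if \<mu> \<in> Q then h \<mu> else 0) * \<gamma> \<mu>) *\<^sub>C to_B2 (expc \<mu>))"
    if "Q \<subseteq> S \<union> R" for Q h \<gamma>
    using S R that by (intro sum.mono_neutral_cong_left) auto
  have k: "(\<Sum>\<mu>\<in>S \<union> R. (k \<mu> * \<gamma> \<mu>) *\<^sub>C to_B2 (expc \<mu>)) =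
      (\<Sum>\<mu>\<in>S. (c \<mu> * \<gamma> \<mu>) *\<^sub>C to_B2 (expc \<mu>)) - (\<Sum>\<mu>\<in>R. (d \<mu> * \<gamma> \<mu>) *\<^sub>C to_B2 (expc \<mu>))" for \<gamma>
    unfolding ext[of S, OF Un_upper1] ext[of R, OF Un_upper2] sum_subtractf[symmetric]
      scaleC_diff_left[symmetric] left_diff_distrib[symmetric] k_def ..
  show ?thesis
    using multiplier_I[of "S \<union> R" k \<beta>] S R k[of "\<lambda>_. 1"] k[of \<beta>] by (simp add: u v u' v')
qed

lemma multiplier_expc: "(to_B2 (expc \<mu>), \<beta> \<mu> *\<^sub>C to_B2 (expc \<mu>)) \<in> multiplier \<beta>"
  using multiplier_I[of "{\<mu>}" "\<lambda>_. 1" \<beta>] by simp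

text \<open>The relation holds for finite sums and is closed, so it passes to the closure. It says
  that \<open>to_B2 (expc \<mu>)\<close> is an eigenvector of the adjoint with eigenvalue
  \<open>cnj (\<beta> \<mu>)\<close>.\<close>

lemma multiplier_coeff:
  assumes "(u, v) \<in> closure (multiplier \<beta>)"
  shows "cinner v (to_B2 (expc \<mu>)) = \<beta> \<mu> * cinner u (to_B2 (expc \<mu>))"
proof -
  let ?W = "{w. cinner (snd w) (to_B2 (expc \<mu>)) = \<beta> \<mu> * cinner (fst w) (to_B2 (expc \<mu>))}"
  have "closed ?W"
    by (intro closed_Collect_eq continuous_intros bounded_linear.continuous_on[OF bounded_linear_cinner_left])
  moreover have "multiplier \<beta> \<subseteq> ?W"
    by (auto elim!: multiplier_E simp: cinner_expc_sum)
  ultimately have "closure (multiplier \<beta>) \<subseteq> ?W" by (rule closure_minimal[rotated])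
  with assms show ?thesis by auto
qed

text \<open>Parseval's identity gives the estimate coefficient by coefficient on finite sums; both
  sides are continuous, so it extends to the closure.\<close>

lemma multiplier_lower_bound:
  assumes e: "e \<ge> 0" "\<And>\<mu>. e \<le> norm (\<beta> \<mu> - s)" and uv: "(u, v) \<in> closure (multiplier \<beta>)"
  shows "e * norm u \<le> norm (v - s *\<^sub>C u)"
proof -
  let ?W = "{w. e * norm (fst w) \<le> norm (snd w - s *\<^sub>C fst w)}"
  have "closed ?W"
    by (intro closed_Collect_le continuous_intros bounded_linear.continuous_on[OF bounded_linear_scaleC])
  moreover have "multiplier \<beta> \<subseteq> ?W"
  proof (clarsimp)
    fix u v :: "'a B2" assume "(u, v) \<in> multiplier \<beta>"
    then obtain S c where S: "finite S" and u: "u = (\<Sum>\<mu>\<in>S. c \<mu> *\<^sub>C to_B2 (expc \<mu>))"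
      and v: "v = (\<Sum>\<mu>\<in>S. (c \<mu> * \<beta> \<mu>) *\<^sub>C to_B2 (expc \<mu>))" using multiplier_E by blast
    have d: "v - s *\<^sub>C u = (\<Sum>\<mu>\<in>S. (c \<mu> * (\<beta> \<mu> - s)) *\<^sub>C to_B2 (expc \<mu>))"
      unfolding u v scaleC_sum_right scaleC_scaleC sum_subtractf[symmetric] scaleC_diff_left[symmetric]
      by (simp add: algebra_simps)
    have "(e * norm u)\<^sup>2 = (\<Sum>\<mu>\<in>S. e\<^sup>2 * (norm (c \<mu>))\<^sup>2)"
      by (simp add: u norm_expc_sum S power_mult_distrib sum_distrib_left)
    also have "\<dots> \<le> (\<Sum>\<mu>\<in>S. (norm (c \<mu> * (\<beta> \<mu> - s)))\<^sup>2)"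
      unfolding norm_mult power_mult_distrib mult.commute[of "e\<^sup>2"]
      using e by (intro sum_mono mult_left_mono power_mono) auto
    also have "\<dots> = (norm (v - s *\<^sub>C u))\<^sup>2"
      by (simp only: d norm_expc_sum[OF S])
    finally show "e * norm u \<le> norm (v - s *\<^sub>C u)" by (rule power2_le_imp_le) simp
  qed
  ultimately have "closure (multiplier \<beta>) \<subseteq> ?W" by (rule closure_minimal[rotated])
  with uv show ?thesis by auto
qed

text \<open>Off the range of \<beta> the relation of \<open>multiplier_coeff\<close> determines each
  Fourier coefficient of a preimage, and the exponentials are total.\<close>

lemma multiplier_inj:
  assumes s: "s \<notin> range \<beta>"
    and "(u, w) \<in> op_shift (closure (multiplier \<beta>)) s" "(u', w) \<in> op_shift (closure (multiplier \<beta>)) s"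
  shows "u = u'"
proof -
  have "cinner (u - u') (to_B2 (expc \<mu>)) = 0" for \<mu>
  proof -
    have "(\<beta> \<mu> - s) * cinner u (to_B2 (expc \<mu>)) = cinner w (to_B2 (expc \<mu>))"
      if "(u, w) \<in> op_shift (closure (multiplier \<beta>)) s" for u
      using multiplier_coeff[OF that[unfolded op_shift_iff], of \<mu>]
      by (simp add: cinner_add_left cinner_scaleC_left left_diff_distrib diff_eq_eq)
    from this[OF assms(2)] this[OF assms(3)]
    have "(\<beta> \<mu> - s) * cinner (u - u') (to_B2 (expc \<mu>)) = 0"
      by (simp add: cinner_diff_left right_diff_distrib)
    then show ?thesis using s by auto
  qed
  then show ?thesis using expc_total[of "u - u'"] by simp
qed

text \<open>Dividing the coefficients by \<open>\<beta> \<mu> - s\<close> gives a finite sum again,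
  even when \<open>s\<close> is a limit point of the range; this yields the dense range on the
  continuous spectrum.\<close>

lemma multiplier_range:
  assumes s: "s \<notin> range \<beta>" and p: "p \<in> TP"
  obtains u where "(u, to_B2 p) \<in> op_shift (multiplier \<beta>) s"
proof -
  obtain S c where S: "finite S" "p = (\<lambda>x. \<Sum>\<mu>\<in>S. c \<mu> * expc \<mu> x)" using TP_D p by blast
  have "\<beta> \<mu> \<noteq> s" for \<mu> using s by auto
  then have "c \<mu> / (\<beta> \<mu> - s) * \<beta> \<mu> = c \<mu> + s * (c \<mu> / (\<beta> \<mu> - s))" for \<mu> by (simp add: field_simps)
  then have "(\<Sum>\<mu>\<in>S. (c \<mu> / (\<beta> \<mu> - s) * \<beta> \<mu>) *\<^sub>C to_B2 (expc \<mu>)) =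
      to_B2 p + s *\<^sub>C (\<Sum>\<mu>\<in>S. (c \<mu> / (\<beta> \<mu> - s)) *\<^sub>C to_B2 (expc \<mu>))"
    by (simp add: S to_B2_TP_sum scaleC_sum_right scaleC_scaleC scaleC_add_left sum.distrib)
  then show ?thesis
    using that multiplier_I[OF S(1), of "\<lambda>\<mu>. c \<mu> / (\<beta> \<mu> - s)" \<beta>] by (simp add: op_shift_iff)
qed

text \<open>At distance \<open>e > 0\<close> from the range the lower bound makes the inverse
  bounded. It also makes the preimages of trigonometric polynomials tending to \<open>w\<close> a
  Cauchy sequence, whose limit is a preimage of \<open>w\<close> under the closure.\<close>

lemma multiplier_spectrum_subset: "spectrum (closure (multiplier \<beta>)) \<subseteq> closure (range \<beta>)"
proof (rule subsetI, rule ccontr)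
  fix s assume s: "s \<in> spectrum (closure (multiplier \<beta>))" "s \<notin> closure (range \<beta>)"
  let ?A = "op_shift (closure (multiplier \<beta>)) s"
  obtain e where "e > 0" "\<forall>z\<in>range \<beta>. \<not> dist z s < e"
    using s(2) unfolding closure_approachable by blast
  then have e: "e > 0" "e \<le> norm (\<beta> \<mu> - s)" for \<mu>
    by (auto simp: dist_norm not_less)
  have sr: "s \<notin> range \<beta>" using s(2) closure_subset[of "range \<beta>"] by blast
  have lower: "e * norm u \<le> norm w" if "(u, w) \<in> ?A" for u w
    using multiplier_lower_bound[of e \<beta> s u "w + s *\<^sub>C u"] e that by (simp add: op_shift_iff)
  have surj: "\<exists>u. (u, w) \<in> ?A" for w
  proof -
    have "w \<in> closure (to_B2 ` TP)" using TP_dense by blast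
    then obtain W where W: "\<And>n. W n \<in> to_B2 ` TP" "W \<longlonglongrightarrow> w" unfolding closure_sequential by blast
    have "\<exists>u. (u, W n) \<in> op_shift (multiplier \<beta>) s" for n
      using W(1)[of n] multiplier_range[OF sr] by (metis imageE)
    then obtain U where U: "\<And>n. (U n, W n) \<in> op_shift (multiplier \<beta>) s" by metis
    have UW: "e * norm (U m - U n) \<le> norm (W m - W n)" for m n
    proof -
      have "(U m - U n, (W m + s *\<^sub>C U m) - (W n + s *\<^sub>C U n)) \<in> closure (multiplier \<beta>)"
        using U by (intro subsetD[OF closure_subset] multiplier_diff) (simp_all add: op_shift_iff)
      from multiplier_lower_bound[OF less_imp_le[OF e(1)] e(2) this]
      show ?thesis by (simp add: scaleC_diff_right algebra_simps)
    qed
    have "Cauchy U"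
    proof (rule metric_CauchyI)
      fix r :: real assume "r > 0"
      then obtain N where N: "\<And>m n. m \<ge> N \<Longrightarrow> n \<ge> N \<Longrightarrow> dist (W m) (W n) < e * r"
        using metric_CauchyD[OF LIMSEQ_imp_Cauchy[OF W(2)], of "e * r"] e by auto
      have "dist (U m) (U n) < r" if "m \<ge> N" "n \<ge> N" for m n
        using le_less_trans[OF UW N[OF that, unfolded dist_norm]] e by (simp add: dist_norm)
      then show "\<exists>M. \<forall>m\<ge>M. \<forall>n\<ge>M. dist (U m) (U n) < r" by blast
    qed
    then obtain u where u: "U \<longlonglongrightarrow> u" by (auto simp: Cauchy_convergent_iff convergent_def)
    have "(\<lambda>n. (U n, W n + s *\<^sub>C U n)) \<longlonglongrightarrow> (u, w + s *\<^sub>C u)"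
      by (intro tendsto_Pair tendsto_add bounded_linear.tendsto[OF bounded_linear_scaleC] u W)
    moreover have "(U n, W n + s *\<^sub>C U n) \<in> multiplier \<beta>" for n using U by (simp add: op_shift_iff)
    ultimately have "(u, w + s *\<^sub>C u) \<in> closure (multiplier \<beta>)"
      unfolding closure_sequential by (intro exI conjI allI)
    then show ?thesis by (auto simp: op_shift_iff)
  qed
  have "\<forall>w. \<exists>!u. (u, w) \<in> ?A" using surj multiplier_inj[OF sr] by blast
  moreover have "\<forall>(u, w)\<in>?A. norm u \<le> (1 / e) * norm w"
    using lower e(1) by (auto simp: field_simps)
  ultimately have "s \<notin> spectrum (closure (multiplier \<beta>))" unfolding spectrum_def by blast
  with s show False by blast
qed

text \<open>By continuity the frequencies with \<open>norm (\<beta> \<mu> - s) < e\<close> form a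
  nonempty open set, hence an infinite one, so some of them avoid the finitely many exponentials
  correlated with \<open>E\<close>. These are the approximate eigenvectors for
  \<open>not_fredholm\<close>.\<close>

lemma multiplier_ess_spectrum:
  fixes \<beta> :: "real^'n \<Rightarrow> complex"
  assumes cont: "continuous_on UNIV \<beta>"
  shows "closure (range \<beta>) \<subseteq> ess_spectrum (closure (multiplier \<beta>))"
proof
  fix s assume s: "s \<in> closure (range \<beta>)"
  have "\<not> fredholm (op_shift (closure (multiplier \<beta>)) s)"
  proof (rule not_fredholm)
    fix e :: real and E :: "'n B2 set" assume e: "e > 0" and E: "finite E"
    let ?L = "{\<mu>. norm (\<beta> \<mu> - s) < e}"
    obtain \<mu>0 where "\<mu>0 \<in> ?L"
      using s e unfolding closure_approachable dist_norm by blast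
    moreover have "open ?L"
      by (intro open_Collect_less continuous_intros cont)
    ultimately have "infinite ?L" using finite_imp_not_open by blast
    \<comment> \<open>The constant polynomial 1 turns the modulations into the exponentials
      themselves.\<close>
    moreover have "finite (\<Union>f\<in>E. {\<mu>. norm (cinner f (to_B2 (expc \<mu>))) \<ge> e})"
      using finite_modulated_coeffs[where 'n = 'n, OF TP_const[of 1] e] E by simp
    ultimately have "\<not> ?L \<subseteq> (\<Union>f\<in>E. {\<mu>. norm (cinner f (to_B2 (expc \<mu>))) \<ge> e})"
      using finite_subset by blast
    then obtain \<mu> where "\<mu> \<in> ?L" "\<mu> \<notin> (\<Union>f\<in>E. {\<mu>. norm (cinner f (to_B2 (expc \<mu>))) \<ge> e})"
      by blast
    then have m: "norm (\<beta> \<mu> - s) < e" "\<forall>f\<in>E. norm (cinner f (to_B2 (expc \<mu>))) < e"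
      by (auto simp: not_le)
    have "cinner v (to_B2 (expc \<mu>)) = cinner u (cnj (\<beta> \<mu> - s) *\<^sub>C to_B2 (expc \<mu>))"
      if "(u, v) \<in> op_shift (closure (multiplier \<beta>)) s" for u v
      using multiplier_coeff[OF that[unfolded op_shift_iff], of \<mu>]
      by (simp add: cinner_scaleC_right cinner_add_left cinner_scaleC_left algebra_simps)
    moreover have "norm (cnj (\<beta> \<mu> - s) *\<^sub>C to_B2 (expc \<mu>)) < e"
      using m(1) unfolding norm_scaleC norm_B2_expc complex_mod_cnj by simp
    ultimately show "\<exists>x y. norm x = 1 \<and> norm y < e \<and>
        (\<forall>(u, v)\<in>op_shift (closure (multiplier \<beta>)) s. cinner v x = cinner u y) \<and> (\<forall>f\<in>E. norm (cinner f x) < e)"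
      using m(2) norm_B2_expc[of \<mu>] by blast
  qed
  then show "s \<in> ess_spectrum (closure (multiplier \<beta>))" by (simp add: ess_spectrum_def)
qed

text \<open>At \<open>s = \<beta> \<mu>\<close> the shifted operator sends both
  \<open>to_B2 (expc \<mu>)\<close> and 0 to 0.\<close>

lemma multiplier_point_spectrum: "point_spectrum (closure (multiplier \<beta>)) = range \<beta>"
proof (intro set_eqI iffI)
  fix s assume "s \<in> point_spectrum (closure (multiplier \<beta>))"
  then show "s \<in> range \<beta>"
    using multiplier_inj[of s \<beta>] by (auto simp: point_spectrum_def single_valued_def)
next
  fix s assume "s \<in> range \<beta>"
  then obtain \<mu> where s: "s = \<beta> \<mu>" by blast
  let ?A = "op_shift (closure (multiplier \<beta>)) s"
  have "(to_B2 (expc \<mu>), 0) \<in> ?A"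
    using subsetD[OF closure_subset multiplier_expc[of \<mu> \<beta>]] by (simp add: op_shift_iff s)
  moreover have "(0, 0) \<in> ?A"
    using subsetD[OF closure_subset multiplier_I[of "{}" _ \<beta>]] by (simp add: op_shift_iff)
  moreover have "to_B2 (expc \<mu>) \<noteq> 0" using norm_B2_expc[of \<mu>] by auto
  ultimately show "s \<in> point_spectrum (closure (multiplier \<beta>))"
    by (auto simp: point_spectrum_def single_valued_def)
qed

lemma multiplier_dense_range:
  fixes \<beta> :: "real^'n \<Rightarrow> complex"
  assumes "s \<notin> range \<beta>"
  shows "closure (Range (op_shift (closure (multiplier \<beta>)) s)) = UNIV"
proof -
  have "to_B2 ` TP \<subseteq> Range (op_shift (closure (multiplier \<beta>)) s)"
  proof clarify
    fix p :: "real^'n \<Rightarrow> complex" assume "p \<in> TP"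
    then obtain u where "(u, to_B2 p) \<in> op_shift (multiplier \<beta>) s" using multiplier_range[OF assms] by metis
    then show "to_B2 p \<in> Range (op_shift (closure (multiplier \<beta>)) s)"
      using subsetD[OF closure_subset, of _ "multiplier \<beta>"] by (intro RangeI) (simp add: op_shift_iff)
  qed
  then show ?thesis using closure_mono TP_dense by blast
qed

section \<open>Multiplication operators\<close>

lemma mult_B2_mult:
  assumes "f \<in> C_ap" "g \<in> C_ap" shows "mult_B2 f (mult_B2 g u) = mult_B2 (\<lambda>x. f x * g x) u"
proof -
  obtain X where "cauchyB X" "u = abs_B2 X" using B2_rep by blast
  with assms show ?thesis by (simp add: mult_B2_abs cauchyB_mult Cap_mult mult.assoc)
qed

lemma mult_B2_add:
  assumes "f \<in> C_ap" "g \<in> C_ap" shows "mult_B2 (\<lambda>x. f x + g x) u = mult_B2 f u + mult_B2 g u"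
proof -
  obtain X where "cauchyB X" "u = abs_B2 X" using B2_rep by blast
  with assms show ?thesis
    by (simp add: mult_B2_abs cauchyB_mult Cap_add plus_B2.abs_eq distrib_right)
qed

lemma mult_B2_const: "mult_B2 (\<lambda>x. c) u = c *\<^sub>C u"
proof -
  obtain X where "cauchyB X" "u = abs_B2 X" using B2_rep by blast
  then show ?thesis by (simp add: mult_B2_abs Cap_const scaleC_B2.abs_eq)
qed

lemma mult_B2_cmult: "f \<in> C_ap \<Longrightarrow> mult_B2 (\<lambda>x. c * f x) u = c *\<^sub>C mult_B2 f u"
  using mult_B2_mult[OF Cap_const, of f c u] by (simp add: mult_B2_const)

lemma mult_B2_diff:
  assumes "f \<in> C_ap" "g \<in> C_ap" shows "mult_B2 (\<lambda>x. f x - g x) u = mult_B2 f u - mult_B2 g u"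
  using mult_B2_add[OF Cap_diff[OF assms] assms(2), of u] by simp

lemma mult_B2_sum:
  "finite S \<Longrightarrow> (\<And>i. i \<in> S \<Longrightarrow> f i \<in> C_ap) \<Longrightarrow> mult_B2 (\<lambda>x. \<Sum>i\<in>S. f i x) u = (\<Sum>i\<in>S. mult_B2 (f i) u)"
proof (induction S rule: finite_induct)
  case empty
  then show ?case by (simp add: mult_B2_const)
next
  case (insert i S)
  then show ?case using to_B2_sum[of S f] by (simp add: mult_B2_add)
qed

text \<open>The two mean values coincide along the representing sequences, and the identity passes
  to the limit. It supplies the adjoint for \<open>not_fredholm\<close>.\<close>

lemma cinner_mult_B2:
  assumes f: "f \<in> C_ap" shows "cinner (mult_B2 f u) v = cinner u (mult_B2 (\<lambda>x. cnj (f x)) v)"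
proof -
  obtain X where X: "cauchyB X" "u = abs_B2 X" using B2_rep by blast
  obtain Y where Y: "cauchyB Y" "v = abs_B2 Y" using B2_rep by blast
  have "(\<lambda>n. ipB (\<lambda>x. f x * X n x) (Y n)) \<longlonglongrightarrow> cinner (mult_B2 f u) v"
    using cinner_abs_B2[OF cauchyB_mult[OF f X(1)] Y(1)] X Y f by (simp add: mult_B2_abs)
  moreover have "(\<lambda>n. ipB (X n) (\<lambda>x. cnj (f x) * Y n x)) \<longlonglongrightarrow> cinner u (mult_B2 (\<lambda>x. cnj (f x)) v)"
    using cinner_abs_B2[OF X(1) cauchyB_mult[OF Cap_cnj[OF f] Y(1)]] X Y f by (simp add: mult_B2_abs Cap_cnj)
  moreover have "ipB (\<lambda>x. f x * X n x) (Y n) = ipB (X n) (\<lambda>x. cnj (f x) * Y n x)" for n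
    by (simp add: ipB_def mult_ac)
  ultimately show ?thesis using LIMSEQ_unique by auto
qed

lemma norm_mult_B2_le:
  assumes f: "f \<in> C_ap" and B: "\<And>x. norm (f x) \<le> B" shows "norm (mult_B2 f u) \<le> B * norm u"
proof -
  obtain X where X: "cauchyB X" "u = abs_B2 X" using B2_rep by blast
  have "(\<lambda>n. normB (\<lambda>x. f x * X n x)) \<longlonglongrightarrow> norm (mult_B2 f u)"
    using norm_abs_B2[OF cauchyB_mult[OF f X(1)]] f X by (simp add: mult_B2_abs)
  moreover have "(\<lambda>n. B * normB (X n)) \<longlonglongrightarrow> B * norm u"
    using norm_abs_B2[OF X(1)] X(2) by (intro tendsto_mult tendsto_const) simp
  ultimately show ?thesis
    by (rule LIMSEQ_le) (use normB_mult_le[OF f cauchyB_Cap[OF X(1)] B] in blast)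
qed

lemma mult_B2_expc: "mult_B2 (expc \<mu>) (to_B2 (expc \<nu>)) = to_B2 (expc (\<mu> + \<nu>))"
  by (simp add: mult_B2_to_B2 TP_Cap expc_TP expc_add[symmetric])

text \<open>Multiplication by \<open>expc (-\<mu>)\<close> is the inverse, and both maps are
  contractions.\<close>

lemma norm_mult_B2_expc: "norm (mult_B2 (expc \<mu>) u) = norm u"
proof (rule antisym)
  have C: "expc \<nu> \<in> C_ap" for \<nu> by (rule TP_Cap[OF expc_TP])
  have le: "norm (mult_B2 (expc \<nu>) v) \<le> norm v" for \<nu> v
    using norm_mult_B2_le[OF C, of \<nu> 1 v] by simp
  show "norm (mult_B2 (expc \<mu>) u) \<le> norm u" by (rule le)
  have "mult_B2 (expc (-\<mu>)) (mult_B2 (expc \<mu>) u) = u"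
    by (simp add: mult_B2_mult C expc_add[symmetric] mult_B2_const)
  then show "norm u \<le> norm (mult_B2 (expc \<mu>) u)" using le[of "-\<mu>" "mult_B2 (expc \<mu>) u"] by simp
qed

section \<open>Uniform limits and inverses in \<open>C_ap\<close>\<close>

lemma Cap_approx:
  assumes "f \<in> C_ap" "e > 0" obtains p where "p \<in> TP" "\<And>x. norm (p x - f x) < e"
proof -
  obtain p where p: "\<And>n. p n \<in> TP" "uniform_limit UNIV p f sequentially" using CapE assms by blast
  show ?thesis
    using uniform_limitD[OF p(2) assms(2)] that[OF p(1)] by (auto simp: eventually_sequentially dist_norm)
qed

lemma Cap_limit:
  assumes "\<And>e. e > 0 \<Longrightarrow> \<exists>f\<in>C_ap. \<forall>x. norm (f x - g x) < e" shows "g \<in> C_ap"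
proof -
  have "\<exists>p\<in>TP. \<forall>x. norm (p x - g x) < inverse (real (Suc n))" for n
  proof -
    \<comment> \<open>The error is split in half between passing from \<open>g\<close> to
      \<open>f\<close> and from \<open>f\<close> to a trigonometric polynomial.\<close>
    define e where "e = inverse (real (Suc n)) / 2"
    have e: "e > 0" by (simp add: e_def)
    obtain f where f: "f \<in> C_ap" "\<forall>x. norm (f x - g x) < e" using assms[OF e] by blast
    obtain p where p: "p \<in> TP" "\<And>x. norm (p x - f x) < e" using Cap_approx[OF f(1) e] by blast
    have "norm (p x - g x) < e + e" for x
      using norm_triangle_ineq[of "p x - f x" "f x - g x"] p(2)[of x] f(2)[THEN spec, of x] by simp
    then show ?thesis using p(1) by (auto simp: e_def)
  qed
  then obtain p where p: "\<And>n. p n \<in> TP" "\<And>n x. norm (p n x - g x) < inverse (real (Suc n))" by metis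
  have "uniform_limit UNIV p g sequentially"
  proof (rule uniform_limitI)
    fix e :: real assume "e > 0"
    then have "\<forall>\<^sub>F n in sequentially. inverse (real (Suc n)) < e"
      using LIMSEQ_inverse_real_of_nat order_tendstoD(2) by blast
    then show "\<forall>\<^sub>F n in sequentially. \<forall>x\<in>UNIV. dist (p n x) (g x) < e"
      by eventually_elim (use p(2) in \<open>auto simp: dist_norm simp del: of_nat_Suc intro: less_trans\<close>)
  qed
  with p(1) show ?thesis by (rule CapI)
qed

text \<open>The partial sums of the geometric series lie in \<open>C_ap\<close> and converge
  uniformly, the remainder being at most \<open>r ^ n / (1 - r)\<close>.\<close>

lemma Cap_geometric:
  assumes q: "q \<in> C_ap" and r: "\<And>x. norm (q x) \<le> r" "r < 1"
  shows "(\<lambda>x. 1 / (1 - q x)) \<in> C_ap"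
proof (rule Cap_limit)
  fix e :: real assume e: "e > 0"
  have r0: "r \<ge> 0" using r(1)[of undefined] norm_ge_zero order_trans by blast
  obtain n where n: "r ^ n < e * (1 - r)"
    using real_arch_pow_inv[of "e * (1 - r)" r] e r by auto
  have "(\<lambda>x. \<Sum>k<m. q x ^ k) \<in> C_ap" for m
  proof (induction m)
    case (Suc m)
    \<comment> \<open>Horner form: the induction uses only closure under sums and products.\<close>
    have "(\<lambda>x. \<Sum>k<Suc m. q x ^ k) = (\<lambda>x. 1 + q x * (\<Sum>k<m. q x ^ k))"
      by (simp add: sum.lessThan_Suc_shift sum_distrib_left del: sum.lessThan_Suc)
    then show ?case by (simp only:) (intro Cap_add Cap_const Cap_mult q Suc)
  qed (simp add: Cap_const)
  moreover have "norm ((\<Sum>k<n. q x ^ k) - 1 / (1 - q x)) < e" for x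
  proof -
    have 1: "q x \<noteq> 1" using r(1)[of x] r(2) by auto
    have d: "1 - r \<le> norm (1 - q x)" using norm_triangle_ineq2[of 1 "q x"] r(1)[of x] by simp
    have "(\<Sum>k<n. q x ^ k) - 1 / (1 - q x) = - (q x ^ n / (1 - q x))"
      using 1 by (simp add: sum_gp_strict diff_divide_distrib)
    then have "norm ((\<Sum>k<n. q x ^ k) - 1 / (1 - q x)) = norm (q x) ^ n / norm (1 - q x)"
      by (simp add: norm_divide norm_power)
    also have "\<dots> \<le> r ^ n / (1 - r)"
      using r r0 d by (intro frac_le power_mono) auto
    also have "\<dots> < e" using n r(2) by (simp add: pos_divide_less_eq)
    finally show ?thesis .
  qed
  ultimately show "\<exists>f\<in>C_ap. \<forall>x. norm (f x - 1 / (1 - q x)) < e"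
    by (intro bexI[of _ "\<lambda>x. \<Sum>k<n. q x ^ k"]) auto
qed

text \<open>With \<open>M = sup |g|\<close>, the identity \<open>1/g = cnj g / (M\<^sup>2 (1 - q))\<close> for \<open>q = 1 - |g|\<^sup>2/M\<^sup>2\<close> reduces this to the geometric series.\<close>

lemma Cap_inverse:
  fixes g :: "real^'n \<Rightarrow> complex"
  assumes g: "g \<in> C_ap" and e: "e > 0" "\<And>x. e \<le> norm (g x)"
  shows "(\<lambda>x. 1 / g x) \<in> C_ap"
proof -
  obtain M where M: "M > 0" "\<And>x. norm (g x) \<le> M" using Cap_bounded[OF g] by blast
  define q where "q x = 1 - of_real (1 / M\<^sup>2) * (g x * cnj (g x))" for x
  have q: "q x = of_real (1 - (norm (g x))\<^sup>2 / M\<^sup>2)" for x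
    unfolding q_def complex_norm_square[symmetric] of_real_mult[symmetric]
    by (simp del: of_real_power of_real_divide)
  have qC: "q \<in> C_ap" unfolding q_def[abs_def] by (intro Cap_diff Cap_const Cap_mult Cap_cnj g)
  have nq: "norm (q x) \<le> 1 - e\<^sup>2 / M\<^sup>2" for x
  proof -
    \<comment> \<open>This makes \<open>q x\<close> nonnegative, so that the bound on its value
      bounds its modulus.\<close>
    have "(norm (g x))\<^sup>2 / M\<^sup>2 \<le> 1" using M power_mono[OF M(2)[of x], of 2] by simp
    moreover have "e\<^sup>2 / M\<^sup>2 \<le> (norm (g x))\<^sup>2 / M\<^sup>2" using e by (intro divide_right_mono power_mono) auto
    ultimately show ?thesis unfolding q norm_of_real by linarith
  qed
  have "1 - e\<^sup>2 / M\<^sup>2 < 1" using e M by simp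
  then have "(\<lambda>x. 1 / (1 - q x)) \<in> C_ap"
    using Cap_geometric[OF qC nq] by blast
  then have "(\<lambda>x. of_real (1 / M\<^sup>2) * cnj (g x) * (1 / (1 - q x))) \<in> C_ap"
    by (intro Cap_mult Cap_const Cap_cnj g)
  moreover have "of_real (1 / M\<^sup>2) * cnj (g x) * (1 / (1 - q x)) = 1 / g x" for x
  proof -
    have "g x \<noteq> 0" using e(1) e(2)[of x] by auto
    then show ?thesis using M by (simp add: q_def divide_simps)
  qed
  ultimately show ?thesis by simp
qed

section \<open>Approximate eigenvectors of multiplication operators\<close>

text \<open>Sums of at most \<open>n\<close> elements of \<open>S\<close> with repetitions: balls in
  the semigroup generated by \<open>S\<close>. Translation by an element of \<open>S\<close> maps
  each ball into the next.\<close>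

primrec folner :: "'a::real_vector set \<Rightarrow> nat \<Rightarrow> 'a set" where
  "folner S 0 = {0}"
| "folner S (Suc n) = folner S n \<union> (\<Union>\<mu>\<in>S. (+) \<mu> ` folner S n)"

lemma finite_folner: "finite S \<Longrightarrow> finite (folner S n)"
  by (induction n) auto

lemma folner_nonempty: "folner S n \<noteq> {}"
  by (induction n) auto

text \<open>Addition is commutative, so a sum is determined by the multiplicities of the elements of
  \<open>S\<close>, each at most \<open>n\<close>. Hence the growth is polynomial.\<close>

lemma card_folner:
  assumes S: "finite S" shows "card (folner S n) \<le> Suc n ^ card S"
proof -
  let ?h = "\<lambda>k. \<Sum>\<mu>\<in>S. real (k \<mu>) *\<^sub>R \<mu>"
  have "folner S n \<subseteq> ?h ` (S \<rightarrow>\<^sub>E {..n})"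
  proof (induction n)
    case 0
    have "0 \<in> ?h ` (S \<rightarrow>\<^sub>E {..0})"
      by (rule image_eqI[of _ _ "\<lambda>\<mu>\<in>S. 0"]) auto
    then show ?case by simp
  next
    case (Suc n)
    have sub: "S \<rightarrow>\<^sub>E {..n} \<subseteq> S \<rightarrow>\<^sub>E {..Suc n}" by (intro PiE_mono) auto
    have "\<mu> + x \<in> ?h ` (S \<rightarrow>\<^sub>E {..Suc n})" if \<mu>: "\<mu> \<in> S" and x: "x \<in> folner S n" for \<mu> x
    proof -
      obtain k where k: "k \<in> S \<rightarrow>\<^sub>E {..n}" "x = ?h k" using Suc x by blast
      let ?k = "k(\<mu> := Suc (k \<mu>))"
      have "(\<Sum>\<nu>\<in>S - {\<mu>}. real (?k \<nu>) *\<^sub>R \<nu>) = (\<Sum>\<nu>\<in>S - {\<mu>}. real (k \<nu>) *\<^sub>R \<nu>)"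
        by (rule sum.cong) auto
      then have "?h ?k = \<mu> + ?h k"
        unfolding sum.remove[OF S \<mu>] by (simp add: scaleR_add_left)
      moreover have "?k \<in> S \<rightarrow>\<^sub>E {..Suc n}"
        using k(1) \<mu> by (fastforce simp: PiE_iff extensional_def intro: le_SucI)
      ultimately show ?thesis using k(2) by (intro image_eqI[of _ ?h ?k]) simp_all
    qed
    moreover have "folner S n \<subseteq> ?h ` (S \<rightarrow>\<^sub>E {..Suc n})"
      by (rule subset_trans[OF Suc image_mono[OF sub]])
    ultimately show ?case unfolding folner.simps by blast
  qed
  then have "card (folner S n) \<le> card (S \<rightarrow>\<^sub>E {..n})"
    by (rule surj_card_le[rotated]) (simp add: finite_PiE S)
  then show ?thesis using S by (simp add: card_PiE)
qed

text \<open>By Bernoulli's inequality \<open>(1 + d)\<^bsup>(k+1)m\<^esup> \<ge> (1 + md)\<^bsup>k+1\<^esup>\<close>.\<close>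

lemma power_exceeds_polynomial:
  fixes d :: real assumes d: "d > 0" shows "\<exists>n. real (Suc n ^ k) < (1 + d) ^ n"
proof -
  \<comment> \<open>\<open>C\<close> is chosen, independently of \<open>m\<close>, for
    \<open>n + 1 \<le> C * (1 + m * d)\<close>; the choice of \<open>m\<close> then absorbs
    \<open>C ^ k\<close> into one more factor \<open>1 + m * d\<close>.\<close>
  define C where "C = real (Suc k) / d + 1"
  obtain m :: nat where m: "C ^ k / d < real m" using reals_Archimedean2 by blast
  define n where "n = m * Suc k"
  have "real (Suc n) \<le> C * (1 + real m * d)"
    using d by (simp add: n_def C_def field_simps)
  then have "real (Suc n) ^ k \<le> C ^ k * (1 + real m * d) ^ k"
    unfolding power_mult_distrib[symmetric] by (rule power_mono) simp
  also have "\<dots> < (1 + real m * d) * (1 + real m * d) ^ k"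
    using m d by (intro mult_strict_right_mono zero_less_power) (auto simp: field_simps add_pos_nonneg)
  also have "\<dots> = (1 + real m * d) ^ Suc k" by simp
  also have "\<dots> \<le> ((1 + d) ^ m) ^ Suc k"
    using Bernoulli_inequality[of d m] d by (intro power_mono) auto
  also have "\<dots> = (1 + d) ^ n" by (simp only: n_def power_mult)
  finally show ?thesis by auto
qed

text \<open>If each ball exceeded the previous one by the factor \<open>1 + d\<close>, their sizes
  would grow exponentially, against the polynomial bound \<open>card_folner\<close>.\<close>

lemma folner_growth:
  assumes S: "finite S" and d: "d > 0"
  shows "\<exists>n. real (card (folner S (Suc n))) \<le> (1 + d) * real (card (folner S n))"
proof (rule ccontr)
  assume "\<not> ?thesis"
  then have g: "(1 + d) * real (card (folner S n)) < real (card (folner S (Suc n)))" for n by (auto simp: not_le)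
  have lower: "(1 + d) ^ n \<le> real (card (folner S n))" for n
  proof (induction n)
    case (Suc n)
    have "(1 + d) ^ Suc n \<le> (1 + d) * real (card (folner S n))" using Suc d by simp
    then show ?case using g[of n] by linarith
  qed simp
  obtain n where "real (Suc n ^ card S) < (1 + d) ^ n" using power_exceeds_polynomial[OF d] by blast
  also note lower[of n]
  also have "real (card (folner S n)) \<le> real (Suc n ^ card S)"
    using card_folner[OF S] of_nat_mono by blast
  finally show False by simp
qed

text \<open>
  The normalised sum \<open>\<Sum>\<^bsub>\<nu>\<in>B\<^esub> cnj (e\<^sub>\<nu>(x0)) e\<^sub>\<nu>\<close> over a Folner set \<open>B\<close> of the group generated by \<open>S\<close>
  is almost multiplied by \<open>e\<^sub>\<mu>(x0)\<close> under multiplication by \<open>e\<^sub>\<mu>\<close>, since \<open>\<mu> + B\<close> is almost \<open>B\<close>.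
\<close>

lemma approx_eigenvector_expc:
  fixes S :: "(real^'n) set"
  assumes S: "finite S" and e: "e > 0"
  shows "\<exists>\<phi>\<in>TP. norm (to_B2 \<phi>) = 1 \<and>
    (\<forall>\<mu>\<in>S. norm (mult_B2 (expc \<mu>) (to_B2 \<phi>) - expc \<mu> x0 *\<^sub>C to_B2 \<phi>) \<le> e)"
proof -
  \<comment> \<open>The squared error will be at most \<open>2 * d\<close>.\<close>
  define d where "d = e\<^sup>2 / 2"
  have d: "d > 0" using e by (simp add: d_def)
  obtain n where n: "real (card (folner S (Suc n))) \<le> (1 + d) * real (card (folner S n))"
    using folner_growth[OF S d] by blast
  define B B' where "B = folner S n" and "B' = folner S (Suc n)"
  have fin: "finite B" "finite B'" using finite_folner[OF S] unfolding B_def B'_def by blast+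
  define b where "b = real (card B)"
  have b: "b > 0" using fin folner_nonempty[of S n] by (simp add: b_def B_def card_gt_0_iff)
  define c where "c \<nu> = cnj (expc \<nu> x0) / of_real (sqrt b)" for \<nu>
  have nc: "(norm (c \<nu>))\<^sup>2 = 1 / b" for \<nu>
    using b by (simp add: c_def norm_divide power_divide)
  define u where "u = (\<Sum>\<nu>\<in>B. c \<nu> *\<^sub>C to_B2 (expc \<nu>))"
  have u: "u = to_B2 (\<lambda>x. \<Sum>\<nu>\<in>B. c \<nu> * expc \<nu> x)" by (simp add: u_def to_B2_TP_sum fin)
  have "(norm u)\<^sup>2 = b * (1 / b)" by (simp add: u_def norm_expc_sum fin nc b_def)
  also have "\<dots> = 1" using b by simp
  finally have "(norm u)\<^sup>2 = 1" .
  then have nu: "norm u = 1" using norm_ge_zero[of u] by (auto simp: power2_eq_1_iff)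
  have "norm (mult_B2 (expc \<mu>) u - expc \<mu> x0 *\<^sub>C u) \<le> e" if \<mu>: "\<mu> \<in> S" for \<mu>
  proof -
    have BB: "B \<subseteq> B'" "(+) \<mu> ` B \<subseteq> B'" using \<mu> by (auto simp: B_def B'_def)
    interpret M: bounded_linear "mult_B2 (expc \<mu>)" by (rule bounded_linear_mult_B2[OF TP_Cap[OF expc_TP]])
    \<comment> \<open>As \<open>expc \<mu> x0\<close> has modulus 1, the shifted sum and the
      multiple of \<open>u\<close> get the same coefficients and differ only in their frequency
      sets, \<open>\<mu> + B\<close> and \<open>B\<close>.\<close>
    have c: "c \<nu> = expc \<mu> x0 * c (\<mu> + \<nu>)" for \<nu>
      by (simp add: c_def expc_add complex_norm_square[symmetric] mult.assoc[symmetric])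
    have "mult_B2 (expc \<mu>) u = (\<Sum>\<nu>\<in>B. c \<nu> *\<^sub>C to_B2 (expc (\<mu> + \<nu>)))"
      by (simp add: u_def M.sum mult_B2_scaleC TP_Cap expc_TP mult_B2_expc)
    also have "\<dots> = (\<Sum>\<nu>\<in>(+) \<mu> ` B. (expc \<mu> x0 * c \<nu>) *\<^sub>C to_B2 (expc \<nu>))"
      by (subst sum.reindex) (simp_all add: c[symmetric])
    also have "\<dots> = (\<Sum>\<nu>\<in>B'. (of_bool (\<nu> \<in> (+) \<mu> ` B) * (expc \<mu> x0 * c \<nu>)) *\<^sub>C to_B2 (expc \<nu>))"
      using BB fin by (intro sum.mono_neutral_cong_left) auto
    finally have 1: "mult_B2 (expc \<mu>) u = \<dots>" .
    have "expc \<mu> x0 *\<^sub>C u = (\<Sum>\<nu>\<in>B. (expc \<mu> x0 * c \<nu>) *\<^sub>C to_B2 (expc \<nu>))"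
      by (simp add: u_def scaleC_sum_right scaleC_scaleC)
    also have "\<dots> = (\<Sum>\<nu>\<in>B'. (of_bool (\<nu> \<in> B) * (expc \<mu> x0 * c \<nu>)) *\<^sub>C to_B2 (expc \<nu>))"
      using BB fin by (intro sum.mono_neutral_cong_left) auto
    finally have 2: "expc \<mu> x0 *\<^sub>C u = \<dots>" .
    have "(norm (mult_B2 (expc \<mu>) u - expc \<mu> x0 *\<^sub>C u))\<^sup>2 =
        (\<Sum>\<nu>\<in>B'. (norm ((of_bool (\<nu> \<in> (+) \<mu> ` B) - of_bool (\<nu> \<in> B)) * (expc \<mu> x0 * c \<nu>)))\<^sup>2)"
      unfolding 1 2 sum_subtractf[symmetric] scaleC_diff_left[symmetric] left_diff_distrib[symmetric]
      by (rule norm_expc_sum[OF fin(2)])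
    \<comment> \<open>A term survives only where the frequency is missing from one of the two sets,
      and then contributes \<open>1 / b\<close>.\<close>
    also have "\<dots> \<le> (\<Sum>\<nu>\<in>B'. (of_bool (\<nu> \<notin> (+) \<mu> ` B) + of_bool (\<nu> \<notin> B)) * (1 / b))"
      unfolding norm_mult power_mult_distrib nc norm_expc using b
      by (intro sum_mono) (auto simp: of_bool_def)
    also have "\<dots> = (real (card (B' - (+) \<mu> ` B)) + real (card (B' - B))) / b"
    proof -
      have "(\<Sum>\<nu>\<in>B'. of_bool (\<nu> \<notin> Q)) = real (card (B' - Q))" for Q
        using fin by (simp add: of_bool_def sum.If_cases set_diff_eq Int_def)
      then show ?thesis unfolding sum_distrib_right[symmetric] sum.distrib by simp
    qed
    also have "\<dots> = 2 * (real (card B') - b) / b"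
    proof -
      have "real (card (B' - Q)) = real (card B') - b" if "Q \<subseteq> B'" "card Q = card B" for Q
        using that fin card_mono[OF fin(2) that(1)]
        by (simp add: card_Diff_subset finite_subset of_nat_diff b_def)
      then show ?thesis using BB by (simp add: card_image)
    qed
    also have "\<dots> \<le> 2 * d" using n b by (simp add: B_def[symmetric] B'_def[symmetric] b_def[symmetric] field_simps del: folner.simps)
    also have "\<dots> = e\<^sup>2" by (simp add: d_def)
    finally show ?thesis by (rule power2_le_imp_le) (use e in simp)
  qed
  then show ?thesis using nu TP_I[OF fin(1), of c] unfolding u by blast
qed

text \<open>Replacing \<open>g\<close> by a trigonometric polynomial \<open>p\<close> leaves three
  errors of at most \<open>e / 4\<close>: that of \<open>p\<close> itself, where the tolerance
  \<open>e / (4 * K)\<close> offsets the coefficients, and those of \<open>p - g\<close> as an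
  operator and at \<open>x0\<close>.\<close>

lemma approx_eigenvector:
  fixes g :: "real^'n \<Rightarrow> complex"
  assumes g: "g \<in> C_ap" and e: "e > 0"
  shows "\<exists>\<phi>\<in>TP. norm (to_B2 \<phi>) = 1 \<and> norm (mult_B2 g (to_B2 \<phi>) - g x0 *\<^sub>C to_B2 \<phi>) < e"
proof -
  obtain p where p: "p \<in> TP" "\<And>x. norm (p x - g x) < e / 4" using Cap_approx[OF g, of "e / 4"] e by auto
  obtain S c where S: "finite S" "p = (\<lambda>x. \<Sum>\<mu>\<in>S. c \<mu> * expc \<mu> x)" using TP_D p(1) by blast
  define K where "K = (\<Sum>\<mu>\<in>S. norm (c \<mu>)) + 1"
  have K: "K > 0" by (simp add: K_def add_nonneg_pos sum_nonneg)
  obtain \<phi> where \<phi>: "\<phi> \<in> TP" "norm (to_B2 \<phi>) = 1"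
    and app: "\<And>\<mu>. \<mu> \<in> S \<Longrightarrow> norm (mult_B2 (expc \<mu>) (to_B2 \<phi>) - expc \<mu> x0 *\<^sub>C to_B2 \<phi>) \<le> e / (4 * K)"
    using approx_eigenvector_expc[OF S(1), of "e / (4 * K)" x0] e K by auto
  define u where "u = to_B2 \<phi>"
  have C: "expc \<mu> \<in> C_ap" for \<mu> by (rule TP_Cap[OF expc_TP])
  have "mult_B2 p u = (\<Sum>\<mu>\<in>S. c \<mu> *\<^sub>C mult_B2 (expc \<mu>) u)"
    unfolding S(2) by (subst mult_B2_sum[OF S(1)]) (simp_all add: C Cap_cmult mult_B2_cmult)
  moreover have "p x0 *\<^sub>C u = (\<Sum>\<mu>\<in>S. c \<mu> *\<^sub>C (expc \<mu> x0 *\<^sub>C u))"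
    using module.scale_sum_left[OF module_scaleC, of "\<lambda>\<mu>. c \<mu> * expc \<mu> x0" S u] by (simp add: S(2) scaleC_scaleC)
  ultimately have "mult_B2 p u - p x0 *\<^sub>C u = (\<Sum>\<mu>\<in>S. c \<mu> *\<^sub>C (mult_B2 (expc \<mu>) u - expc \<mu> x0 *\<^sub>C u))"
    by (simp add: sum_subtractf scaleC_diff_right)
  also have "norm \<dots> \<le> (\<Sum>\<mu>\<in>S. norm (c \<mu>) * (e / (4 * K)))"
  proof (rule sum_norm_le)
    fix \<mu> assume "\<mu> \<in> S"
    then show "norm (c \<mu> *\<^sub>C (mult_B2 (expc \<mu>) u - expc \<mu> x0 *\<^sub>C u)) \<le> norm (c \<mu>) * (e / (4 * K))"
      unfolding norm_scaleC u_def by (intro mult_left_mono app norm_ge_zero)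
  qed
  also have "\<dots> \<le> K * (e / (4 * K))"
    unfolding sum_distrib_right[symmetric] using e K by (intro mult_right_mono) (auto simp: K_def)
  also have "\<dots> = e / 4" using K by simp
  finally have 1: "norm (mult_B2 p u - p x0 *\<^sub>C u) \<le> e / 4" .
  have "norm (mult_B2 (\<lambda>x. p x - g x) u) \<le> e / 4 * norm u"
    using p(2) by (intro norm_mult_B2_le Cap_diff TP_Cap p(1) g) (simp add: less_imp_le)
  then have 2: "norm (mult_B2 p u - mult_B2 g u) \<le> e / 4"
    using \<phi>(2) by (simp add: mult_B2_diff TP_Cap p(1) g u_def)
  have 3: "norm ((p x0 - g x0) *\<^sub>C u) \<le> e / 4"
    using p(2)[of x0] \<phi>(2) by (simp add: norm_scaleC u_def)
  have "mult_B2 g u - g x0 *\<^sub>C u =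
      (mult_B2 p u - p x0 *\<^sub>C u) - (mult_B2 p u - mult_B2 g u) + (p x0 - g x0) *\<^sub>C u"
    by (simp add: scaleC_diff_left)
  also have "norm \<dots> \<le> e / 4 + e / 4 + e / 4"
    by (intro norm_triangle_mono order_trans[OF norm_triangle_ineq4 add_mono] 1 2 3)
  finally have "norm (mult_B2 g u - g x0 *\<^sub>C u) \<le> e / 4 + e / 4 + e / 4" .
  then show ?thesis using \<phi> e unfolding u_def by (intro bexI[of _ \<phi>] conjI) auto
qed

section \<open>Spectrum of multiplication by an almost periodic function\<close>

definition mult_graph :: "(real^'n \<Rightarrow> complex) \<Rightarrow> ('n B2 \<times> 'n B2) set" where
  "mult_graph b = {(u, mult_B2 b u) | u. True}"

lemma op_shift_mult_graph:
  "b \<in> C_ap \<Longrightarrow> (u, w) \<in> op_shift (mult_graph b) s \<longleftrightarrow> w = mult_B2 (\<lambda>x. b x - s) u"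
  by (auto simp: op_shift_iff mult_graph_def mult_B2_diff Cap_const mult_B2_const algebra_simps)

text \<open>Off the closure of the range, \<open>b - s\<close> is bounded away from 0, so its
  reciprocal lies in \<open>C_ap\<close> and multiplication by it is the bounded inverse.\<close>

lemma mult_spectrum_subset:
  assumes b: "b \<in> C_ap" shows "spectrum (mult_graph b) \<subseteq> closure (range b)"
proof (rule subsetI, rule ccontr)
  fix s assume s: "s \<in> spectrum (mult_graph b)" "s \<notin> closure (range b)"
  obtain e where "e > 0" "\<forall>z\<in>range b. \<not> dist z s < e"
    using s(2) unfolding closure_approachable by blast
  then have e: "e > 0" "e \<le> norm (b x - s)" for x
    by (auto simp: dist_norm not_less)
  define g where "g x = b x - s" for x
  have C: "g \<in> C_ap" unfolding g_def by (intro Cap_diff b Cap_const)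
  have I: "(\<lambda>x. 1 / g x) \<in> C_ap" using e by (intro Cap_inverse[OF C, of e]) (auto simp: g_def)
  have "g x \<noteq> 0" for x using e(1) e(2)[of x] by (auto simp: g_def)
  then have inv: "mult_B2 (\<lambda>x. 1 / g x) (mult_B2 g u) = u" "mult_B2 g (mult_B2 (\<lambda>x. 1 / g x) u) = u" for u
    using mult_B2_const[of 1 u] by (simp_all add: mult_B2_mult C I)
  have A: "(u, w) \<in> op_shift (mult_graph b) s \<longleftrightarrow> w = mult_B2 g u" for u w
    by (simp add: op_shift_mult_graph[OF b] g_def[abs_def])
  obtain D where D: "\<And>w. norm (mult_B2 (\<lambda>x. 1 / g x) w) \<le> norm w * D"
    using bounded_linear.bounded[OF bounded_linear_mult_B2[OF I]] by blast
  have "\<forall>w. \<exists>!u. (u, w) \<in> op_shift (mult_graph b) s"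
    unfolding A using inv by metis
  moreover have "\<forall>(u, w)\<in>op_shift (mult_graph b) s. norm u \<le> D * norm w"
    using A D inv by (auto simp: mult.commute) (metis inv(1))
  ultimately have "s \<notin> spectrum (mult_graph b)" unfolding spectrum_def by blast
  with s show False by blast
qed

text \<open>The adjoint is multiplication by \<open>cnj (b - s)\<close>, which is small at some
  \<open>x0\<close>, so an approximate eigenvector \<phi> for that value has a small image.
  Modulation is isometric and commutes with the adjoint; as there are infinitely many frequencies,
  some modulation of \<phi> is almost orthogonal to \<open>E\<close>.\<close>

lemma mult_ess_spectrum:
  fixes b :: "real^'n \<Rightarrow> complex"
  assumes b: "b \<in> C_ap" shows "closure (range b) \<subseteq> ess_spectrum (mult_graph b)"
proof
  fix s assume s: "s \<in> closure (range b)"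
  have "\<not> fredholm (op_shift (mult_graph b) s)"
  proof (rule not_fredholm)
    fix e :: real and E :: "'n B2 set" assume e: "e > 0" and E: "finite E"
    have "e / 2 > 0" using e by simp
    then obtain x0 where x0: "norm (b x0 - s) < e / 2"
      using s unfolding closure_approachable dist_norm by blast
    define h where "h x = cnj (b x - s)" for x
    have h: "h \<in> C_ap" unfolding h_def by (intro Cap_cnj Cap_diff b Cap_const)
    have C: "expc \<mu> \<in> C_ap" for \<mu> :: "real^'n" by (rule TP_Cap[OF expc_TP])
    obtain \<phi> where \<phi>: "\<phi> \<in> TP" "norm (to_B2 \<phi>) = 1" "norm (mult_B2 h (to_B2 \<phi>) - h x0 *\<^sub>C to_B2 \<phi>) < e / 2"
      using approx_eigenvector[OF h, of "e / 2" x0] e by auto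
    have "norm (h x0 *\<^sub>C to_B2 \<phi>) < e / 2"
      using x0 unfolding norm_scaleC h_def complex_mod_cnj \<phi>(2) by simp
    then have small: "norm (mult_B2 h (to_B2 \<phi>)) < e"
      using \<phi>(3) norm_triangle_ineq2[of "mult_B2 h (to_B2 \<phi>)" "h x0 *\<^sub>C to_B2 \<phi>"] by simp
    have "infinite (UNIV :: (real^'n) set)"
      using finite_imp_not_open[of "UNIV :: (real^'n) set"] by auto
    moreover have "finite (\<Union>f\<in>E. {\<kappa>. norm (cinner f (to_B2 (\<lambda>x. expc \<kappa> x * \<phi> x))) \<ge> e})"
      using finite_modulated_coeffs[OF \<phi>(1) e] E by simp
    ultimately have "\<not> UNIV \<subseteq> (\<Union>f\<in>E. {\<kappa>. norm (cinner f (to_B2 (\<lambda>x. expc \<kappa> x * \<phi> x))) \<ge> e})"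
      using finite_subset by blast
    then obtain \<kappa> where "\<kappa> \<notin> (\<Union>f\<in>E. {\<kappa>. norm (cinner f (to_B2 (\<lambda>x. expc \<kappa> x * \<phi> x))) \<ge> e})"
      by blast
    then have \<kappa>: "\<forall>f\<in>E. norm (cinner f (to_B2 (\<lambda>x. expc \<kappa> x * \<phi> x))) < e" by (auto simp: not_le)
    define x where "x = mult_B2 (expc \<kappa>) (to_B2 \<phi>)"
    have x: "x = to_B2 (\<lambda>x. expc \<kappa> x * \<phi> x)" by (simp add: x_def mult_B2_to_B2 C TP_Cap \<phi>(1))
    have "mult_B2 h x = mult_B2 (expc \<kappa>) (mult_B2 h (to_B2 \<phi>))"
      by (simp add: x_def mult_B2_mult C h mult.commute)
    then have "norm (mult_B2 h x) < e" using small by (simp add: norm_mult_B2_expc)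
    moreover have "norm x = 1" by (simp add: x_def norm_mult_B2_expc \<phi>(2))
    moreover have "cinner v x = cinner u (mult_B2 h x)" if "(u, v) \<in> op_shift (mult_graph b) s" for u v
      using that cinner_mult_B2[OF Cap_diff[OF b Cap_const], of s u x]
      by (simp add: op_shift_mult_graph[OF b] h_def[abs_def])
    ultimately show "\<exists>x y. norm x = 1 \<and> norm y < e \<and>
        (\<forall>(u, v)\<in>op_shift (mult_graph b) s. cinner v x = cinner u y) \<and> (\<forall>f\<in>E. norm (cinner f x) < e)"
      using \<kappa> unfolding x by blast
  qed
  then show "s \<in> ess_spectrum (mult_graph b)" by (simp add: ess_spectrum_def)
qed

theorem proposition6p8:
  fixes \<rho> \<delta> m :: real and a :: "(real^'n) \<times> (real^'n) \<Rightarrow> complex"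
  assumes "0 < \<rho>" "\<rho> \<le> 1" "0 \<le> \<delta>" "\<delta> < 1" "\<delta> \<le> \<rho>"
    and "a \<in> APS m \<rho> \<delta>"
  shows "(\<forall>b :: real^'n \<Rightarrow> complex. (\<forall>x \<xi>. a (x, \<xi>) = b x) \<longrightarrow>
            spectrum (closure (psd_op a)) = closure (range b) \<and>
            ess_spectrum (closure (psd_op a)) = closure (range b)) \<and>
         (\<forall>b :: real^'n \<Rightarrow> real. (\<forall>x \<xi>. a (x, \<xi>) = complex_of_real (b \<xi>)) \<longrightarrow>
            spectrum (closure (psd_op a)) = closure (range (\<lambda>\<xi>. complex_of_real (b \<xi>))) \<and>
            ess_spectrum (closure (psd_op a)) = closure (range (\<lambda>\<xi>. complex_of_real (b \<xi>))) \<and>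
            point_spectrum (closure (psd_op a)) = range (\<lambda>\<xi>. complex_of_real (b \<xi>)) \<and>
            cont_spectrum (closure (psd_op a)) =
              closure (range (\<lambda>\<xi>. complex_of_real (b \<xi>))) - range (\<lambda>\<xi>. complex_of_real (b \<xi>)))"
proof (intro conjI allI impI)
  let ?T = "closure (psd_op a)"
  have ess: "ess_spectrum ?T \<subseteq> spectrum ?T" by (rule ess_spectrum_subset_spectrum) simp
  {
    fix b :: "real^'n \<Rightarrow> complex" assume ab: "\<forall>x \<xi>. a (x, \<xi>) = b x"
    then have a: "a = (\<lambda>(x, \<xi>). b x)" by auto
    have b: "b \<in> C_ap" using assms(6) ab by (simp add: APS_def)
    have T: "?T = mult_graph b" unfolding a mult_graph_def by (rule closure_psd_op_mult[OF b])
    show "spectrum ?T = closure (range b)" "ess_spectrum ?T = closure (range b)"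
      using ess mult_spectrum_subset[OF b] mult_ess_spectrum[OF b] unfolding T by blast+
  next
    fix b :: "real^'n \<Rightarrow> real" assume ab: "\<forall>x \<xi>. a (x, \<xi>) = complex_of_real (b \<xi>)"
    let ?\<beta> = "\<lambda>\<xi>. complex_of_real (b \<xi>)"
    have "a = (\<lambda>(x, \<xi>). ?\<beta> \<xi>)" using ab by auto
    then have T: "?T = closure (multiplier ?\<beta>)" by (simp add: multiplier_def)
    have "continuous_on UNIV a" using assms(6) C_k.simps(1) unfolding APS_def C_inf_def by blast
    then have "continuous_on UNIV (\<lambda>\<xi>. a (0, \<xi>))"
      by (rule continuous_on_compose2) (auto intro!: continuous_intros)
    then have cont: "continuous_on UNIV ?\<beta>" using ab by simp
    show sp: "spectrum ?T = closure (range ?\<beta>)" and "ess_spectrum ?T = closure (range ?\<beta>)"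
      using ess multiplier_spectrum_subset[of ?\<beta>] multiplier_ess_spectrum[OF cont] unfolding T by blast+
    show pt: "point_spectrum ?T = range ?\<beta>" unfolding T by (rule multiplier_point_spectrum)
    \<comment> \<open>Injectivity excludes exactly the point spectrum, and there the dense range
      comes from \<open>multiplier_dense_range\<close>.\<close>
    show "cont_spectrum ?T = closure (range ?\<beta>) - range ?\<beta>"
      using sp pt multiplier_dense_range[of _ ?\<beta>] unfolding T cont_spectrum_def point_spectrum_def by auto
  }
qed

end
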